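(* Let $0<p<\infty$ and $\alpha>1$, and let $\mu$ be a positive Borel measure on $[0,1)$ such that $\mu$ is a $1/p$-Carleson measure if $0<p\le1$, and $\mu$ is a $1$-Carleson measure if $1<p<\infty$. (i) If $q>1$ and $q\ge\alpha p$, then $\mathcal{H}_{\mu,\alpha}$ is a bounded operator from $H^p$ into $A^q_{\alpha-2}$ if and only if $\mu$ is a $(1/p+\alpha/q')$-Carleson measure, where $1/q+1/q'=1$. (ii) If $q=1$ and $q\ge p$, then $\mathcal{H}_{\mu,\alpha}$ is a bounded operator from $H^p$ into $A^1_{\alpha-2}$ if and only if $\mu$ is a $1$-logarithmic $1/p$-Carleson measure. (iii) $\mathcal{H}_{\mu,\alpha}$ is a bounded operator from $H^p$ into $\mathcal{B}$ if and only if $\mu$ is a $(1/p+\alpha)$-Carleson measure.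
   Context: $\mathbb{D}=\{z\in\mathbb{C}:|z|<1\}$ and $H(\mathbb{D})$ is the class of analytic functions on $\mathbb{D}$. For $0<p<\infty$, the Hardy space $H^p$ is the set of $f\in H(\mathbb{D})$ with $\|f\|_{H^p}=\sup_{0<r<1}\left(\frac{1}{2\pi}\int_0^{2\pi}|f(re^{i\theta})|^p\,\mathrm{d}\theta\right)^{1/p}<\infty$. For $0<q<\infty$ and $\beta>-1$, the weighted Bergman space $A^q_\beta$ is the set of $f\in H(\mathbb{D})$ with $\|f\|_{A^q_\beta}=\left((\beta+1)\int_{\mathbb{D}}|f(z)|^q(1-|z|^2)^\beta\,\mathrm{d}A(z)\right)^{1/q}<\infty$, where $\mathrm{d}A=\frac1\pi\,\mathrm{d}x\,\mathrm{d}y$. The Bloch space $\mathcal{B}$ is the set of $f\in H(\mathbb{D})$ with $\|f\|_{\mathcal{B}}=|f(0)|+\sup_{z\in\mathbb{D}}(1-|z|^2)|f'(z)|<\infty$. For $a\ge0$ and $s>0$, a positive Borel measure $\mu$ on $[0,1)$ is an $a$-logarithmic $s$-Carleson measure if there is a constant $C>0$ with $\left(\log\frac{2}{1-t}\right)^a\mu([t,1))\le C(1-t)^s$ for all $0\le t<1$; when $a=0$ it is called an $s$-Carleson measure. For $\alpha>0$ and $f(z)=\sum_{k\ge0}a_kz^k\in H(\mathbb{D})$, the generalized Hilbert operator is $$\mathcal{H}_{\mu,\alpha}(f)(z)=\sum_{n=0}^\infty\left(\sum_{k=0}^\infty\mu_{n,k,\alpha}a_k\right)z^n,\qquad \mu_{n,k,\alpha}=\int_{[0,1)}\frac{\Gamma(n+\alpha)}{n!\,\Gamma(\alpha)}t^{n+k}\,\mathrm{d}\mu(t),$$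 whenever the right-hand side makes sense and defines an analytic function in $\mathbb{D}$. An operator $T$ is bounded from $X$ into $Y$ if there is a constant $C$ with $\|Tf\|_Y\le C\|f\|_X$ for all $f\in X$. *)

theory Defs
  imports "HOL-Complex_Analysis.Complex_Analysis"
begin

(* Functions on the unit disc are total functions complex => complex of which only the
   values on ball 0 1 matter.  Norms are real-valued, and are meaningful on the
   corresponding space only: membership in the space carries the finiteness condition. *)

definition hardy_mean :: "real \<Rightarrow> (complex \<Rightarrow> complex) \<Rightarrow> real \<Rightarrow> real" where
  "hardy_mean p f r =
     (1 / (2 * pi) * (LINT \<theta>:{0..2*pi}|lborel. norm (f (of_real r * exp (\<i> * of_real \<theta>))) powr p))
       powr (1 / p)"

definition hardy_norm :: "real \<Rightarrow> (complex \<Rightarrow> complex) \<Rightarrow> real" where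
  "hardy_norm p f = (SUP r\<in>{0<..<1}. hardy_mean p f r)"

definition hardy_space :: "real \<Rightarrow> (complex \<Rightarrow> complex) set" where
  "hardy_space p = {f. f holomorphic_on ball 0 1 \<and> bdd_above (hardy_mean p f ` {0<..<1})}"

definition bergman_norm :: "real \<Rightarrow> real \<Rightarrow> (complex \<Rightarrow> complex) \<Rightarrow> real" where
  "bergman_norm q \<beta> f =
     ((\<beta> + 1) * (1 / pi * (LINT z:ball 0 1|lborel. norm (f z) powr q * (1 - (norm z)\<^sup>2) powr \<beta>)))
       powr (1 / q)"

definition bergman_space :: "real \<Rightarrow> real \<Rightarrow> (complex \<Rightarrow> complex) set" where
  "bergman_space q \<beta> =
     {f. f holomorphic_on ball 0 1 \<and>
         set_integrable lborel (ball 0 1) (\<lambda>z. norm (f z) powr q * (1 - (norm z)\<^sup>2) powr \<beta>)}"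

definition bloch_norm :: "(complex \<Rightarrow> complex) \<Rightarrow> real" where
  "bloch_norm f = norm (f 0) + (SUP z\<in>ball 0 1. (1 - (norm z)\<^sup>2) * norm (deriv f z))"

definition bloch_space :: "(complex \<Rightarrow> complex) set" where
  "bloch_space =
     {f. f holomorphic_on ball 0 1 \<and>
         bdd_above ((\<lambda>z. (1 - (norm z)\<^sup>2) * norm (deriv f z)) ` ball 0 1)}"

(* The measure is not assumed finite; taking t = 0 below shows that a Carleson measure is. *)

definition borel_measure_01 :: "real measure \<Rightarrow> bool" where
  "borel_measure_01 \<mu> \<longleftrightarrow> sets \<mu> = sets (restrict_space borel {0..<1})"

definition log_carleson :: "real \<Rightarrow> real \<Rightarrow> real measure \<Rightarrow> bool" where
  "log_carleson a s \<mu> \<longleftrightarrow>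
     (\<exists>C>0. \<forall>t\<in>{0..<1}.
        ennreal (ln (2 / (1 - t)) powr a) * emeasure \<mu> {t..<1} \<le> ennreal (C * (1 - t) powr s))"

definition carleson :: "real \<Rightarrow> real measure \<Rightarrow> bool" where
  "carleson s \<mu> \<longleftrightarrow> log_carleson 0 s \<mu>"

definition taylor_coeff :: "(complex \<Rightarrow> complex) \<Rightarrow> nat \<Rightarrow> complex" where
  "taylor_coeff f k = (deriv ^^ k) f 0 / fact k"

definition hilbert_entry :: "real measure \<Rightarrow> real \<Rightarrow> nat \<Rightarrow> nat \<Rightarrow> real" where
  "hilbert_entry \<mu> \<alpha> n k =
     (LINT t|\<mu>. Gamma (real n + \<alpha>) / (fact n * Gamma \<alpha>) * t ^ (n + k))"

definition hilbert_coeff :: "real measure \<Rightarrow> real \<Rightarrow> (complex \<Rightarrow> complex) \<Rightarrow> nat \<Rightarrow> complex" where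
  "hilbert_coeff \<mu> \<alpha> f n = (\<Sum>k. of_real (hilbert_entry \<mu> \<alpha> n k) * taylor_coeff f k)"

definition hilbert_op :: "real measure \<Rightarrow> real \<Rightarrow> (complex \<Rightarrow> complex) \<Rightarrow> complex \<Rightarrow> complex" where
  "hilbert_op \<mu> \<alpha> f z = (\<Sum>n. hilbert_coeff \<mu> \<alpha> f n * z ^ n)"

(* The right-hand side makes sense (all integrals and series converge) and is analytic. *)
definition hilbert_op_defined :: "real measure \<Rightarrow> real \<Rightarrow> (complex \<Rightarrow> complex) \<Rightarrow> bool" where
  "hilbert_op_defined \<mu> \<alpha> f \<longleftrightarrow>
     (\<forall>n k. integrable \<mu> (\<lambda>t. Gamma (real n + \<alpha>) / (fact n * Gamma \<alpha>) * t ^ (n + k))) \<and>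
     (\<forall>n. summable (\<lambda>k. of_real (hilbert_entry \<mu> \<alpha> n k) * taylor_coeff f k)) \<and>
     (\<forall>z\<in>ball 0 1. summable (\<lambda>n. hilbert_coeff \<mu> \<alpha> f n * z ^ n)) \<and>
     hilbert_op \<mu> \<alpha> f holomorphic_on ball 0 1"

(* Boundedness from the space X with norm NX into Y with norm NY of an operator T that is
   defined at f only when P f holds. *)
definition bounded_operator ::
  "('a \<Rightarrow> bool) \<Rightarrow> ('a \<Rightarrow> 'b) \<Rightarrow> 'a set \<Rightarrow> ('a \<Rightarrow> real) \<Rightarrow> 'b set \<Rightarrow> ('b \<Rightarrow> real) \<Rightarrow> bool" where
  "bounded_operator P T X NX Y NY \<longleftrightarrow>
     (\<forall>f\<in>X. P f \<and> T f \<in> Y) \<and> (\<exists>C. \<forall>f\<in>X. NY (T f) \<le> C * NX f)"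

definition hilbert_bounded ::
  "real measure \<Rightarrow> real \<Rightarrow> (complex \<Rightarrow> complex) set \<Rightarrow> ((complex \<Rightarrow> complex) \<Rightarrow> real) \<Rightarrow>
   (complex \<Rightarrow> complex) set \<Rightarrow> ((complex \<Rightarrow> complex) \<Rightarrow> real) \<Rightarrow> bool" where
  "hilbert_bounded \<mu> \<alpha> = bounded_operator (hilbert_op_defined \<mu> \<alpha>) (hilbert_op \<mu> \<alpha>)"

end

theory Submission
  imports Defs
begin

text \<open>
  Expanding $(1-tz)^{-\<alpha>}$ binomially turns the operator into the integral
  \[ H f(z) = \int_{[0,1)} \frac{f(t)}{(1-tz)^{\<alpha>}}\, d\<mu>(t), \]
  so only the values of \<open>f\<close> on the radius \<open>[0,1)\<close> and the mass that \<open>\<mu>\<close> gives to the dyadic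
  intervals \<open>[1 - h, 1 - h/2)\<close>, \<open>h = (1/2)^j\<close>, matter.  A Carleson condition of order \<open>s\<close> bounds
  that mass by a multiple of \<open>h powr s\<close>, divided by \<open>j + 1\<close> in the logarithmic case with exponent 1.

  Sufficiency rests on two facts about the maximum \<open>m\<^sub>j\<close> of \<open>norm \<circ> f\<close> over the segment
  \<open>[0, 1 - h/2]\<close>: the growth bound \<open>m\<^sub>j \<le> C * h powr (-1/p) * hardy_norm p f\<close>
  (\<open>radial_max_growth\<close>), and, for \<open>q \<ge> p\<close>, the embedding that bounds the sum of
  \<open>h powr (q/p) * m\<^sub>j powr q\<close> by \<open>C * hardy_norm p f powr q\<close> (\<open>radial_max_embedding\<close>).  Both come from
  the inequality between a power of the modulus of a holomorphic function and the Poisson integral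
  of its boundary values (\<open>norm_powr_le_Poisson_mean\<close>), which holds for every positive exponent.  The
  embedding applies it with the exponent \<open>p/2\<close>: the Poisson integral then acts on a square
  integrable function, where a Schur test sums over the dyadic scales; with the exponent \<open>p\<close> it
  would act on an integrable function and the scales would add up to a logarithm.

  For the Bloch space, growth and a geometric sum over the scales around \<open>h = 1 - norm z\<close> suffice.
  For \<open>q = 1\<close> one integrates term by term.  The integral of $|1-tz|^{-\<alpha>}(1-|z|^2)^{\<alpha>-2}$ over the disc
  is of the order of \<open>ln (2 / (1 - t))\<close>, and this is where the logarithm in the condition comes from.
  For \<open>q > 1\<close>, Hoelder's inequality over the dyadic scales splits the sum: one factor is summed
  geometrically, the other one is integrated over the disc.

  That the defining series converge for every \<open>f\<close> in the Hardy space has to be shown as well.  They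
  are Abel summable, because the dilates \<open>\<lambda>t. f (\<rho> * t)\<close> are dominated by the \<open>m\<^sub>j\<close>; their terms are
  \<open>o(1/k)\<close>; hence they converge by Tauber's theorem (\<open>moment_expansion_hardy\<close>).

  Necessity is tested on the functions \<open>peak_fun p a\<close>, whose modulus to the power \<open>p\<close> is a dilated
  Poisson kernel and whose Hardy norm is therefore at most 1.  Their images are at least
  \<open>c * (1 - a) powr (-1/p - \<alpha>) * measure \<mu> {a..<1}\<close> at the point \<open>a\<close>, and the derivatives gain another
  factor \<open>1 / (1 - a)\<close>.  Comparison with the maximal growth of Bloch and Bergman functions gives the
  Carleson condition.  For \<open>q = 1\<close> the growth bound loses the logarithm; Hardy's inequality on circles,
  integrated over the radii, keeps it, because a Beta integral turns the coefficient weights into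
  multiples of \<open>1 / (n + 1)\<close> and the sum of \<open>a ^ n / (n + 1)\<close> is at least \<open>ln (1 / (1 - a))\<close>.
\<close>

section \<open>Poisson majorants of powers of holomorphic functions\<close>

text \<open>
  Cauchy's formula for \<open>\<lambda>w. h w / (1 - cnj z * w)\<close> at the point \<open>z\<close>.  On the unit circle
  \<open>1 - cnj z * w = w * cnj (w - z)\<close>, so that the Cauchy kernel of this function is the Poisson
  kernel of \<open>h\<close>.
\<close>

lemma Poisson_integral_holomorphic:
  fixes h :: "complex \<Rightarrow> complex" and z :: complex
  assumes "continuous_on (cball 0 1) h" "h holomorphic_on ball 0 1" and z: "norm z < 1"
  shows "((\<lambda>\<theta>. of_real ((1 - (norm z)\<^sup>2) / (norm (cis \<theta> - z))\<^sup>2) * h (cis \<theta>))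
           has_integral of_real (2 * pi) * h z) {0..2*pi}"
proof -
  have nz: "1 - cnj z * w \<noteq> 0" if "w \<in> cball 0 1" for w
  proof
    assume "1 - cnj z * w = 0"
    then have "norm (cnj z * w) = 1" by auto
    moreover have "norm z * norm w \<le> norm z * 1" using that by (intro mult_left_mono) auto
    ultimately show False using z by (simp add: norm_mult)
  qed
  define g where "g w = h w / (1 - cnj z * w)" for w
  have "continuous_on (cball 0 1) g" "g holomorphic_on ball 0 1"
    unfolding g_def using assms nz by (auto intro!: continuous_intros holomorphic_intros)
  then have "((\<lambda>u. g u / (u - z)) has_contour_integral (2 * of_real pi * \<i> * g z)) (circlepath 0 1)"
    by (rule Cauchy_integral_circlepath) (use z in auto)
  then have 1: "((\<lambda>t. g (cis t) / (cis t - z) * \<i> * cis t) has_integral (2 * of_real pi * \<i> * g z)) {0..2*pi}"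
    unfolding circlepath_def by (subst (asm) has_contour_integral_part_circlepath_iff) auto
  have key: "1 - cnj z * cis t = cis t * cnj (cis t - z)" for t
    by (simp add: algebra_simps) (metis complex_norm_square mult.commute norm_cis of_real_1 one_power2)
  have one: "1 - cnj z * z = of_real (1 - (norm z)\<^sup>2)"
    by (simp add: complex_norm_square mult.commute flip: of_real_power)
  have nz2: "cis t - z \<noteq> 0" for t using z by auto
  have "((\<lambda>t. (of_real (1 - (norm z)\<^sup>2) / \<i>) * (g (cis t) / (cis t - z) * \<i> * cis t)) has_integral 
      (of_real (1 - (norm z)\<^sup>2) / \<i>) * (2 * of_real pi * \<i> * g z)) {0..2*pi}"
    by (rule has_integral_mult_right[OF 1])
  moreover have "(of_real (1 - (norm z)\<^sup>2) / \<i>) * (2 * of_real pi * \<i> * g z) = of_real (2 * pi) * h z"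
    unfolding g_def one using nz[of z] z one by (simp add: field_simps)
  moreover have "(of_real (1 - (norm z)\<^sup>2) / \<i>) * (g (cis t) / (cis t - z) * \<i> * cis t)
      = of_real ((1 - (norm z)\<^sup>2) / (norm (cis t - z))\<^sup>2) * h (cis t)" for t
  proof -
    have "of_real ((norm (cis t - z))\<^sup>2) = (cis t - z) * cnj (cis t - z)"
      by (rule complex_norm_square)
    moreover have gen: "d / \<i> * (x / (c * B) / A * \<i> * c) = d / (A * B) * x"
      if "A \<noteq> 0" "B \<noteq> 0" "c \<noteq> 0" for A B c d x :: complex
      using that by (simp add: field_simps)
    have "cnj (cis t - z) \<noteq> 0" using nz2[of t] complex_cnj_zero_iff by blast
    note gen[OF nz2[of t] this cis_neq_zero]
    ultimately show ?thesis
      unfolding g_def key of_real_divide by (simp only:)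
  qed
  ultimately show ?thesis by (simp only:)
qed

lemma Poisson_kernel_integral:
  assumes "norm z < 1"
  shows "((\<lambda>\<theta>. (1 - (norm z)\<^sup>2) / (norm (cis \<theta> - z))\<^sup>2) has_integral 2 * pi) {0..2*pi}"
proof -
  have "((\<lambda>\<theta>. of_real ((1 - (norm z)\<^sup>2) / (norm (cis \<theta> - z))\<^sup>2) * (1::complex)) has_integral of_real (2 * pi) * 1) {0..2*pi}"
    by (rule Poisson_integral_holomorphic) (use assms in auto)
  from has_integral_linear[OF this bounded_linear_Re] show ?thesis
    by (simp only: o_def mult_1_right Re_complex_of_real)
qed

lemma continuous_on_Poisson_kernel:
  assumes "norm z < 1" "continuous_on A g"
  shows "continuous_on A (\<lambda>x. (1 - (norm z)\<^sup>2) / (norm (cis (g x) - z))\<^sup>2)"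
proof -
  have "cis t \<noteq> z" for t using assms by auto
  then show ?thesis by (intro continuous_intros assms) auto
qed

text \<open>
  A function without zeros on the closed disc has a holomorphic logarithm on a slightly larger
  disc.  Thus \<open>norm (h w) powr s\<close> is the modulus of a holomorphic function, for which the Poisson
  formula holds.
\<close>

lemma norm_powr_le_Poisson_zero_free:
  fixes s :: real and h :: "complex \<Rightarrow> complex"
  assumes h: "h holomorphic_on ball 0 \<rho>" "1 < \<rho>" and nz: "\<And>w. w \<in> cball 0 1 \<Longrightarrow> h w \<noteq> 0"
    and z: "norm z < 1"
  shows "norm (h z) powr s
     \<le> 1 / (2*pi) * integral {0..2*pi} (\<lambda>\<theta>. (1 - (norm z)\<^sup>2) / (norm (cis \<theta> - z))\<^sup>2 * norm (h (cis \<theta>)) powr s)"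
proof -
  define U where "U = {w \<in> ball 0 \<rho>. h w \<noteq> 0}"
  have "open U"
  proof -
    have "open (ball 0 \<rho> \<inter> h -` (- {0}))"
      by (rule continuous_open_preimage) (use h in \<open>auto intro: holomorphic_on_imp_continuous_on\<close>)
    also have "ball 0 \<rho> \<inter> h -` (- {0}) = {w \<in> ball 0 \<rho>. h w \<noteq> 0}" by auto
    finally show ?thesis unfolding U_def .
  qed
  have sub: "cball 0 1 \<subseteq> U" unfolding U_def using assms by auto
  then obtain e where e: "e > 0" "(\<Union>x\<in>cball (0::complex) 1. cball x e) \<subseteq> U"
    using compact_subset_open_imp_cball_epsilon_subset[OF _ \<open>open U\<close>, of "cball 0 1"] by auto
  (* A point outside the unit disc is within e of its radial projection to the circle. *)
  have bU: "ball 0 (1+e) \<subseteq> U"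
  proof
    fix w :: complex assume w: "w \<in> ball 0 (1+e)"
    show "w \<in> U"
    proof (cases "norm w \<le> 1")
      case True then show ?thesis using sub by auto
    next
      case False
      then have wn: "w \<noteq> 0" by (metis norm_zero zero_le_one)
      have "w \<in> cball (w / norm w) e"
      proof -
        have "dist (w / norm w) w = norm (w * (1 / norm w - 1))"
          unfolding dist_norm by (cases "w = 0") (use False in \<open>auto simp add: algebra_simps\<close>)
        also have "\<dots> = norm w * \<bar>1 / norm w - 1\<bar>"
          by (metis (no_types, lifting) norm_mult norm_of_real of_real_1 of_real_diff of_real_divide)
        also have "\<dots> = norm w - 1" using False wn by (simp add: abs_if field_simps)
        finally show ?thesis using w by simp
      qed
      moreover have "w / norm w \<in> cball 0 1" using False by (simp add: norm_divide)
      ultimately show ?thesis using e(2) by blast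
    qed
  qed
  have holU: "h holomorphic_on ball 0 (1+e)"
    using h(1) by (rule holomorphic_on_subset) (use bU U_def in auto)
  obtain l where l: "l holomorphic_on ball 0 (1+e)" "\<And>w. w \<in> ball 0 (1+e) \<Longrightarrow> h w = exp (l w)"
  proof (rule contractible_imp_holomorphic_log[OF holU])
    show "contractible (ball (0::complex) (1 + e))" by (simp add: convex_imp_contractible)
  qed (use bU U_def in auto)
  define H where "H w = exp (of_real s * l w)" for w
  have H: "norm (H w) = norm (h w) powr s" if "w \<in> ball 0 (1+e)" for w
    using l(2)[OF that] by (simp add: H_def powr_def)
  have HH: "H holomorphic_on ball 0 (1+e)" unfolding H_def by (intro holomorphic_intros l)
  have cH: "continuous_on (cball 0 1) H"
    by (rule holomorphic_on_imp_continuous_on) (rule holomorphic_on_subset[OF HH], use e in auto)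
  have 1: "((\<lambda>\<theta>. of_real ((1 - (norm z)\<^sup>2) / (norm (cis \<theta> - z))\<^sup>2) * H (cis \<theta>))
           has_integral of_real (2 * pi) * H z) {0..2*pi}"
    by (rule Poisson_integral_holomorphic[OF cH holomorphic_on_subset[OF HH] z]) (use e in auto)
  have "2 * pi * norm (H z) = norm (integral {0..2*pi} (\<lambda>\<theta>. of_real ((1 - (norm z)\<^sup>2) / (norm (cis \<theta> - z))\<^sup>2) * H (cis \<theta>)))"
    using integral_unique[OF 1] by (simp add: norm_mult)
  also have "\<dots> \<le> integral {0..2*pi} (\<lambda>\<theta>. (1 - (norm z)\<^sup>2) / (norm (cis \<theta> - z))\<^sup>2 * norm (h (cis \<theta>)) powr s)"
  proof (rule integral_norm_bound_integral)
    show "(\<lambda>\<theta>. of_real ((1 - (norm z)\<^sup>2) / (norm (cis \<theta> - z))\<^sup>2) * H (cis \<theta>)) integrable_on {0..2*pi}"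
      using 1 by blast
    have "continuous_on {0..2*pi} (\<lambda>\<theta>. norm (H (cis \<theta>)))"
      by (intro continuous_intros continuous_on_compose2[OF cH]) auto
    then have "continuous_on {0..2*pi} (\<lambda>\<theta>. norm (h (cis \<theta>)) powr s)"
      using H e by (subst continuous_on_cong[where g="\<lambda>\<theta>. norm (H (cis \<theta>))"]) auto
    then show "(\<lambda>\<theta>. (1 - (norm z)\<^sup>2) / (norm (cis \<theta> - z))\<^sup>2 * norm (h (cis \<theta>)) powr s) integrable_on {0..2*pi}"
      by (intro integrable_continuous_real continuous_on_mult continuous_on_Poisson_kernel z continuous_on_id)
    show "norm (of_real ((1 - (norm z)\<^sup>2) / (norm (cis \<theta> - z))\<^sup>2) * H (cis \<theta>))
        \<le> (1 - (norm z)\<^sup>2) / (norm (cis \<theta> - z))\<^sup>2 * norm (h (cis \<theta>)) powr s" for \<theta>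
      using H[of "cis \<theta>"] e z by (simp add: norm_mult abs_square_le_1 del: of_real_divide of_real_diff of_real_power)
  qed
  finally show ?thesis using H[of z] e z by (simp add: field_simps)
qed

text \<open>
  A zero \<open>a\<close> of multiplicity \<open>n\<close> is removed by exchanging the factor \<open>(w - a) ^ n\<close> for
  \<open>(1 - cnj a * w) ^ n\<close>, which has the same modulus on the unit circle and is not smaller inside.
  The induction is on the number of distinct zeros.
\<close>

lemma Blaschke_zero_removal:
  fixes f :: "complex \<Rightarrow> complex"
  assumes "f holomorphic_on ball 0 \<rho>" "1 < \<rho>" "\<And>w. norm w = 1 \<Longrightarrow> f w \<noteq> 0"
  shows "\<exists>g. g holomorphic_on ball 0 \<rho> \<and> (\<forall>w\<in>cball 0 1. g w \<noteq> 0) \<and>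
    (\<forall>w. norm w = 1 \<longrightarrow> norm (g w) = norm (f w)) \<and> (\<forall>w. norm w < 1 \<longrightarrow> norm (f w) \<le> norm (g w))"
  using assms(1,3)
proof (induction "card {w\<in>cball 0 1. f w = 0}" arbitrary: f rule: less_induct)
  case less
  let ?S = "ball (0::complex) \<rho>"
  have nc: "\<not> f constant_on ?S" if "f a = 0" "norm a < 1" for a
  proof
    assume "f constant_on ?S"
    then have "f 1 = f a" unfolding constant_on_def using that assms(2) by (metis mem_ball_0 less_trans norm_one)
    then show False using less.prems(2)[of 1] that by simp
  qed
  show ?case
  proof (cases "\<exists>a. f a = 0 \<and> norm a < 1")
    case False
    then show ?thesis using less.prems by (intro exI[of _ f]) (auto simp: order.order_iff_strict)
  next
    case True
    then obtain a where a: "f a = 0" "norm a < 1" by auto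
    have aS: "a \<in> ?S" using a assms(2) by auto
    have fin: "finite {w\<in>cball 0 1. f w = 0}"
      by (rule holomorphic_compact_finite_zeros[OF less.prems(1)]) (use assms(2) nc[OF a] in auto)
    obtain g r n where g: "0 < n" "0 < r" "ball a r \<subseteq> ?S" "g holomorphic_on ball a r"
       "\<And>w. w \<in> ball a r \<Longrightarrow> f w = (w - a)^n * g w" "\<And>w. w \<in> ball a r \<Longrightarrow> g w \<noteq> 0"
      by (rule holomorphic_factor_zero_nonconstant[OF less.prems(1) open_ball connected_ball aS a(1) nc[OF a]]) (rule that)
    define G where "G w = (if w = a then g a else f w / (w - a)^n)" for w
    have Gg: "G w = g w" if "w \<in> ball a r" for w using g(5)[OF that] by (auto simp: G_def)
    have G1: "G holomorphic_on ball a r" using g(4) Gg holomorphic_cong by metis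
    have G2: "G holomorphic_on (?S - {a})"
    proof -
      have "(\<lambda>w. f w / (w - a)^n) holomorphic_on (?S - {a})"
        by (intro holomorphic_intros holomorphic_on_subset[OF less.prems(1)]) auto
      then show ?thesis by (rule holomorphic_transform) (auto simp: G_def)
    qed
    have "G holomorphic_on (?S - {a}) \<union> ball a r"
      by (rule holomorphic_on_Un[OF G2 G1]) auto
    moreover have "(?S - {a}) \<union> ball a r = ?S" using g(2,3) by (auto simp: centre_in_ball)
    ultimately have G: "G holomorphic_on ?S" by simp
    have fG: "f w = (w - a)^n * G w" for w using a g(1) by (auto simp: G_def)
    have Ga: "G a \<noteq> 0" using Gg[of a] g(2,6) by auto
    (* The induction hypothesis applies to f1, which has lost the zero a and gained none. *)
    define f1 where "f1 w = (1 - cnj a * w)^n * G w" for w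
    have nz: "1 - cnj a * w \<noteq> 0" if "w \<in> cball 0 1" for w
    proof
      assume "1 - cnj a * w = 0"
      then have "norm (cnj a * w) = 1" by auto
      moreover have "norm a * norm w \<le> norm a * 1" using that by (intro mult_left_mono) auto
      ultimately show False using a by (simp add: norm_mult)
    qed
    have f1h: "f1 holomorphic_on ?S" unfolding f1_def by (intro holomorphic_intros G)
    have sub: "{w\<in>cball 0 1. f1 w = 0} \<subseteq> {w\<in>cball 0 1. f w = 0} - {a}"
      using nz Ga by (auto simp: f1_def fG)
    have "card {w\<in>cball 0 1. f1 w = 0} < card {w\<in>cball 0 1. f w = 0}"
      by (rule psubset_card_mono[OF fin]) (use sub a in auto)
    moreover have eq: "norm (f1 w) = norm (f w)" if "norm w = 1" for w
    proof -
      have "1 - cnj a * w = w * cnj (w - a)"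
        using that by (simp add: algebra_simps) (metis complex_norm_square mult.commute of_real_1 one_power2)
      then have "norm (1 - cnj a * w) = norm (w - a)" using that by (simp add: norm_mult del: complex_cnj_diff)
      then show ?thesis by (simp add: f1_def fG norm_mult norm_power)
    qed
    moreover have "f1 w \<noteq> 0" if "norm w = 1" for w
      using eq[OF that] less.prems(2)[OF that] by (metis norm_eq_zero)
    ultimately obtain h where h: "h holomorphic_on ?S" "\<forall>w\<in>cball 0 1. h w \<noteq> 0"
       "\<forall>w. norm w = 1 \<longrightarrow> norm (h w) = norm (f1 w)" "\<forall>w. norm w < 1 \<longrightarrow> norm (f1 w) \<le> norm (h w)"
      using less.hyps[OF _ f1h] by blast
    have "norm (f w) \<le> norm (f1 w)" if w: "norm w < 1" for w
    proof -
      have "0 \<le> (1 - (norm a)\<^sup>2) * (1 - (norm w)\<^sup>2)"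
        using a w by (intro mult_nonneg_nonneg) (auto simp: abs_square_le_1)
      also have "(1 - (norm a)\<^sup>2) * (1 - (norm w)\<^sup>2) = (norm (1 - cnj a * w))\<^sup>2 - (norm (w - a))\<^sup>2"
        unfolding cmod_power2 by (simp add: power2_eq_square algebra_simps)
      finally have "(norm (w - a))\<^sup>2 \<le> (norm (1 - cnj a * w))\<^sup>2" by linarith
      then have "norm (w - a) \<le> norm (1 - cnj a * w)"
        by (rule power2_le_imp_le) auto
      then show ?thesis 
        unfolding f1_def fG[of w] norm_mult norm_power by (intro mult_right_mono power_mono) auto
    qed
    then have "norm (f w) \<le> norm (h w)" if "norm w < 1" for w using h(4) that order_trans by blast
    moreover have "norm (h w) = norm (f w)" if "norm w = 1" for w using h(3) eq that by simp
    ultimately show ?thesis using h(1,2) by blast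
  qed
qed

lemma norm_powr_le_Poisson_no_zeros_on_circle:
  fixes s :: real and f :: "complex \<Rightarrow> complex"
  assumes "f holomorphic_on ball 0 \<rho>" "1 < \<rho>" "\<And>w. norm w = 1 \<Longrightarrow> f w \<noteq> 0"
    and "norm z < 1" "0 < s"
  shows "norm (f z) powr s
     \<le> 1 / (2*pi) * integral {0..2*pi} (\<lambda>\<theta>. (1 - (norm z)\<^sup>2) / (norm (cis \<theta> - z))\<^sup>2 * norm (f (cis \<theta>)) powr s)"
proof -
  obtain g where g: "g holomorphic_on ball 0 \<rho>" "\<And>w. w\<in>cball 0 1 \<Longrightarrow> g w \<noteq> 0"
    "\<And>w. norm w = 1 \<Longrightarrow> norm (g w) = norm (f w)" "\<And>w. norm w < 1 \<Longrightarrow> norm (f w) \<le> norm (g w)"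
    using Blaschke_zero_removal[OF assms(1-3)] by blast
  have "norm (f z) powr s \<le> norm (g z) powr s"
    using g(4) assms by (intro powr_mono2) auto
  also have "\<dots> \<le> 1 / (2*pi) * integral {0..2*pi} (\<lambda>\<theta>. (1 - (norm z)\<^sup>2) / (norm (cis \<theta> - z))\<^sup>2 * norm (g (cis \<theta>)) powr s)"
    by (rule norm_powr_le_Poisson_zero_free[OF g(1) assms(2) g(2) assms(4)])
  finally show ?thesis by (simp add: g(3))
qed

text \<open>
  The kernel is that of the unit circle while \<open>f\<close> is evaluated on the circle of radius \<open>r\<close>.  It is
  thus the Poisson integral at \<open>r * z\<close> for the disc of radius \<open>r\<close>, but its kernel stays fixed when
  \<open>r\<close> varies.
\<close>

definition Poisson_mean :: "real \<Rightarrow> (complex \<Rightarrow> complex) \<Rightarrow> complex \<Rightarrow> real \<Rightarrow> real" where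
  "Poisson_mean s f z r = 1 / (2*pi) * integral {0..2*pi}
     (\<lambda>\<theta>. (1 - (norm z)\<^sup>2) / (norm (cis \<theta> - z))\<^sup>2 * norm (f (of_real r * cis \<theta>)) powr s)"

lemma continuous_on_Poisson_mean:
  assumes f: "f holomorphic_on ball 0 1" and "norm z < 1" "0 < s" "A \<subseteq> {0<..<1}"
  shows "continuous_on A (Poisson_mean s f z)"
proof -
  have cf: "continuous_on (ball 0 1) f" using f by (rule holomorphic_on_imp_continuous_on)
  have "continuous_on (A \<times> cbox 0 (2*pi))
     (\<lambda>(r,\<theta>). (1 - (norm z)\<^sup>2) / (norm (cis \<theta> - z))\<^sup>2 * norm (f (of_real r * cis \<theta>)) powr s)"
    unfolding case_prod_unfold
  proof (intro continuous_on_mult continuous_on_Poisson_kernel continuous_on_powr' continuous_intros assms(2))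
    show "continuous_on (A \<times> cbox 0 (2 * pi)) (\<lambda>x. f (of_real (fst x) * cis (snd x)))"
    proof (rule continuous_on_compose2[OF cf])
      show "continuous_on (A \<times> cbox 0 (2 * pi)) (\<lambda>x. of_real (fst x) * cis (snd x))"
        by (intro continuous_intros)
      show "(\<lambda>x. of_real (fst x) * cis (snd x)) ` (A \<times> cbox 0 (2 * pi)) \<subseteq> ball 0 1"
      proof clarify
        fix r :: real and \<theta> :: real assume "r \<in> A"
        then have "0 < r" "r < 1" using assms(4) by auto
        then show "of_real (fst (r, \<theta>)) * cis (snd (r, \<theta>)) \<in> ball 0 1" by (simp add: norm_mult)
      qed
    qed
  qed (use \<open>0 < s\<close> in auto)
  from continuous_on_mult[OF continuous_on_const integral_continuous_on_param[OF this], of "1 / (2*pi)"]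
  show ?thesis unfolding Poisson_mean_def[abs_def] cbox_interval .
qed

text \<open>
  Only finitely many circles of radius less than \<open>R < 1\<close> contain zeros of a nonconstant \<open>f\<close>.  For
  the others the zeros inside are removed by Blaschke factors, and both sides are continuous in the
  radius, so that \<open>r\<close> can be approached by good radii from above.
\<close>

lemma norm_powr_le_Poisson_mean:
  assumes f: "f holomorphic_on ball 0 1" and z: "norm z < 1" and s: "0 < s" and r: "0 < r" "r < 1"
  shows "norm (f (of_real r * z)) powr s \<le> Poisson_mean s f z r"
proof (cases "f constant_on ball 0 1")
  case True
  then obtain c where c: "\<And>w. norm w < 1 \<Longrightarrow> f w = c" by (auto simp: constant_on_def)
  have "norm (of_real r * z) < 1" using mult_strict_mono[of r 1 "norm z" 1] r z by (simp add: norm_mult)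
  moreover have "f (of_real r * cis \<theta>) = c" for \<theta> by (intro c) (use r in \<open>simp add: norm_mult\<close>)
  moreover have "integral {0..2*pi} (\<lambda>\<theta>. (1 - (norm z)\<^sup>2) / (norm (cis \<theta> - z))\<^sup>2 * norm c powr s)
      = 2 * pi * norm c powr s"
    unfolding integral_mult_left integral_unique[OF Poisson_kernel_integral[OF z]] ..
  ultimately show ?thesis
    unfolding Poisson_mean_def using c by (simp only:) simp
next
  case False
  obtain R where R: "r < R" "R < 1" using r dense by blast
  have "finite {w \<in> cball 0 R. f w = 0}"
    by (rule holomorphic_compact_finite_zeros[OF f]) (use False R in auto)
  then have fin: "finite (norm ` {w \<in> cball 0 R. f w = 0} - {r})" (is "finite ?B") by auto
  have "eventually (\<lambda>t. t \<notin> ?B) (at_right r)"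
    unfolding eventually_at_topological
    by (rule exI[of _ "- ?B"]) (use finite_imp_closed[OF fin] in blast)
  moreover have "eventually (\<lambda>t. t \<in> {r<..<R}) (at_right r)"
    using eventually_at_right_real[OF R(1)] by simp
  ultimately have ev: "eventually (\<lambda>t. norm (f (of_real t * z)) powr s \<le> Poisson_mean s f z t) (at_right r)"
  proof eventually_elim
    case (elim t)
    have t: "0 < t" "t < 1" using elim r R by auto
    have "norm (f (of_real t * z)) powr s
     \<le> 1 / (2*pi) * integral {0..2*pi} (\<lambda>\<theta>. (1 - (norm z)\<^sup>2) / (norm (cis \<theta> - z))\<^sup>2 * norm (f (of_real t * cis \<theta>)) powr s)"
    proof (rule norm_powr_le_Poisson_no_zeros_on_circle[of "\<lambda>w. f (of_real t * w)" "1 / t"])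
      have "(\<lambda>w::complex. of_real t * w) ` ball 0 (1 / t) \<subseteq> ball 0 1"
        using t by (auto simp: norm_mult field_simps)
      moreover have "(\<lambda>w::complex. of_real t * w) holomorphic_on ball 0 (1 / t)"
        by (intro holomorphic_intros)
      ultimately have "(f \<circ> (\<lambda>w. of_real t * w)) holomorphic_on ball 0 (1 / t)"
        using holomorphic_on_compose_gen[OF _ f] by blast
      then show "(\<lambda>w. f (of_real t * w)) holomorphic_on ball 0 (1 / t)"
        unfolding o_def .
      show "f (of_real t * w) \<noteq> 0" if "norm w = 1" for w
      proof
        assume "f (of_real t * w) = 0"
        then have "norm (of_real t * w) \<in> norm ` {w \<in> cball 0 R. f w = 0}"
          using that t elim by (intro imageI) (auto simp: norm_mult)
        then show False using that t elim by (auto simp: norm_mult)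
      qed
    qed (use t s z in auto)
    then show ?case unfolding Poisson_mean_def .
  qed
  have cf: "continuous_on (ball 0 1) f" using f by (rule holomorphic_on_imp_continuous_on)
  have "continuous_on {r..R} (\<lambda>t. norm (f (of_real t * z)) powr s)"
  proof (intro continuous_on_powr' continuous_intros continuous_on_compose2[OF cf] subsetI)
    fix x assume "x \<in> (\<lambda>x. complex_of_real x * z) ` {r..R}"
    then obtain t where t: "t \<in> {r..R}" "x = of_real t * z" by auto
    then show "x \<in> ball 0 1" using mult_strict_mono[of t 1 "norm z" 1] r R z by (simp add: norm_mult)
  qed (use s in auto)
  then have "((\<lambda>t. norm (f (of_real t * z)) powr s) \<longlongrightarrow> norm (f (of_real r * z)) powr s) (at r within {r..R})"
    using R by (auto simp: continuous_on_def)
  moreover have "(Poisson_mean s f z \<longlongrightarrow> Poisson_mean s f z r) (at r within {r..R})"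
  proof -
    have "{r..R} \<subseteq> {0<..<1}" using r R by auto
    from continuous_on_Poisson_mean[OF f z s this] show ?thesis
      unfolding continuous_on_def using R by simp
  qed
  moreover have "at r within {r..R} = at_right r"
    using R by (rule_tac at_within_Icc_at_right) auto
  ultimately show ?thesis using ev by (intro tendsto_le[of "at_right r"]) auto
qed

section \<open>Kernel estimates on the circle and sums over dyadic scales\<close>

text \<open>
  The length of the shorter arc from \<open>cis \<theta>\<close> to \<open>1\<close>, for \<open>\<theta>\<close> in \<open>{0..2*pi}\<close>.
\<close>

definition circle_gap :: "real \<Rightarrow> real" where
  "circle_gap \<theta> = min \<theta> (2 * pi - \<theta>)"

text \<open>
  Jordan's inequality: the sine is concave on this interval and lies above its chord.
\<close>

lemma Jordan_sin_ge: "0 \<le> x \<Longrightarrow> x \<le> pi / 2 \<Longrightarrow> 2 / pi * x \<le> sin x"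
proof -
  assume x: "0 \<le> x" "x \<le> pi / 2"
  have "concave_on {0..pi/2} sin"
  proof (rule f''_le0_imp_concave[where f'=cos and f''="\<lambda>x. - sin x"])
    show "- sin x \<le> 0" if "x \<in> {0..pi/2}" for x :: real
      using that by (simp add: sin_ge_zero)
  qed (auto intro!: derivative_eq_intros)
  from concave_onD_Icc[OF this, of "2 / pi * x"] x show ?thesis
    by (simp add: field_simps)
qed

lemma norm_cis_minus_one_ge:
  assumes "0 \<le> \<theta>" "\<theta> \<le> 2 * pi"
  shows "2 / pi * circle_gap \<theta> \<le> norm (cis \<theta> - 1)"
proof -
  have "(norm (cis \<theta> - 1))\<^sup>2 = 2 - 2 * cos \<theta>"
    unfolding cmod_power2 using sin_cos_squared_add[of \<theta>] by (simp add: power2_eq_square algebra_simps)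
  also have "\<dots> = (2 * sin (\<theta> / 2))\<^sup>2"
    using cos_double_sin[of "\<theta> / 2"] by (simp add: power2_eq_square)
  finally have "norm (cis \<theta> - 1) = \<bar>2 * sin (\<theta> / 2)\<bar>"
    by (metis abs_norm_cancel power2_eq_iff_nonneg abs_ge_zero norm_ge_zero power2_abs)
  moreover have "2 / pi * (circle_gap \<theta> / 2) \<le> sin (circle_gap \<theta> / 2)"
    by (rule Jordan_sin_ge) (use assms in \<open>auto simp: circle_gap_def min_def\<close>)
  moreover have "sin (circle_gap \<theta> / 2) = sin (\<theta> / 2)"
    by (auto simp: circle_gap_def min_def diff_divide_distrib)
  ultimately show ?thesis by simp
qed

lemma norm_cis_minus_real_ge:
  assumes "0 \<le> \<theta>" "\<theta> \<le> 2 * pi" "0 \<le> t" "t \<le> 1"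
  shows "circle_gap \<theta> / pi \<le> norm (cis \<theta> - of_real t)" "1 - t \<le> norm (cis \<theta> - of_real t)"
proof -
  show 1: "1 - t \<le> norm (cis \<theta> - of_real t)"
    using norm_triangle_ineq2[of "cis \<theta>" "of_real t"] assms by simp
  have "norm (cis \<theta> - 1) \<le> norm (cis \<theta> - of_real t) + norm (of_real t - 1 :: complex)"
    using norm_triangle_ineq[of "cis \<theta> - of_real t" "of_real t - 1"] by simp
  moreover have "norm (of_real t - 1 :: complex) = 1 - t"
    using assms by (metis abs_minus_commute abs_of_nonneg diff_ge_0_iff_ge norm_of_real of_real_1 of_real_diff)
  ultimately have "norm (cis \<theta> - 1) \<le> 2 * norm (cis \<theta> - of_real t)" using 1 by linarith
  then have "2 / pi * circle_gap \<theta> \<le> 2 * norm (cis \<theta> - of_real t)"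
    using norm_cis_minus_one_ge[OF assms(1,2)] by linarith
  then show "circle_gap \<theta> / pi \<le> norm (cis \<theta> - of_real t)" by simp
qed

text \<open>
  The two half circles are folded onto one half-line.
\<close>

lemma nn_integral_circle_gap_le:
  assumes [measurable]: "f \<in> borel_measurable borel"
  shows "(\<integral>\<^sup>+\<theta>\<in>{0<..<2*pi}. f (circle_gap \<theta>) \<partial>lborel) \<le> 2 * (\<integral>\<^sup>+t\<in>{0<..}. f t \<partial>lborel)"
proof -
  have "(\<integral>\<^sup>+\<theta>\<in>{0<..<2*pi}. f (circle_gap \<theta>) \<partial>lborel)
      \<le> (\<integral>\<^sup>+\<theta>. f \<theta> * indicator {0<..} \<theta> + f (2*pi - \<theta>) * indicator {0<..} (2*pi - \<theta>) \<partial>lborel)"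
    by (intro nn_integral_mono) (auto simp: circle_gap_def min_def indicator_def)
  also have "\<dots> = (\<integral>\<^sup>+\<theta>\<in>{0<..}. f \<theta> \<partial>lborel) + (\<integral>\<^sup>+\<theta>. f (2*pi - \<theta>) * indicator {0<..} (2*pi - \<theta>) \<partial>lborel)"
    by (intro nn_integral_add) auto
  also have "(\<integral>\<^sup>+\<theta>. f (2*pi - \<theta>) * indicator {0<..} (2*pi - \<theta>) \<partial>lborel) = (\<integral>\<^sup>+\<theta>\<in>{0<..}. f \<theta> \<partial>lborel)"
    using nn_integral_real_affine[of "\<lambda>t. f t * indicator {0<..} t" "-1" "2*pi"] by simp
  finally show ?thesis unfolding mult_2 .
qed

text \<open>
  The terms decay geometrically on both sides of the index with \<open>2 ^ j \<approx> x\<close>, so that the sum does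
  not depend on where this index is.  All sums over dyadic scales below in which two competing bounds
  meet are brought to this form.
\<close>

lemma two_sided_geometric_sum:
  fixes a b :: real
  assumes a: "0 < a" and b: "0 < b"
  shows "\<exists>C>0. \<forall>x>0. \<forall>J. (\<Sum>j<J. min ((x * (1/2)^j) powr a) ((x * (1/2)^j) powr (-b))) \<le> C"
proof -
  define q where "q c = (1/2 :: real) powr c" for c
  have q: "0 < q c" "q c < 1" if "0 < c" for c
    using powr_less_mono2[OF that, of "1/2" 1] by (simp_all add: q_def)
  have geo: "(\<Sum>i<n. q c ^ i) \<le> 1 / (1 - q c)" if "0 < c" for c n
  proof -
    have "(\<Sum>i<n. q c ^ i) \<le> (\<Sum>i. q c ^ i)"
      using q[OF that] by (intro sum_le_suminf summable_geometric) auto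
    then show ?thesis using q[OF that] by (simp add: suminf_geometric)
  qed
  have qp: "((1/2)^i) powr c = q c ^ i" for c i
  proof -
    have "((1/2)^i) powr c = ((1/2) powr real i) powr c" by (subst powr_realpow) auto
    also have "\<dots> = ((1/2) powr c) powr real i" by (simp only: powr_powr mult.commute)
    also have "\<dots> = q c ^ i" unfolding q_def by (rule powr_realpow) simp
    finally show ?thesis .
  qed
  have "(\<Sum>j<J. min ((x * (1/2)^j) powr a) ((x * (1/2)^j) powr (-b))) \<le> 1 / (1 - q a) + 1 / (1 - q b)"
    (is "?S \<le> _") if x: "0 < x" for x J
  proof -
    let ?t = "\<lambda>j. min ((x * (1/2)^j) powr a) ((x * (1/2)^j) powr (-b))"
    have "\<exists>j. x \<le> 2 ^ j" using real_arch_pow[of 2 x] by (auto intro: less_imp_le)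
    define k where "k = (LEAST j. x \<le> 2 ^ j)"
    have k: "x \<le> 2 ^ k" unfolding k_def by (rule LeastI_ex) fact
    have k': "2 ^ j < x" if "j < k" for j using not_less_Least[of j "\<lambda>j. x \<le> 2^j"] that by (auto simp: k_def)
    have "?S \<le> sum ?t {..<k + J}" by (rule sum_mono2) auto
    also have "\<dots> = sum ?t {..<k} + (\<Sum>i<J. ?t (k + i))"
      by (induction J) (auto simp: add.assoc)
    also have "(\<Sum>i<J. ?t (k + i)) \<le> (\<Sum>i<J. q a ^ i)"
    proof (rule sum_mono)
      fix i
      have "x * (1/2)^(k+i) \<le> (1/2)^i" using k by (simp add: power_add field_simps)
      then have "(x * (1/2)^(k+i)) powr a \<le> ((1/2)^i) powr a" using x a by (intro powr_mono2) auto
      then show "?t (k + i) \<le> q a ^ i" by (simp add: qp)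
    qed
    also have "sum ?t {..<k} = (\<Sum>i<k. ?t (k - Suc i))" by (rule sum.nat_diff_reindex[symmetric])
    also have "\<dots> \<le> (\<Sum>i<k. q b ^ i)"
    proof (rule sum_mono)
      fix i assume "i \<in> {..<k}"
      then have i: "i < k" by simp
      have "2 ^ (k - Suc i) * 2 ^ i = (2::real) ^ (k - 1)" using i by (simp flip: power_add)
      also have "\<dots> \<le> x" using k'[of "k-1"] i by simp
      finally have "2 ^ i \<le> x * (1/2)^(k - Suc i)" by (simp add: field_simps power_one_over)
      then have "(x * (1/2)^(k - Suc i)) powr (-b) \<le> (2 ^ i) powr (-b)" using b by (intro powr_mono2') auto
      also have "\<dots> = ((1/2)^i) powr b" by (simp add: powr_minus powr_divide power_one_over inverse_eq_divide)
      finally show "?t (k - Suc i) \<le> q b ^ i" by (simp add: qp)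
    qed
    finally show ?thesis using geo[OF a, of J] geo[OF b, of k] by linarith
  qed
  moreover have "0 < 1 / (1 - q a) + 1 / (1 - q b)" using q[OF a] q[OF b] by (intro add_pos_pos) auto
  ultimately show ?thesis by blast
qed

text \<open>
  The function \<open>min (1 / h) (h / t\<^sup>2)\<close> models the Poisson kernel at distance \<open>h\<close> from the circle: it
  has total mass of order 1, concentrated on \<open>t \<le> h\<close>, where the weight is of order \<open>h powr (-1/2)\<close> on
  average.
\<close>

lemma nn_integral_Poisson_weight_le:
  assumes h: "0 < h"
  shows "(\<integral>\<^sup>+t\<in>{0<..}. ennreal (min (1 / h) (h / t\<^sup>2) * t powr (-1/2)) \<partial>lborel) \<le> ennreal (3 * h powr (-1/2))"
proof -
  have 1: "(\<integral>\<^sup>+t. ennreal (1 / h * t powr (-1/2)) * indicator {0..h} t \<partial>lborel) = ennreal (1 / h * (h powr (-1/2+1) / (-1/2+1)))"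
    using h by (intro nn_integral_has_integral_lebesgue' has_integral_mult_right has_integral_powr_from_0) auto
  have 2: "(\<integral>\<^sup>+t. ennreal (h * t powr (-5/2)) * indicator {h..} t \<partial>lborel) = ennreal (h * (- (h powr (-5/2+1)) / (-5/2+1)))"
    using h by (intro nn_integral_has_integral_lebesgue' has_integral_mult_right has_integral_powr_to_inf) auto
  have "(\<integral>\<^sup>+t\<in>{0<..}. ennreal (min (1 / h) (h / t\<^sup>2) * t powr (-1/2)) \<partial>lborel)
     \<le> (\<integral>\<^sup>+t. ennreal (1 / h * t powr (-1/2)) * indicator {0..h} t + ennreal (h * t powr (-5/2)) * indicator {h..} t \<partial>lborel)"
  proof (rule nn_integral_mono)
    fix t :: real
    show "ennreal (min (1 / h) (h / t\<^sup>2) * t powr (-1/2)) * indicator {0<..} t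
      \<le> ennreal (1 / h * t powr (-1/2)) * indicator {0..h} t + ennreal (h * t powr (-5/2)) * indicator {h..} t"
    proof (cases "0 < t")
      case t: True
      show ?thesis
      proof (cases "t \<le> h")
        case True
        then have "ennreal (min (1 / h) (h / t\<^sup>2) * t powr (-1/2)) \<le> ennreal (1 / h * t powr (-1/2))"
          using t h by (intro ennreal_leI mult_right_mono) auto
        then show ?thesis using t True by (simp add: add_increasing2)
      next
        case False
        have "t powr (-5/2) = t powr (-1/2) / t\<^sup>2"
          using t powr_diff[of t "-1/2" 2] by simp
        then have "ennreal (min (1 / h) (h / t\<^sup>2) * t powr (-1/2)) \<le> ennreal (h * t powr (-5/2))"
          using t h mult_right_mono[of "min (1 / h) (h / t\<^sup>2)" "h / t\<^sup>2" "t powr (-1/2)"] by (intro ennreal_leI) auto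
        then show ?thesis using t False by simp
      qed
    qed simp
  qed
  also have "\<dots> = ennreal (1 / h * (h powr (-1/2+1) / (-1/2+1))) + ennreal (h * (- (h powr (-5/2+1)) / (-5/2+1)))"
    unfolding 1[symmetric] 2[symmetric] by (intro nn_integral_add) auto
  also have "\<dots> = ennreal (1 / h * (h powr (-1/2+1) / (-1/2+1)) + h * (- (h powr (-5/2+1)) / (-5/2+1)))"
    using h by (intro ennreal_plus[symmetric]) (auto simp: divide_nonneg_nonneg)
  also have "\<dots> \<le> ennreal (3 * h powr (-1/2))"
  proof (rule ennreal_leI)
    define u where "u = h powr (-1/2)"
    have hu: "h powr (1/2) = h * u" "h * h powr (-3/2) = u"
      unfolding u_def using h powr_add[of h 1 "-1/2"] powr_add[of h 1 "-3/2"] by auto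
    have "1 / h * (h powr (-1/2+1) / (-1/2+1)) = 2 * (h powr (1/2) / h)"
      "h * (- (h powr (-5/2+1)) / (-5/2+1)) = 2 / 3 * (h * h powr (-3/2))" by auto
    then have "1 / h * (h powr (-1/2+1) / (-1/2+1)) + h * (- (h powr (-5/2+1)) / (-5/2+1)) = 2 * u + 2 / 3 * u"
      unfolding hu using h by simp
    moreover have "0 \<le> u" by (simp add: u_def)
    ultimately show "1 / h * (h powr (-1/2+1) / (-1/2+1)) + h * (- (h powr (-5/2+1)) / (-5/2+1)) \<le> 3 * h powr (-1/2)"
      unfolding u_def[symmetric] by linarith
  qed
  finally show ?thesis .
qed

section \<open>Growth of Hardy space functions and their radial embedding\<close>

lemma powr_half_square: "(x powr (p / 2))\<^sup>2 = x powr (p::real)"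
  by (simp add: power2_eq_square flip: powr_add)

lemma continuous_on_circle_powr:
  assumes f: "f holomorphic_on ball 0 1" and "0 < s" "0 \<le> r" "r < 1"
  shows "continuous_on A (\<lambda>\<theta>. norm (f (of_real r * cis \<theta>)) powr s)"
proof -
  have cf: "continuous_on (ball 0 1) f" using f by (rule holomorphic_on_imp_continuous_on)
  have "continuous_on A (\<lambda>\<theta>. f (of_real r * cis \<theta>))"
  proof (rule continuous_on_compose2[OF cf])
    show "continuous_on A (\<lambda>\<theta>. of_real r * cis \<theta>)" by (intro continuous_intros)
    show "(\<lambda>\<theta>. of_real r * cis \<theta>) ` A \<subseteq> ball 0 1" using assms(3,4) by (auto simp: norm_mult)
  qed
  then show ?thesis using assms(2) by (intro continuous_on_powr' continuous_intros) auto
qed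

lemma hardy_mean_powr:
  assumes f: "f holomorphic_on ball 0 1" and p: "0 < p" and r: "0 < r" "r < 1"
  shows "integral {0..2*pi} (\<lambda>\<theta>. norm (f (of_real r * cis \<theta>)) powr p) = 2 * pi * hardy_mean p f r powr p"
proof -
  let ?g = "\<lambda>\<theta>. norm (f (of_real r * cis \<theta>)) powr p"
  have "set_integrable lborel {0..2*pi} ?g"
    by (rule borel_integrable_atLeastAtMost') (use continuous_on_circle_powr[OF f p] r in auto)
  then have eq: "(LINT \<theta>:{0..2*pi}|lborel. ?g \<theta>) = integral {0..2*pi} ?g"
    by (rule set_borel_integral_eq_integral)
  have nn: "0 \<le> integral {0..2*pi} ?g"
    using integral_nonneg[OF integrable_continuous_real[OF continuous_on_circle_powr[OF f p]], of r 0 "2*pi"] r by simp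
  have "hardy_mean p f r = (1 / (2*pi) * integral {0..2*pi} ?g) powr (1 / p)"
    unfolding hardy_mean_def eq[symmetric] by (simp add: cis_conv_exp)
  then have "hardy_mean p f r powr p = 1 / (2*pi) * integral {0..2*pi} ?g"
    using nn p by (simp add: powr_powr)
  then show ?thesis by simp
qed

lemma hardy_mean_nonneg: "0 \<le> hardy_mean p f r"
  by (simp add: hardy_mean_def)

lemma hardy_mean_le_norm:
  assumes "f \<in> hardy_space p" "0 < r" "r < 1"
  shows "hardy_mean p f r \<le> hardy_norm p f"
  unfolding hardy_norm_def using assms by (intro cSUP_upper) (auto simp: hardy_space_def)

lemma hardy_norm_nonneg:
  assumes "f \<in> hardy_space p"
  shows "0 \<le> hardy_norm p f"
  using hardy_mean_le_norm[OF assms, of "1/2"] hardy_mean_nonneg[of p f "1/2"] by simp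

lemma hardy_integral_le:
  assumes f: "f \<in> hardy_space p" and p: "0 < p" and r: "0 < r" "r < 1"
  shows "integral {0..2*pi} (\<lambda>\<theta>. norm (f (of_real r * cis \<theta>)) powr p) \<le> 2 * pi * hardy_norm p f powr p"
proof -
  have "f holomorphic_on ball 0 1" using f by (simp add: hardy_space_def)
  then show ?thesis
    using hardy_mean_powr[OF _ p r, of f] hardy_mean_le_norm[OF f r] hardy_mean_nonneg p
    by (simp add: powr_mono2)
qed

text \<open>
  For the circle of radius \<open>r\<close> the Poisson kernel at \<open>z\<close> is at most \<open>2 / (1 - norm z / r)\<close>.
\<close>

lemma norm_powr_le_circle_mean:
  assumes f: "f holomorphic_on ball 0 1" and s: "0 < s" and r: "norm z < r" "r < 1"
  shows "norm (f z) powr s \<le> 1 / (pi * (r - norm z)) * integral {0..2*pi} (\<lambda>\<theta>. norm (f (of_real r * cis \<theta>)) powr s)"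
proof -
  define w where "w = z / of_real r"
  have r0: "0 < r" using r(1) norm_ge_zero[of z] by linarith
  have w: "norm w = norm z / r" "norm w < 1" "of_real r * w = z"
    using r r0 by (auto simp: w_def norm_divide)
  have "norm (f z) powr s \<le> Poisson_mean s f w r"
    using norm_powr_le_Poisson_mean[OF f w(2) s r0 r(2)] w(3) by simp
  also have "\<dots> \<le> 1 / (2*pi) * integral {0..2*pi} (\<lambda>\<theta>. 2 / (r - norm z) * norm (f (of_real r * cis \<theta>)) powr s)"
    unfolding Poisson_mean_def
  proof (intro mult_left_mono integral_le)
    show "(\<lambda>\<theta>. (1 - (norm w)\<^sup>2) / (norm (cis \<theta> - w))\<^sup>2 * norm (f (of_real r * cis \<theta>)) powr s) integrable_on {0..2*pi}"
      using r r0 by (intro integrable_continuous_real continuous_on_mult continuous_on_Poisson_kernel w(2)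
          continuous_on_id continuous_on_circle_powr[OF f s]) auto
    show "(\<lambda>\<theta>. 2 / (r - norm z) * norm (f (of_real r * cis \<theta>)) powr s) integrable_on {0..2*pi}"
      using r r0 by (intro integrable_continuous_real continuous_on_mult continuous_on_const continuous_on_circle_powr[OF f s]) auto
    fix \<theta>
    have 1: "1 - norm w \<le> norm (cis \<theta> - w)"
      using norm_triangle_ineq2[of "cis \<theta>" w] by simp
    have "(1 - (norm w)\<^sup>2) / (norm (cis \<theta> - w))\<^sup>2 \<le> (1 - (norm w)\<^sup>2) / (1 - norm w)\<^sup>2"
      using w(2) 1 by (intro divide_left_mono power_mono mult_pos_pos) (auto simp: abs_square_le_1)
    also have "\<dots> = (1 + norm w) / (1 - norm w)"
    proof -
      have "1 - (norm w)\<^sup>2 = (1 - norm w) * (1 + norm w)" by (simp add: power2_eq_square algebra_simps)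
      then show ?thesis using w(2) by (simp add: power2_eq_square)
    qed
    also have "\<dots> \<le> 2 / (1 - norm w)" using w(2) by (intro divide_right_mono) auto
    also have "\<dots> = 2 * r / (r - norm z)" using r r0 by (simp add: w(1) field_simps)
    also have "\<dots> \<le> 2 / (r - norm z)" using r r0 by (intro divide_right_mono) auto
    finally show "(1 - (norm w)\<^sup>2) / (norm (cis \<theta> - w))\<^sup>2 * norm (f (of_real r * cis \<theta>)) powr s
       \<le> 2 / (r - norm z) * norm (f (of_real r * cis \<theta>)) powr s"
      by (rule mult_right_mono) simp
  qed simp
  also have "\<dots> = 1 / (pi * (r - norm z)) * integral {0..2*pi} (\<lambda>\<theta>. norm (f (of_real r * cis \<theta>)) powr s)"
    unfolding integral_mult_right by simp
  finally show ?thesis .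
qed

text \<open>
  The circle-mean bound for the radius half-way between \<open>norm z\<close> and 1.
\<close>

lemma hardy_growth:
  assumes f: "f \<in> hardy_space p" and p: "0 < p" and z: "norm z < 1"
  shows "norm (f z) \<le> (4 / (1 - norm z)) powr (1 / p) * hardy_norm p f"
proof -
  define r where "r = (1 + norm z) / 2"
  have r: "norm z < r" "r < 1" "0 < r" using z norm_ge_zero[of z] by (auto simp: r_def add_pos_nonneg)
  have hol: "f holomorphic_on ball 0 1" using f by (simp add: hardy_space_def)
  have "norm (f z) powr p \<le> 1 / (pi * (r - norm z)) * integral {0..2*pi} (\<lambda>\<theta>. norm (f (of_real r * cis \<theta>)) powr p)"
    by (rule norm_powr_le_circle_mean[OF hol p r(1,2)])
  also have "\<dots> \<le> 1 / (pi * (r - norm z)) * (2 * pi * hardy_norm p f powr p)"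
    using r by (intro mult_left_mono hardy_integral_le[OF f p]) auto
  also have "\<dots> = 4 / (1 - norm z) * hardy_norm p f powr p"
    using z unfolding r_def by (simp add: field_simps)
  finally have "(norm (f z) powr p) powr (1 / p) \<le> (4 / (1 - norm z) * hardy_norm p f powr p) powr (1 / p)"
    using p by (intro powr_mono2) auto
  also have "(4 / (1 - norm z) * hardy_norm p f powr p) powr (1 / p) = (4 / (1 - norm z)) powr (1 / p) * hardy_norm p f"
    using p z hardy_norm_nonneg[OF f] by (subst powr_mult) (auto simp: powr_powr)
  finally show ?thesis using p by (simp add: powr_powr)
qed

lemma borel_measurable_circle_gap [measurable]: "circle_gap \<in> borel_measurable borel"
  unfolding circle_gap_def[abs_def] by measurable

text \<open>
  The numerator is at most \<open>2 * h\<close> and the distance \<open>norm (cis \<theta> - t)\<close> is at least \<open>h / 2\<close> and at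
  least \<open>circle_gap \<theta> / pi\<close>; the constant 20 exceeds \<open>2 * pi\<^sup>2\<close> and 8.
\<close>

lemma Poisson_kernel_dyadic_le:
  assumes \<theta>: "0 < \<theta>" "\<theta> < 2 * pi" and h: "0 < h" "h \<le> 1" and t: "1 - h \<le> t" "t \<le> 1 - h / 2"
  shows "(1 - t\<^sup>2) / (norm (cis \<theta> - of_real t))\<^sup>2 \<le> 20 * min (1 / h) (h / (circle_gap \<theta>)\<^sup>2)"
proof -
  let ?K = "(1 - t\<^sup>2) / (norm (cis \<theta> - of_real t))\<^sup>2"
  have d: "0 < circle_gap \<theta>" using \<theta> by (simp add: circle_gap_def)
  have t0: "0 \<le> t" "t \<le> 1" using h t by auto
  have "1 - t\<^sup>2 = (1 - t) * (1 + t)" by (simp add: power2_eq_square algebra_simps)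
  also have "\<dots> \<le> h * 2" using t t0 h by (intro mult_mono) auto
  finally have num: "1 - t\<^sup>2 \<le> 2 * h" by simp
  have K: "?K \<le> 2 * h / x\<^sup>2" if "0 < x" "x \<le> norm (cis \<theta> - of_real t)" for x
    using that num h by (intro frac_le power_mono) auto
  have "?K \<le> 2 * h / (h / 2)\<^sup>2"
    using norm_cis_minus_real_ge(2)[of \<theta> t] \<theta> t t0 h by (intro K) auto
  also have "\<dots> = 8 * (1 / h)" using h by (simp add: power2_eq_square field_simps)
  also have "\<dots> \<le> 20 * (1 / h)" using h by (intro mult_right_mono) auto
  finally have 1: "?K \<le> 20 * (1 / h)" .
  have "?K \<le> 2 * h / (circle_gap \<theta> / pi)\<^sup>2"
    using norm_cis_minus_real_ge(1)[of \<theta> t] \<theta> t0 d by (intro K) auto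
  also have "\<dots> = 2 * pi\<^sup>2 * (h / (circle_gap \<theta>)\<^sup>2)" by (simp add: power_divide)
  also have "\<dots> \<le> 20 * (h / (circle_gap \<theta>)\<^sup>2)"
  proof (rule mult_right_mono)
    have "pi * pi \<le> 3.15 * 3.15"
      using pi_approx pi_ge_zero by (intro mult_mono) auto
    then show "2 * pi\<^sup>2 \<le> 20" by (simp add: power2_eq_square)
  qed (use h in auto)
  finally have 2: "?K \<le> 20 * (h / (circle_gap \<theta>)\<^sup>2)" .
  show ?thesis using 1 2 by (auto simp: min_def)
qed

text \<open>
  First half of the Schur test: the Cauchy-Schwarz inequality with the kernel split by the weight
  \<open>circle_gap powr (1/2)\<close> and its reciprocal.  Since the exponent is \<open>p/2\<close>, the square brings back
  \<open>norm f powr p\<close>.  The constant is \<open>2400 = 20\<^sup>2 * 2 * 3\<close>, collected from the three estimates that are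
  used.
\<close>

lemma Poisson_mean_square_le:
  assumes f: "f holomorphic_on ball 0 1" and p: "0 < p" and r: "0 < r" "r < 1"
    and h: "0 < h" "h \<le> 1" and t: "1 - h \<le> t" "t \<le> 1 - h / 2"
  shows "ennreal ((Poisson_mean (p/2) f (of_real t) r)\<^sup>2) \<le> ennreal (2400 * h powr (-1/2)) *
    (\<integral>\<^sup>+\<theta>\<in>{0<..<2*pi}. ennreal (min (1 / h) (h / (circle_gap \<theta>)\<^sup>2) * circle_gap \<theta> powr (1/2)
       * norm (f (of_real r * cis \<theta>)) powr p) \<partial>lborel)"
proof -
  define A where "A = Poisson_mean (p/2) f (of_real t) r"
  define m where "m \<theta> = min (1 / h) (h / (circle_gap \<theta>)\<^sup>2)" for \<theta>
  define g where "g \<theta> = norm (f (of_real r * cis \<theta>)) powr (p/2)" for \<theta>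
  define K where "K \<theta> = (1 - t\<^sup>2) / (norm (cis \<theta> - of_real t))\<^sup>2" for \<theta>
  have t1: "norm (of_real t :: complex) < 1" "0 \<le> t" "t < 1" using h t by auto
  have [measurable]: "m \<in> borel_measurable borel" unfolding m_def[abs_def] by measurable
  have cg: "continuous_on A g" for A
    unfolding g_def[abs_def] by (rule continuous_on_circle_powr[OF f]) (use p r in auto)
  then have [measurable]: "g \<in> borel_measurable borel" by (intro borel_measurable_continuous_onI)
  have m0: "0 \<le> m \<theta>" for \<theta> using h by (auto simp: m_def)
  have K0: "0 \<le> K \<theta>" for \<theta> using t1 by (auto simp: K_def abs_square_le_1)
  have int: "(\<lambda>\<theta>. K \<theta> * g \<theta>) integrable_on {0..2*pi}"
  proof (intro integrable_continuous_real continuous_on_mult cg)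
    show "continuous_on {0..2*pi} K"
      using continuous_on_Poisson_kernel[OF t1(1) continuous_on_id, of "{0..2*pi}"]
      by (simp add: K_def[abs_def])
  qed
  have A: "2 * pi * A = integral {0..2*pi} (\<lambda>\<theta>. K \<theta> * g \<theta>)"
    by (simp add: A_def Poisson_mean_def K_def g_def)
  moreover have "0 \<le> integral {0..2*pi} (\<lambda>\<theta>. K \<theta> * g \<theta>)"
    by (rule integral_nonneg[OF int]) (simp add: K0 g_def)
  ultimately have "0 \<le> 2 * pi * A" by simp
  then have A0: "0 \<le> A" using pi_gt_zero by (simp add: zero_le_mult_iff)
  have "((\<lambda>\<theta>. K \<theta> * g \<theta>) has_integral (2 * pi * A)) {0<..<2*pi}"
    using int unfolding A by (simp add: has_integral_Icc_iff_Ioo[symmetric] integrable_integral)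
  then have "ennreal (2 * pi * A) = (\<integral>\<^sup>+\<theta>. ennreal (K \<theta> * g \<theta>) * indicator {0<..<2*pi} \<theta> \<partial>lborel)"
    using K0 by (intro nn_integral_has_integral_lebesgue'[symmetric]) (auto simp: g_def)
  also have "\<dots> \<le> (\<integral>\<^sup>+\<theta>. ennreal 20 * ((ennreal (sqrt (m \<theta> * circle_gap \<theta> powr (-1/2))) * indicator {0<..<2*pi} \<theta>)
      * (ennreal (sqrt (m \<theta> * circle_gap \<theta> powr (1/2)) * g \<theta>) * indicator {0<..<2*pi} \<theta>)) \<partial>lborel)"
  proof (rule nn_integral_mono)
    fix \<theta>
    show "ennreal (K \<theta> * g \<theta>) * indicator {0<..<2*pi} \<theta> \<le> 
      ennreal 20 * ((ennreal (sqrt (m \<theta> * circle_gap \<theta> powr (-1/2))) * indicator {0<..<2*pi} \<theta>)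
      * (ennreal (sqrt (m \<theta> * circle_gap \<theta> powr (1/2)) * g \<theta>) * indicator {0<..<2*pi} \<theta>))"
    proof (cases "\<theta> \<in> {0<..<2*pi}")
      case True
      then have d: "0 < circle_gap \<theta>" by (auto simp: circle_gap_def)
      have "sqrt (m \<theta> * circle_gap \<theta> powr (-1/2)) * sqrt (m \<theta> * circle_gap \<theta> powr (1/2))
         = sqrt ((m \<theta> * m \<theta>) * (circle_gap \<theta> powr (-1/2) * circle_gap \<theta> powr (1/2)))"
        by (simp add: real_sqrt_mult[symmetric] mult_ac)
      also have "circle_gap \<theta> powr (-1/2) * circle_gap \<theta> powr (1/2) = 1"
        using d by (simp flip: powr_add)
      finally have s: "sqrt (m \<theta> * circle_gap \<theta> powr (-1/2)) * sqrt (m \<theta> * circle_gap \<theta> powr (1/2)) = m \<theta>"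
        using m0[of \<theta>] by simp
      have "K \<theta> * g \<theta> \<le> (20 * m \<theta>) * g \<theta>"
        using Poisson_kernel_dyadic_le[OF _ _ h t, of \<theta>] True
        by (intro mult_right_mono) (auto simp: K_def m_def g_def)
      also have "\<dots> = 20 * (sqrt (m \<theta> * circle_gap \<theta> powr (-1/2)) * (sqrt (m \<theta> * circle_gap \<theta> powr (1/2)) * g \<theta>))"
        by (subst s[symmetric]) (simp only: mult_ac)
      finally have "ennreal (K \<theta> * g \<theta>) \<le> ennreal (20 * (sqrt (m \<theta> * circle_gap \<theta> powr (-1/2)) * (sqrt (m \<theta> * circle_gap \<theta> powr (1/2)) * g \<theta>)))"
        by (rule ennreal_leI)
      then show ?thesis using True m0[of \<theta>] by (simp add: ennreal_mult g_def)
    qed simp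
  qed
  also have "\<dots> = ennreal 20 * (\<integral>\<^sup>+\<theta>. (ennreal (sqrt (m \<theta> * circle_gap \<theta> powr (-1/2))) * indicator {0<..<2*pi} \<theta>)
      * (ennreal (sqrt (m \<theta> * circle_gap \<theta> powr (1/2)) * g \<theta>) * indicator {0<..<2*pi} \<theta>) \<partial>lborel)"
    (is "_ = _ * ?I") by (rule nn_integral_cmult) measurable
  finally have 1: "ennreal (2 * pi * A) \<le> ennreal 20 * ?I" .
  have "?I\<^sup>2 \<le> (\<integral>\<^sup>+\<theta>. (ennreal (sqrt (m \<theta> * circle_gap \<theta> powr (-1/2))) * indicator {0<..<2*pi} \<theta>)\<^sup>2 \<partial>lborel)
     * (\<integral>\<^sup>+\<theta>. (ennreal (sqrt (m \<theta> * circle_gap \<theta> powr (1/2)) * g \<theta>) * indicator {0<..<2*pi} \<theta>)\<^sup>2 \<partial>lborel)"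
    by (rule Cauchy_Schwarz_nn_integral) measurable
  also have "(\<lambda>\<theta>. (ennreal (sqrt (m \<theta> * circle_gap \<theta> powr (-1/2))) * indicator {0<..<2*pi} \<theta>)\<^sup>2)
     = (\<lambda>\<theta>. ennreal (m \<theta> * circle_gap \<theta> powr (-1/2)) * indicator {0<..<2*pi} \<theta>)"
    using m0 by (auto simp: fun_eq_iff ennreal_power indicator_def)
  also have "(\<lambda>\<theta>. (ennreal (sqrt (m \<theta> * circle_gap \<theta> powr (1/2)) * g \<theta>) * indicator {0<..<2*pi} \<theta>)\<^sup>2)
     = (\<lambda>\<theta>. ennreal (m \<theta> * circle_gap \<theta> powr (1/2) * norm (f (of_real r * cis \<theta>)) powr p) * indicator {0<..<2*pi} \<theta>)"
  proof -
    have "(g \<theta>)\<^sup>2 = norm (f (of_real r * cis \<theta>)) powr p" for \<theta>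
      unfolding g_def by (rule powr_half_square)
    moreover have "0 \<le> g \<theta>" for \<theta> by (simp add: g_def)
    ultimately show ?thesis
      using m0 by (auto simp: fun_eq_iff ennreal_power indicator_def power_mult_distrib)
  qed
  also have "(\<integral>\<^sup>+\<theta>. ennreal (m \<theta> * circle_gap \<theta> powr (-1/2)) * indicator {0<..<2*pi} \<theta> \<partial>lborel)
      \<le> 2 * (\<integral>\<^sup>+t\<in>{0<..}. ennreal (min (1 / h) (h / t\<^sup>2) * t powr (-1/2)) \<partial>lborel)"
    unfolding m_def by (rule nn_integral_circle_gap_le) measurable
  also have "\<dots> \<le> 2 * ennreal (3 * h powr (-1/2))"
    by (intro mult_left_mono nn_integral_Poisson_weight_le h) simp
  also have "\<dots> = ennreal (6 * h powr (-1/2))" by (simp add: ennreal_mult[symmetric] flip: ennreal_numeral)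
  finally have 2: "?I\<^sup>2 \<le> ennreal (6 * h powr (-1/2)) *
     (\<integral>\<^sup>+\<theta>\<in>{0<..<2*pi}. ennreal (m \<theta> * circle_gap \<theta> powr (1/2) * norm (f (of_real r * cis \<theta>)) powr p) \<partial>lborel)"
    (is "_ \<le> _ * ?J")
    by (simp add: mult_right_mono)
  have "A\<^sup>2 \<le> (2 * pi * A)\<^sup>2"
  proof (rule power_mono)
    have "1 * A \<le> 2 * pi * A" by (rule mult_right_mono) (use pi_ge_two A0 in auto)
    then show "A \<le> 2 * pi * A" by simp
  qed (rule A0)
  then have "ennreal (A\<^sup>2) \<le> (ennreal (2 * pi * A))\<^sup>2"
    using A0 by (simp add: ennreal_power ennreal_leI)
  also have "\<dots> \<le> (ennreal 20 * ?I)\<^sup>2" by (rule power_mono[OF 1]) simp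
  also have "\<dots> = ennreal 400 * ?I\<^sup>2" by (simp add: power_mult_distrib ennreal_power)
  also have "\<dots> \<le> ennreal 400 * (ennreal (6 * h powr (-1/2)) * ?J)" by (rule mult_left_mono[OF 2]) simp
  also have "\<dots> = ennreal (2400 * h powr (-1/2)) * ?J"
    by (simp add: mult.assoc[symmetric] ennreal_mult[symmetric] flip: ennreal_numeral)
  finally show ?thesis unfolding A_def m_def .
qed

text \<open>
  Second half of the Schur test.  For each angle the weights that the dyadic scales put on it form a
  two-sided geometric sum, hence they add up to a constant.  The argument is carried out for the
  dilates \<open>\<lambda>z. f (r * z)\<close>, and \<open>r\<close> then tends to 1.
\<close>

lemma hardy_dyadic_points:
  assumes p: "0 < p"
  shows "\<exists>C>0. \<forall>f\<in>hardy_space p. \<forall>\<tau>. (\<forall>j. 1 - (1/2)^j \<le> \<tau> j \<and> \<tau> j \<le> 1 - (1/2)^Suc j) \<longrightarrow>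
     (\<forall>N. (\<Sum>j<N. (1/2)^j * norm (f (of_real (\<tau> j))) powr p) \<le> C * hardy_norm p f powr p)"
proof -
  obtain C where C: "0 < C" "\<And>x J. 0 < (x::real) \<Longrightarrow> (\<Sum>j<J. min ((x * (1/2)^j) powr (3/2)) ((x * (1/2)^j) powr (-(1/2)))) \<le> C"
    using two_sided_geometric_sum[of "3/2" "1/2"] by auto
  have main: "(\<Sum>j<N. (1/2)^j * norm (f (of_real (\<tau> j))) powr p) \<le> 2400 * C * (2 * pi) * hardy_norm p f powr p"
    if f: "f \<in> hardy_space p" and \<tau>: "\<And>j. 1 - (1/2)^j \<le> \<tau> j" "\<And>j. \<tau> j \<le> 1 - (1/2)^Suc j" for f \<tau> N
  proof -
    have hol: "f holomorphic_on ball 0 1" using f by (simp add: hardy_space_def)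
    have \<tau>1: "norm (of_real (\<tau> j) :: complex) < 1" for j
    proof -
      have "0 \<le> 1 - (1/2::real)^j" by (simp add: power_le_one)
      moreover have "0 < (1/2::real)^Suc j" by simp
      ultimately show ?thesis using \<tau>[of j] unfolding norm_of_real by linarith
    qed
    have R: "(\<Sum>j<N. (1/2)^j * norm (f (of_real r * of_real (\<tau> j))) powr p) \<le> 2400 * C * (2 * pi) * hardy_norm p f powr p"
      if r: "0 < r" "r < 1" for r
    proof -
      define m where "m j \<theta> = min (1 / (1/2)^j) ((1/2)^j / (circle_gap \<theta>)\<^sup>2)" for j :: nat and \<theta>
      define G where "G \<theta> = norm (f (of_real r * cis \<theta>)) powr p" for \<theta>
      have [measurable]: "m j \<in> borel_measurable borel" for j unfolding m_def[abs_def] by measurable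
      have cG: "continuous_on A G" for A
        unfolding G_def[abs_def] by (rule continuous_on_circle_powr[OF hol p]) (use r in auto)
      then have [measurable]: "G \<in> borel_measurable borel" by (intro borel_measurable_continuous_onI)
      have m0: "0 \<le> m j \<theta>" for j \<theta> by (auto simp: m_def)
      have G0: "0 \<le> G \<theta>" for \<theta> by (simp add: G_def)
      have "((1/2)^j * norm (f (of_real r * of_real (\<tau> j))) powr p) \<le> (1/2)^j * (Poisson_mean (p/2) f (of_real (\<tau> j)) r)\<^sup>2" for j
      proof -
        have "norm (f (of_real r * of_real (\<tau> j))) powr p = (norm (f (of_real r * of_real (\<tau> j))) powr (p/2))\<^sup>2"
          by (rule powr_half_square[symmetric])
        also have "\<dots> \<le> (Poisson_mean (p/2) f (of_real (\<tau> j)) r)\<^sup>2"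
          using p by (intro power_mono norm_powr_le_Poisson_mean[OF hol \<tau>1 _ r]) auto
        finally show ?thesis by (intro mult_left_mono) auto
      qed
      then have "ennreal (\<Sum>j<N. (1/2)^j * norm (f (of_real r * of_real (\<tau> j))) powr p) \<le>
         ennreal (\<Sum>j<N. (1/2)^j * (Poisson_mean (p/2) f (of_real (\<tau> j)) r)\<^sup>2)"
        by (intro ennreal_leI sum_mono)
      also have "\<dots> = (\<Sum>j<N. ennreal ((1/2)^j) * ennreal ((Poisson_mean (p/2) f (of_real (\<tau> j)) r)\<^sup>2))"
        by (subst sum_ennreal[symmetric]) (auto simp: ennreal_mult)
      also have "\<dots> \<le> (\<Sum>j<N. ennreal ((1/2)^j) * (ennreal (2400 * ((1/2)^j) powr (-1/2)) *
          (\<integral>\<^sup>+\<theta>\<in>{0<..<2*pi}. ennreal (m j \<theta> * circle_gap \<theta> powr (1/2) * G \<theta>) \<partial>lborel)))"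
        unfolding m_def G_def using \<tau>
        by (intro sum_mono mult_left_mono Poisson_mean_square_le[OF hol p r]) (auto simp: power_le_one)
      also have "\<dots> = (\<Sum>j<N. (\<integral>\<^sup>+\<theta>. ennreal ((1/2)^j * (2400 * ((1/2)^j) powr (-1/2))) * 
          (ennreal (m j \<theta> * circle_gap \<theta> powr (1/2) * G \<theta>) * indicator {0<..<2*pi} \<theta>) \<partial>lborel))"
        by (intro sum.cong refl) (simp add: nn_integral_cmult ennreal_mult mult.assoc)
      also have "\<dots> = (\<integral>\<^sup>+\<theta>. (\<Sum>j<N. ennreal ((1/2)^j * (2400 * ((1/2)^j) powr (-1/2))) * 
          (ennreal (m j \<theta> * circle_gap \<theta> powr (1/2) * G \<theta>) * indicator {0<..<2*pi} \<theta>)) \<partial>lborel)"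
        by (rule nn_integral_sum[symmetric]) measurable
      also have "\<dots> \<le> (\<integral>\<^sup>+\<theta>. ennreal (2400 * C * G \<theta>) * indicator {0..2*pi} \<theta> \<partial>lborel)"
      proof (rule nn_integral_mono)
        fix \<theta>
        show "(\<Sum>j<N. ennreal ((1/2)^j * (2400 * ((1/2)^j) powr (-1/2))) * 
          (ennreal (m j \<theta> * circle_gap \<theta> powr (1/2) * G \<theta>) * indicator {0<..<2*pi} \<theta>)) \<le> ennreal (2400 * C * G \<theta>) * indicator {0..2*pi} \<theta>"
        proof (cases "\<theta> \<in> {0<..<2*pi}")
          case True
          define d where "d = circle_gap \<theta>"
          have d: "0 < d" using True by (auto simp: circle_gap_def d_def)
          (* In terms of x = h / d: the bound h / d^2 of the kernel gives x powr (3/2), the bound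
             1 / h gives x powr (-1/2). *)
          have term_eq: "(1/2)^j * ((1/2)^j) powr (-1/2) * (m j \<theta> * d powr (1/2))
             = min (((1/d) * (1/2)^j) powr (3/2)) (((1/d) * (1/2)^j) powr (-(1/2)))" for j
          proof -
            define h where "h = (1/2::real)^j"
            have h: "0 < h" by (simp add: h_def)
            have "h * h powr (-1/2) * (1 / h * d powr (1/2)) = ((1/d) * h) powr (-(1/2))"
              using h d by (simp add: powr_mult powr_minus powr_divide field_simps)
            moreover have "h * h powr (-1/2) * (h / d\<^sup>2 * d powr (1/2)) = ((1/d) * h) powr (3/2)"
            proof -
              have 1: "h powr (3/2) = h * h powr (-1/2) * h" using h powr_add[of h "2" "-1/2"] by (simp add: power2_eq_square)
              have 2: "d powr (3/2) = d\<^sup>2 / d powr (1/2)" using d powr_diff[of d "2" "1/2"] by simp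
              show ?thesis using h d by (simp add: powr_mult powr_divide 1 2)
            qed
            moreover have "h * h powr (-1/2) * (min (1 / h) (h / d\<^sup>2) * d powr (1/2)) =
               min (h * h powr (-1/2) * (h / d\<^sup>2 * d powr (1/2))) (h * h powr (-1/2) * (1 / h * d powr (1/2)))"
              using h by (simp add: min_mult_distrib_left min_mult_distrib_right min.commute)
            ultimately show ?thesis unfolding m_def h_def d_def by simp
          qed
          have "(\<Sum>j<N. ennreal ((1/2)^j * (2400 * ((1/2)^j) powr (-1/2))) * (ennreal (m j \<theta> * circle_gap \<theta> powr (1/2) * G \<theta>)))
             = ennreal (\<Sum>j<N. (1/2)^j * (2400 * ((1/2)^j) powr (-1/2)) * (m j \<theta> * circle_gap \<theta> powr (1/2) * G \<theta>))"
            using m0 by (subst sum_ennreal[symmetric]) (auto simp: ennreal_mult G_def)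
          also have "(\<Sum>j<N. (1/2)^j * (2400 * ((1/2)^j) powr (-1/2)) * (m j \<theta> * circle_gap \<theta> powr (1/2) * G \<theta>))
             = (\<Sum>j<N. min (((1/d) * (1/2)^j) powr (3/2)) (((1/d) * (1/2)^j) powr (-(1/2)))) * (2400 * G \<theta>)"
            unfolding sum_distrib_right d_def[symmetric] term_eq[symmetric] by (intro sum.cong refl) (simp only: mult_ac)
          also have "\<dots> \<le> C * (2400 * G \<theta>)"
            using d by (intro mult_right_mono C(2)) (auto simp: G_def)
          finally show ?thesis using True by (simp add: ennreal_leI mult_ac)
        next
          case False
          then have "indicator {0<..<2*pi} \<theta> = (0::ennreal)" by (simp only: indicator_def of_bool_def if_False)
          then show ?thesis by simp
        qed
      qed
      also have "\<dots> = ennreal (2400 * C * integral {0..2*pi} G)"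
        using C(1) integrable_continuous_real[OF cG, of 0 "2*pi"]
        by (intro nn_integral_has_integral_lebesgue' has_integral_mult_right integrable_integral) (use G0 in auto)
      also have "\<dots> \<le> ennreal (2400 * C * (2 * pi * hardy_norm p f powr p))"
        using hardy_integral_le[OF f p r] C(1) by (intro ennreal_leI mult_left_mono) (auto simp: G_def[abs_def])
      finally show ?thesis
        using C(1) by (subst (asm) ennreal_le_iff) (auto simp: mult_ac)
    qed
    have cf: "continuous_on (ball 0 1) f" using hol by (rule holomorphic_on_imp_continuous_on)
    have "((\<lambda>r. \<Sum>j<N. (1/2)^j * norm (f (of_real r * of_real (\<tau> j))) powr p) \<longlongrightarrow>
        (\<Sum>j<N. (1/2)^j * norm (f (of_real 1 * of_real (\<tau> j))) powr p)) (at_left 1)"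
    proof (intro tendsto_sum tendsto_mult tendsto_const)
      fix j
      have "isCont f (of_real 1 * of_real (\<tau> j))"
        using cf \<tau>1[of j] by (simp add: continuous_on_eq_continuous_at)
      then have "((\<lambda>r. f (of_real r * of_real (\<tau> j))) \<longlongrightarrow> f (of_real 1 * of_real (\<tau> j))) (at_left 1)"
        by (rule isCont_tendsto_compose) (intro tendsto_intros)
      then show "((\<lambda>r. norm (f (of_real r * of_real (\<tau> j))) powr p) \<longlongrightarrow> norm (f (of_real 1 * of_real (\<tau> j))) powr p) (at_left 1)"
        using p by (intro tendsto_powr' tendsto_norm tendsto_const) auto
    qed
    moreover have "eventually (\<lambda>r. (\<Sum>j<N. (1/2)^j * norm (f (of_real r * of_real (\<tau> j))) powr p)
        \<le> 2400 * C * (2 * pi) * hardy_norm p f powr p) (at_left 1)"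
    proof -
      have "eventually (\<lambda>r. r \<in> {0<..<1}) (at_left (1::real))" by (rule eventually_at_left_real) simp
      then show ?thesis by (rule eventually_mono) (rule R, auto)
    qed
    ultimately have "(\<Sum>j<N. (1/2)^j * norm (f (of_real 1 * of_real (\<tau> j))) powr p)
        \<le> 2400 * C * (2 * pi) * hardy_norm p f powr p"
      by (rule tendsto_upperbound) simp
    then show ?thesis by simp
  qed
  show ?thesis
    by (rule exI[of _ "2400 * C * (2 * pi)"]) (use C(1) main in auto)
qed

text \<open>
  The maximum is over the whole initial segment and not only over the last dyadic interval.  It
  therefore also dominates the dilates \<open>f (\<rho> * t)\<close> with \<open>\<rho> \<le> 1\<close>, as Abel summation of the coefficient
  series requires.
\<close>

definition radial_max :: "(complex \<Rightarrow> complex) \<Rightarrow> nat \<Rightarrow> real" where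
  "radial_max f j = (SUP t\<in>{0..1 - (1/2)^Suc j}. norm (f (of_real t)))"

lemma half_powers:
  "0 < (1/2::real)^j" "(1/2::real)^j \<le> 1" "(1/2::real)^Suc j < 1" "(1/2::real)^Suc j < (1/2)^j"
proof -
  show 1: "0 < (1/2::real)^j" "(1/2::real)^j \<le> 1" for j by (auto simp: power_le_one)
  show "(1/2::real)^Suc j < (1/2)^j" using 1(1)[of j] by simp
  then show "(1/2::real)^Suc j < 1" using 1(2)[of j] by linarith
qed

lemma less_one_dyadic: "x \<le> 1 - (1/2::real)^j \<Longrightarrow> x < 1"
  using half_powers(1)[of j] by linarith

lemma continuous_on_radius:
  assumes f: "f holomorphic_on ball 0 1" and A: "A \<subseteq> {0..<1}"
  shows "continuous_on A (\<lambda>t. f (of_real t))"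
proof -
  have cf: "continuous_on (ball 0 1) f" using f by (rule holomorphic_on_imp_continuous_on)
  show ?thesis
    by (rule continuous_on_compose2[OF cf]) (use A in \<open>auto intro!: continuous_intros\<close>)
qed

lemma radial_max_bdd:
  assumes f: "f holomorphic_on ball 0 1"
  shows "bdd_above ((\<lambda>t. norm (f (of_real t))) ` {0..1 - (1/2)^Suc j})"
proof -
  have "continuous_on {0..1 - (1/2)^Suc j} (\<lambda>t. norm (f (of_real t)))"
    by (intro continuous_on_norm continuous_on_radius[OF f])
       (auto dest: less_one_dyadic simp del: power_Suc)
  then have "compact ((\<lambda>t. norm (f (of_real t))) ` {0..1 - (1/2)^Suc j})"
    by (rule compact_continuous_image) simp
  then show ?thesis by (simp add: compact_imp_bounded bounded_imp_bdd_above)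
qed

lemma radial_max_upper:
  assumes f: "f holomorphic_on ball 0 1" and "0 \<le> t" "t \<le> 1 - (1/2)^Suc j"
  shows "norm (f (of_real t)) \<le> radial_max f j"
  unfolding radial_max_def by (rule cSUP_upper[OF _ radial_max_bdd[OF f]]) (use assms in auto)

lemma radial_max_nonneg:
  assumes f: "f holomorphic_on ball 0 1"
  shows "0 \<le> radial_max f j"
proof -
  have "norm (f (of_real 0)) \<le> radial_max f j"
    by (rule radial_max_upper[OF f]) (use half_powers(2)[of "Suc j"] in \<open>auto simp del: power_Suc\<close>)
  then show ?thesis using norm_ge_zero[of "f (of_real 0)"] by linarith
qed

lemma radial_max_least:
  assumes "\<And>t. 0 \<le> t \<Longrightarrow> t \<le> 1 - (1/2)^Suc j \<Longrightarrow> norm (f (of_real t)) \<le> B"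
  shows "radial_max f j \<le> B"
  unfolding radial_max_def
proof (rule cSUP_least)
  show "{0..1 - (1/2::real)^Suc j} \<noteq> {}" using half_powers(2)[of "Suc j"] by (simp del: power_Suc)
qed (use assms in auto)

lemma dyadic_interval_exists:
  fixes t :: real
  assumes "0 \<le> t" "t < 1"
  shows "\<exists>i. 1 - (1/2)^i \<le> t \<and> t < 1 - (1/2)^Suc i"
proof -
  have ex: "\<exists>i. t < 1 - (1/2)^Suc i"
  proof -
    obtain n where "(1/2)^n < 1 - t" using real_arch_pow_inv[of "1 - t" "1/2"] assms by auto
    then have "(1/2)^Suc n < 1 - t" using half_powers(4)[of n] by linarith
    then show ?thesis by (intro exI[of _ n]) linarith
  qed
  define i where "i = (LEAST i. t < 1 - (1/2)^Suc i)"
  have "t < 1 - (1/2)^Suc i" unfolding i_def by (rule LeastI_ex[OF ex])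
  moreover have "1 - (1/2)^i \<le> t"
  proof (cases i)
    case 0 then show ?thesis using assms by simp
  next
    case (Suc k)
    then have "\<not> t < 1 - (1/2)^Suc k" using not_less_Least[of k "\<lambda>i. t < 1 - (1/2)^Suc i"] by (simp add: i_def)
    then show ?thesis using Suc by simp
  qed
  ultimately show ?thesis by blast
qed

lemma radial_max_growth:
  assumes f: "f \<in> hardy_space p" and p: "0 < p"
  shows "radial_max f j \<le> (8 * 2^j) powr (1 / p) * hardy_norm p f"
proof (rule radial_max_least)
  fix t :: real assume t: "0 \<le> t" "t \<le> 1 - (1/2)^Suc j"
  have "0 < (1/2::real)^Suc j" by simp
  then have t1: "t < 1" using t by linarith
  have "4 / (1 - t) \<le> 4 / (1/2)^Suc j" using t by (intro divide_left_mono mult_pos_pos) (use t1 in auto)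
  also have "\<dots> = 8 * 2^j" by (simp add: power_one_over)
  finally have "(4 / (1 - t)) powr (1 / p) \<le> (8 * 2^j) powr (1 / p)"
    using p t1 by (intro powr_mono2) auto
  then have "(4 / (1 - t)) powr (1 / p) * hardy_norm p f \<le> (8 * 2^j) powr (1 / p) * hardy_norm p f"
    by (rule mult_right_mono) (rule hardy_norm_nonneg[OF f])
  moreover have "norm (f (of_real t)) \<le> (4 / (1 - t)) powr (1 / p) * hardy_norm p f"
    using hardy_growth[OF f p, of "of_real t"] t t1 by simp
  ultimately show "norm (f (of_real t)) \<le> (8 * 2^j) powr (1 / p) * hardy_norm p f" by linarith
qed

text \<open>
  The maximum over the segment is attained in one of the dyadic intervals with index at most \<open>j\<close>,
  so its power is bounded by the sum of the maxima over these.  Exchanging the sums costs a factor 2,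
  as the weights \<open>(1/2) ^ j\<close> decay geometrically.
\<close>

lemma radial_max_embedding_same:
  assumes p: "0 < p"
  shows "\<exists>C>0. \<forall>f\<in>hardy_space p. \<forall>N. (\<Sum>j<N. (1/2)^j * radial_max f j powr p) \<le> C * hardy_norm p f powr p"
proof -
  obtain C where C: "0 < C" and *: "\<And>f \<tau> N. f \<in> hardy_space p \<Longrightarrow> (\<And>j. 1 - (1/2)^j \<le> \<tau> j \<and> \<tau> j \<le> 1 - (1/2)^Suc j) \<Longrightarrow>
     (\<Sum>j<N. (1/2)^j * norm (f (of_real (\<tau> j))) powr p) \<le> C * hardy_norm p f powr p"
    using hardy_dyadic_points[OF p] by blast
  have "(\<Sum>j<N. (1/2)^j * radial_max f j powr p) \<le> 2 * C * hardy_norm p f powr p"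
    if f: "f \<in> hardy_space p" for f N
  proof -
    have hol: "f holomorphic_on ball 0 1" using f by (simp add: hardy_space_def)
    have "\<exists>t\<in>{1 - (1/2)^j..1 - (1/2)^Suc j}. \<forall>s\<in>{1 - (1/2)^j..1 - (1/2)^Suc j}. norm (f (of_real s)) \<le> norm (f (of_real t))" for j
    proof (rule continuous_attains_sup)
      have "{1 - (1/2)^j..1 - (1/2)^Suc j} \<subseteq> {0..<1::real}"
        using half_powers(2)[of j] by (auto dest: less_one_dyadic simp del: power_Suc)
      then show "continuous_on {1 - (1/2)^j..1 - (1/2)^Suc j} (\<lambda>t. norm (f (of_real t)))"
        by (intro continuous_on_norm continuous_on_radius[OF hol])
    qed auto
    then obtain \<tau> where \<tau>: "\<And>j. \<tau> j \<in> {1 - (1/2)^j..1 - (1/2)^Suc j}"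
      "\<And>j s. s \<in> {1 - (1/2)^j..1 - (1/2)^Suc j} \<Longrightarrow> norm (f (of_real s)) \<le> norm (f (of_real (\<tau> j)))"
      by metis
    define x where "x i = norm (f (of_real (\<tau> i))) powr p" for i
    have x0: "0 \<le> x i" for i by (simp add: x_def)
    have max: "radial_max f j powr p \<le> (\<Sum>i\<le>j. x i)" for j
    proof -
      have "radial_max f j \<le> (\<Sum>i\<le>j. x i) powr (1 / p)"
      proof (rule radial_max_least)
        fix t :: real assume t: "0 \<le> t" "t \<le> 1 - (1/2)^Suc j"
        have "0 < (1/2::real)^Suc j" by simp
        then have t1: "t < 1" using t by linarith
        obtain i where i: "1 - (1/2)^i \<le> t" "t < 1 - (1/2)^Suc i" using dyadic_interval_exists[OF t(1) t1] by blast
        have "i \<le> j \<or> (i = Suc j)"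
        proof (rule ccontr)
          assume "\<not> ?thesis"
          then have "Suc j < i" by auto
          then have "(1/2::real)^i < (1/2)^Suc j" by (intro power_strict_decreasing) auto
          then show False using i t by linarith
        qed
        then have "\<exists>i\<le>j. norm (f (of_real t)) \<le> norm (f (of_real (\<tau> i)))"
        proof
          assume "i \<le> j" then show ?thesis using \<tau>(2)[of t i] i by (auto intro!: exI[of _ i])
        next
          (* Only the right end point of the segment lies in the half-open interval with index j + 1. *)
          assume "i = Suc j"
          then have "t = 1 - (1/2)^Suc j" using i t by auto
          moreover have "(1/2::real)^Suc j \<le> (1/2)^j" by simp
          ultimately show ?thesis using \<tau>(2)[of t j] by (auto intro!: exI[of _ j] simp del: power_Suc)
        qed
        then obtain i where i: "i \<le> j" "norm (f (of_real t)) \<le> norm (f (of_real (\<tau> i)))" by blast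
        have "norm (f (of_real t)) powr p \<le> x i" unfolding x_def using i p by (intro powr_mono2) auto
        also have "\<dots> \<le> (\<Sum>i\<le>j. x i)" using i x0 by (intro member_le_sum) auto
        finally have "(norm (f (of_real t)) powr p) powr (1 / p) \<le> (\<Sum>i\<le>j. x i) powr (1 / p)"
          using p by (intro powr_mono2) auto
        then show "norm (f (of_real t)) \<le> (\<Sum>i\<le>j. x i) powr (1 / p)" using p by (simp add: powr_powr)
      qed
      then have "radial_max f j powr p \<le> ((\<Sum>i\<le>j. x i) powr (1 / p)) powr p"
        using p radial_max_nonneg[OF hol] by (intro powr_mono2) auto
      then show ?thesis using p sum_nonneg[of "{..j}" x] x0 by (simp add: powr_powr)
    qed
    (* Summation by parts, with the boundary term that makes the induction go through. *)
    have gs: "(\<Sum>j<N. (1/2)^j * (\<Sum>i\<le>j. x i)) + 2 * (1/2)^N * (\<Sum>i<N. x i) = 2 * (\<Sum>i<N. (1/2)^i * x i)" for N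
      by (induction N) (auto simp: algebra_simps lessThan_Suc_atMost[symmetric])
    have "(\<Sum>j<N. (1/2)^j * radial_max f j powr p) \<le> (\<Sum>j<N. (1/2)^j * (\<Sum>i\<le>j. x i))"
      by (intro sum_mono mult_left_mono max) auto
    also have "\<dots> \<le> 2 * (\<Sum>i<N. (1/2)^i * x i)"
    proof -
      have "0 \<le> 2 * (1/2)^N * (\<Sum>i<N. x i)" by (intro mult_nonneg_nonneg sum_nonneg x0) auto
      then show ?thesis using gs[of N] by linarith
    qed
    also have "\<dots> \<le> 2 * (C * hardy_norm p f powr p)"
      unfolding x_def using \<tau>(1) by (intro mult_left_mono *[OF f]) auto
    finally show ?thesis by simp
  qed
  then show ?thesis using C by (intro exI[of _ "2 * C"]) auto
qed

text \<open>
  The surplus power \<open>q - p\<close> is estimated by the growth bound, which contributes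
  \<open>h powr (-(q - p) / p)\<close> for \<open>h = (1/2) ^ j\<close>.
\<close>

lemma radial_max_embedding:
  assumes p: "0 < p" and q: "p \<le> q"
  shows "\<exists>C>0. \<forall>f\<in>hardy_space p. \<forall>N.
     (\<Sum>j<N. ((1/2)^j) powr (q / p) * radial_max f j powr q) \<le> C * hardy_norm p f powr q"
proof -
  obtain C where C: "0 < C" and *: "\<And>f N. f \<in> hardy_space p \<Longrightarrow> 
     (\<Sum>j<N. (1/2)^j * radial_max f j powr p) \<le> C * hardy_norm p f powr p"
    using radial_max_embedding_same[OF p] by blast
  have "(\<Sum>j<N. ((1/2)^j) powr (q / p) * radial_max f j powr q) \<le> (8 powr ((q - p) / p) * C) * hardy_norm p f powr q"
    if f: "f \<in> hardy_space p" for f N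
  proof -
    have hol: "f holomorphic_on ball 0 1" using f by (simp add: hardy_space_def)
    note R = radial_max_nonneg[OF hol] hardy_norm_nonneg[OF f]
    have "((1/2)^j) powr (q / p) * radial_max f j powr q \<le> 
        (8 powr ((q - p) / p) * hardy_norm p f powr (q - p)) * ((1/2)^j * radial_max f j powr p)" for j
    proof -
      define m where "m = radial_max f j"
      define h where "h = (1/2::real)^j"
      have h: "0 < h" by (simp add: h_def)
      have "m \<le> (8 / h) powr (1 / p) * hardy_norm p f"
        using radial_max_growth[OF f p, of j] by (simp add: m_def h_def power_one_over)
      then have "m powr (q - p) \<le> ((8 / h) powr (1 / p) * hardy_norm p f) powr (q - p)"
        using q R by (intro powr_mono2) (auto simp: m_def)
      also have "\<dots> = 8 powr ((q - p) / p) * h powr (-((q - p) / p)) * hardy_norm p f powr (q - p)"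
        using R h by (simp add: powr_mult powr_powr powr_divide powr_minus_divide)
      finally have "m powr (q - p) \<le> 8 powr ((q - p) / p) * h powr (-((q - p) / p)) * hardy_norm p f powr (q - p)" .
      then have "h powr (q / p) * (m powr (q - p) * m powr p) \<le> h powr (q / p) *
         ((8 powr ((q - p) / p) * h powr (-((q - p) / p)) * hardy_norm p f powr (q - p)) * m powr p)"
        by (intro mult_left_mono mult_right_mono) auto
      also have "\<dots> = (8 powr ((q - p) / p) * hardy_norm p f powr (q - p)) * ((h powr (q / p) * h powr (-((q - p) / p))) * m powr p)"
        by (simp only: mult_ac)
      also have "h powr (q / p) * h powr (-((q - p) / p)) = h"
      proof -
        have "q / p + -((q - p) / p) = 1" using p by (simp add: diff_divide_distrib)
        then show ?thesis using h by (metis powr_add powr_one less_imp_le)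
      qed
      also have "m powr (q - p) * m powr p = m powr q" by (simp flip: powr_add)
      finally show ?thesis unfolding m_def h_def .
    qed
    then have "(\<Sum>j<N. ((1/2)^j) powr (q / p) * radial_max f j powr q) \<le>
       (8 powr ((q - p) / p) * hardy_norm p f powr (q - p)) * (\<Sum>j<N. (1/2)^j * radial_max f j powr p)"
      unfolding sum_distrib_left by (rule sum_mono)
    also have "\<dots> \<le> (8 powr ((q - p) / p) * hardy_norm p f powr (q - p)) * (C * hardy_norm p f powr p)"
      by (intro mult_left_mono *[OF f]) auto
    also have "\<dots> = (8 powr ((q - p) / p) * C) * hardy_norm p f powr q"
      by (simp flip: powr_add)
    finally show ?thesis .
  qed
  then show ?thesis using C by (intro exI[of _ "8 powr ((q - p) / p) * C"]) auto
qed

section \<open>Polar coordinates in the unit disc\<close>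

lemma lborel_complex_eq_distr:
  "(lborel :: complex measure) = distr (lborel \<Otimes>\<^sub>M lborel) borel (\<lambda>(x, y). of_real x + \<i> * of_real y)"
proof (rule lborel_eqI)
  fix l u :: complex
  assume le: "\<And>b. b \<in> Basis \<Longrightarrow> l \<bullet> b \<le> u \<bullet> b"
  have le': "Re l \<le> Re u" "Im l \<le> Im u" using le[of 1] le[of \<i>] by (auto simp: Basis_complex_def)
  have "emeasure (distr (lborel \<Otimes>\<^sub>M lborel) borel (\<lambda>(x, y). of_real x + \<i> * of_real y)) (box l u)
    = emeasure (lborel \<Otimes>\<^sub>M lborel) ({Re l<..<Re u} \<times> {Im l<..<Im u})"
    by (subst emeasure_distr)
       (auto simp: box_def Basis_complex_def space_pair_measure intro!: arg_cong2[where f=emeasure])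
  also have "\<dots> = ennreal (Re u - Re l) * ennreal (Im u - Im l)"
    using le' by (subst lborel.emeasure_pair_measure_Times) auto
  also have "\<dots> = ennreal (\<Prod>b\<in>Basis. (u - l) \<bullet> b)"
    using le' by (simp add: Basis_complex_def ennreal_mult)
  finally show "emeasure (distr (lborel \<Otimes>\<^sub>M lborel) borel (\<lambda>(x, y). of_real x + \<i> * of_real y)) (box l u) = 
    ennreal (\<Prod>b\<in>Basis. (u - l) \<bullet> b)" .
qed simp

lemma nn_integral_lborel_complex:
  fixes f :: "complex \<Rightarrow> ennreal"
  assumes [measurable]: "f \<in> borel_measurable borel"
  shows "(\<integral>\<^sup>+z. f z \<partial>lborel) = (\<integral>\<^sup>+x. \<integral>\<^sup>+y. f (of_real x + \<i> * of_real y) \<partial>lborel \<partial>lborel)"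
proof -
  have "(\<integral>\<^sup>+z. f z \<partial>lborel) = (\<integral>\<^sup>+p. f (of_real (fst p) + \<i> * of_real (snd p)) \<partial>(lborel \<Otimes>\<^sub>M lborel))"
    by (subst lborel_complex_eq_distr, subst nn_integral_distr) (auto simp: case_prod_unfold)
  also have "\<dots> = (\<integral>\<^sup>+x. \<integral>\<^sup>+y. f (of_real x + \<i> * of_real y) \<partial>lborel \<partial>lborel)"
    by (subst lborel.nn_integral_fst[symmetric]) auto
  finally show ?thesis .
qed

text \<open>
  A rotation is the composition of two maps that each change one coordinate affinely; their Jacobian
  factors \<open>cos \<phi>\<close> and \<open>1 / cos \<phi>\<close> cancel.
\<close>

lemma nn_integral_rotate_cos_nonzero:
  fixes f :: "complex \<Rightarrow> ennreal"
  assumes [measurable]: "f \<in> borel_measurable borel" and c: "cos \<phi> \<noteq> 0"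
  shows "(\<integral>\<^sup>+z. f (cis \<phi> * z) \<partial>lborel) = (\<integral>\<^sup>+z. f z \<partial>lborel)"
proof -
  define c s where "c = cos \<phi>" and "s = sin \<phi>"
  have c0: "c \<noteq> 0" using c by (simp add: c_def)
  have sc: "s * s = 1 - c * c" using sin_cos_squared_add[of \<phi>] by (simp add: c_def s_def power2_eq_square)
  have "(\<integral>\<^sup>+z. f (cis \<phi> * z) \<partial>lborel) = (\<integral>\<^sup>+x. \<integral>\<^sup>+y. f (cis \<phi> * (of_real x + \<i> * of_real y)) \<partial>lborel \<partial>lborel)"
    by (rule nn_integral_lborel_complex) measurable
  also have "\<dots> = (\<integral>\<^sup>+y. \<integral>\<^sup>+x. f (cis \<phi> * (of_real x + \<i> * of_real y)) \<partial>lborel \<partial>lborel)"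
    by (rule lborel_pair.Fubini'[symmetric]) measurable
  also have "\<dots> = (\<integral>\<^sup>+y. ennreal \<bar>1 / c\<bar> * (\<integral>\<^sup>+x. f (of_real x + \<i> * of_real (x * s / c + 1 / c * y)) \<partial>lborel) \<partial>lborel)"
  proof (rule nn_integral_cong)
    fix y :: real
    have "(\<integral>\<^sup>+x. f (cis \<phi> * (of_real x + \<i> * of_real y)) \<partial>lborel) =
      ennreal \<bar>1 / c\<bar> * (\<integral>\<^sup>+x. f (cis \<phi> * (of_real (y * s / c + 1 / c * x) + \<i> * of_real y)) \<partial>lborel)"
      using c0 by (intro nn_integral_real_affine) auto
    also have "(\<lambda>x. cis \<phi> * (of_real (y * s / c + 1 / c * x) + \<i> * of_real y)) = (\<lambda>x. of_real x + \<i> * of_real (x * s / c + 1 / c * y))"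
    proof
      fix x
      have 1: "c * (y * s / c + 1 / c * x) - s * y = x" using c0 by (simp add: field_simps)
      have "s * (y * s / c + 1 / c * x) + c * y = (y * (s * s) + x * s + c * c * y) / c"
        using c0 by (simp add: field_simps)
      also have "\<dots> = x * s / c + 1 / c * y" unfolding sc using c0 by (simp add: field_simps)
      finally have 2: "s * (y * s / c + 1 / c * x) + c * y = x * s / c + 1 / c * y" .
      show "cis \<phi> * (of_real (y * s / c + 1 / c * x) + \<i> * of_real y) = of_real x + \<i> * of_real (x * s / c + 1 / c * y)"
        using 1 2 by (simp only: complex_eq_iff) (simp add: c_def[symmetric] s_def[symmetric])
    qed
    finally show "(\<integral>\<^sup>+x. f (cis \<phi> * (of_real x + \<i> * of_real y)) \<partial>lborel) =
       ennreal \<bar>1 / c\<bar> * (\<integral>\<^sup>+x. f (of_real x + \<i> * of_real (x * s / c + 1 / c * y)) \<partial>lborel)" .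
  qed
  also have "\<dots> = ennreal \<bar>1 / c\<bar> * (\<integral>\<^sup>+y. \<integral>\<^sup>+x. f (of_real x + \<i> * of_real (x * s / c + 1 / c * y)) \<partial>lborel \<partial>lborel)"
    by (rule nn_integral_cmult) measurable
  also have "(\<integral>\<^sup>+y. \<integral>\<^sup>+x. f (of_real x + \<i> * of_real (x * s / c + 1 / c * y)) \<partial>lborel \<partial>lborel)
     = (\<integral>\<^sup>+x. \<integral>\<^sup>+y. f (of_real x + \<i> * of_real (x * s / c + 1 / c * y)) \<partial>lborel \<partial>lborel)"
    by (rule lborel_pair.Fubini') measurable
  also have "ennreal \<bar>1 / c\<bar> * (\<integral>\<^sup>+x. \<integral>\<^sup>+y. f (of_real x + \<i> * of_real (x * s / c + 1 / c * y)) \<partial>lborel \<partial>lborel)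
     = (\<integral>\<^sup>+x. ennreal \<bar>1 / c\<bar> * (\<integral>\<^sup>+y. f (of_real x + \<i> * of_real (x * s / c + 1 / c * y)) \<partial>lborel) \<partial>lborel)"
    by (rule nn_integral_cmult[symmetric]) measurable
  also have "\<dots> = (\<integral>\<^sup>+x. \<integral>\<^sup>+y. f (of_real x + \<i> * of_real y) \<partial>lborel \<partial>lborel)"
    using c0 by (intro nn_integral_cong nn_integral_real_affine[symmetric]) auto
  also have "\<dots> = (\<integral>\<^sup>+z. f z \<partial>lborel)"
    by (rule nn_integral_lborel_complex[symmetric]) measurable
  finally show ?thesis .
qed

text \<open>
  If \<open>cos \<phi>\<close> vanishes, the rotation is carried out as two rotations by \<open>\<phi> / 2\<close>.
\<close>

lemma nn_integral_rotate:
  fixes f :: "complex \<Rightarrow> ennreal"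
  assumes [measurable]: "f \<in> borel_measurable borel"
  shows "(\<integral>\<^sup>+z. f (cis \<phi> * z) \<partial>lborel) = (\<integral>\<^sup>+z. f z \<partial>lborel)"
proof (cases "cos \<phi> = 0")
  case True
  have c: "cos (\<phi> / 2) \<noteq> 0" using cos_double_cos[of "\<phi> / 2"] True by auto
  have "(\<integral>\<^sup>+z. f (cis \<phi> * z) \<partial>lborel) = (\<integral>\<^sup>+z. f (cis (\<phi> / 2) * (cis (\<phi> / 2) * z)) \<partial>lborel)"
    by (simp add: cis_mult mult.assoc[symmetric])
  also have "\<dots> = (\<integral>\<^sup>+z. f (cis (\<phi> / 2) * z) \<partial>lborel)"
    by (rule nn_integral_rotate_cos_nonzero[OF _ c, of "\<lambda>w. f (cis (\<phi> / 2) * w)"]) measurable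
  also have "\<dots> = (\<integral>\<^sup>+z. f z \<partial>lborel)"
    by (rule nn_integral_rotate_cos_nonzero[OF _ c]) measurable
  finally show ?thesis .
qed (use nn_integral_rotate_cos_nonzero in auto)

text \<open>
  Both sides are integrals of \<open>g\<close> against measures on the line.  Those agree on half-lines, where the
  areas of concentric discs are compared.
\<close>

lemma nn_integral_radial:
  fixes g :: "real \<Rightarrow> ennreal"
  assumes [measurable]: "g \<in> borel_measurable borel"
  shows "(\<integral>\<^sup>+z\<in>ball (0::complex) 1. g (norm z) \<partial>lborel) = (\<integral>\<^sup>+r\<in>{0..1}. ennreal (2 * pi * r) * g r \<partial>lborel)"
proof -
  define M where "M = distr (density lborel (indicator (ball (0::complex) 1))) borel norm"
  define N where "N = density lborel (\<lambda>r::real. ennreal (2 * pi * r) * indicator {0..1} r)"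
  have vol: "emeasure lborel (ball (0::complex) 1) = ennreal pi"
    by (simp add: emeasure_ball unit_ball_vol_2)
  have volc: "emeasure lborel (cball (0::complex) x) = ennreal (pi * x\<^sup>2)" if "0 \<le> x" for x
    using that by (simp add: emeasure_cball unit_ball_vol_2)
  have Mx: "emeasure M {x<..} = ennreal (if x < 0 then pi else if x < 1 then pi - pi * x\<^sup>2 else 0)" for x
  proof -
    have "open (norm -` {x<..} :: complex set)" by (intro open_vimage continuous_intros)
    then have meas: "norm -` {x<..} \<in> sets (borel :: complex measure)" by (rule borel_open)
    have "emeasure M {x<..} = (\<integral>\<^sup>+z. indicator (ball 0 1) z * indicator (norm -` {x<..}) z \<partial>(lborel :: complex measure))"
      unfolding M_def using meas
      by (simp add: emeasure_distr) (subst emeasure_density; simp add: borel_measurable_indicator)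
    also have "\<dots> = (\<integral>\<^sup>+z. indicator (ball 0 1 \<inter> (norm -` {x<..})) z \<partial>(lborel :: complex measure))"
      by (simp add: indicator_inter_arith)
    also have "\<dots> = emeasure lborel (ball (0::complex) 1 \<inter> (norm -` {x<..}))"
      using meas by (subst nn_integral_indicator) auto
    also have "\<dots> = ennreal (if x < 0 then pi else if x < 1 then pi - pi * x\<^sup>2 else 0)"
    proof -
      consider "x < 0" | "0 \<le> x" "x < 1" | "1 \<le> x" by linarith
      then show ?thesis
      proof cases
        case 1
        then have "ball (0::complex) 1 \<inter> (norm -` {x<..}) = ball 0 1"
          by (auto intro: less_le_trans[OF _ norm_ge_zero])
        then show ?thesis using 1 vol by simp
      next
        case 2
        have "ball (0::complex) 1 \<inter> (norm -` {x<..}) = ball 0 1 - cball 0 x" by auto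
        moreover have "emeasure lborel (ball (0::complex) 1 - cball 0 x) = emeasure lborel (ball (0::complex) 1) - emeasure lborel (cball (0::complex) x)"
          using 2 volc[of x] by (intro emeasure_Diff) auto
        ultimately show ?thesis using 2 vol volc[of x] by (simp add: ennreal_minus)
      next
        case 3
        then have "ball (0::complex) 1 \<inter> (norm -` {x<..}) = {}" by auto
        then show ?thesis using 3 by simp
      qed
    qed
    finally show ?thesis .
  qed
  have Nx: "emeasure N {x<..} = ennreal (if x < 0 then pi else if x < 1 then pi - pi * x\<^sup>2 else 0)" for x
  proof -
    define y where "y = max 0 (min x 1)"
    have y: "0 \<le> y" "y \<le> 1" by (auto simp: y_def)
    have "emeasure N {x<..} = (\<integral>\<^sup>+r. ennreal (2 * pi * r) * indicator {0..1} r * indicator {x<..} r \<partial>lborel)"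
      unfolding N_def by (subst emeasure_density) auto
    also have "\<dots> = (\<integral>\<^sup>+r. ennreal (2 * pi * r) * indicator {y..1} r \<partial>lborel)"
    proof (rule nn_integral_cong_AE)
      have "AE r in lborel. r \<noteq> x" "AE r in lborel. r \<noteq> 1" by (rule AE_lborel_singleton)+
      then show "AE r in lborel. ennreal (2 * pi * r) * indicator {0..1} r * indicator {x<..} r = ennreal (2 * pi * r) * indicator {y..1} r"
        by eventually_elim (auto simp: indicator_def y_def)
    qed
    also have "\<dots> = ennreal (pi * 1\<^sup>2 - pi * y\<^sup>2)"
      using y by (intro nn_integral_FTC_Icc) (auto intro!: derivative_eq_intros)
    also have "pi * 1\<^sup>2 - pi * y\<^sup>2 = (if x < 0 then pi else if x < 1 then pi - pi * x\<^sup>2 else 0)"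
      by (auto simp: y_def min_def max_def)
    finally show ?thesis .
  qed
  have "M = N"
    by (rule measure_eqI_lessThan) (simp_all add: Mx Nx, simp_all add: M_def N_def)
  have "(\<integral>\<^sup>+z\<in>ball (0::complex) 1. g (norm z) \<partial>lborel) = (\<integral>\<^sup>+r. g r \<partial>M)"
    unfolding M_def
    by (simp add: nn_integral_distr) (subst nn_integral_density; simp add: borel_measurable_indicator mult.commute)
  also have "\<dots> = (\<integral>\<^sup>+r\<in>{0..1}. ennreal (2 * pi * r) * g r \<partial>lborel)"
    unfolding \<open>M = N\<close> N_def by (subst nn_integral_density) (auto simp: mult_ac intro!: nn_integral_cong)
  finally show ?thesis .
qed

lemma nn_integral_periodic_shift:
  fixes h :: "real \<Rightarrow> ennreal"
  assumes [measurable]: "h \<in> borel_measurable borel" and per: "\<And>\<theta>. h (\<theta> + c) = h \<theta>" and a: "0 \<le> a" "a \<le> c"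
  shows "(\<integral>\<^sup>+\<theta>\<in>{0..<c}. h (\<theta> + a) \<partial>lborel) = (\<integral>\<^sup>+\<theta>\<in>{0..<c}. h \<theta> \<partial>lborel)"
proof -
  have "(\<integral>\<^sup>+\<theta>\<in>{0..<c}. h (\<theta> + a) \<partial>lborel) = (\<integral>\<^sup>+\<theta>\<in>{a..<c+a}. h \<theta> \<partial>lborel)"
    using nn_integral_real_affine[of "\<lambda>\<theta>. h \<theta> * indicator {a..<c+a} \<theta>" 1 a]
    by (simp add: indicator_def add.commute cong: nn_integral_cong)
  also have "\<dots> = (\<integral>\<^sup>+\<theta>. h \<theta> * indicator {a..<c} \<theta> + h \<theta> * indicator {c..<c+a} \<theta> \<partial>lborel)"
    using a by (intro nn_integral_cong) (auto simp: indicator_def)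
  also have "\<dots> = (\<integral>\<^sup>+\<theta>\<in>{a..<c}. h \<theta> \<partial>lborel) + (\<integral>\<^sup>+\<theta>\<in>{c..<c+a}. h \<theta> \<partial>lborel)"
    by (rule nn_integral_add) auto
  also have "(\<integral>\<^sup>+\<theta>\<in>{c..<c+a}. h \<theta> \<partial>lborel) = (\<integral>\<^sup>+\<theta>\<in>{0..<a}. h \<theta> \<partial>lborel)"
    using nn_integral_real_affine[of "\<lambda>\<theta>. h \<theta> * indicator {c..<c+a} \<theta>" 1 c] per
    by (simp add: indicator_def add.commute[of c] cong: nn_integral_cong)
  also have "(\<integral>\<^sup>+\<theta>\<in>{a..<c}. h \<theta> \<partial>lborel) + (\<integral>\<^sup>+\<theta>\<in>{0..<a}. h \<theta> \<partial>lborel) = 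
     (\<integral>\<^sup>+\<theta>. h \<theta> * indicator {a..<c} \<theta> + h \<theta> * indicator {0..<a} \<theta> \<partial>lborel)"
    by (rule nn_integral_add[symmetric]) auto
  also have "\<dots> = (\<integral>\<^sup>+\<theta>\<in>{0..<c}. h \<theta> \<partial>lborel)"
    using a by (intro nn_integral_cong) (auto simp: indicator_def)
  finally show ?thesis .
qed

text \<open>
  The integral equals its average over all rotations of the disc.  After exchanging the integrals, the
  inner one depends only on \<open>norm z\<close>, by periodicity, and what remains is radial.
\<close>

lemma nn_integral_polar:
  fixes f :: "complex \<Rightarrow> ennreal"
  assumes [measurable]: "f \<in> borel_measurable borel"
  shows "(\<integral>\<^sup>+z\<in>ball 0 1. f z \<partial>lborel) = (\<integral>\<^sup>+r\<in>{0..1}. ennreal r * (\<integral>\<^sup>+\<theta>\<in>{0..<2*pi}. f (of_real r * cis \<theta>) \<partial>lborel) \<partial>lborel)"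
proof -
  have [measurable]: "cis \<in> borel_measurable borel"
    by (intro borel_measurable_continuous_onI continuous_intros)
  have [measurable]: "ball (0::complex) 1 \<in> sets borel" by simp
  define I where "I = (\<integral>\<^sup>+z\<in>ball 0 1. f z \<partial>lborel)"
  define g where "g r = (\<integral>\<^sup>+\<theta>\<in>{0..<2*pi}. f (of_real r * cis \<theta>) \<partial>lborel)" for r
  have [measurable]: "g \<in> borel_measurable borel" unfolding g_def[abs_def] by measurable
  have inner: "(\<integral>\<^sup>+\<theta>\<in>{0..<2*pi}. f (cis \<theta> * z) \<partial>lborel) = g (norm z)" for z
  proof -
    have z: "z = of_real (norm z) * cis (Arg2pi z)"
      using Arg2pi_eq[of z] by (simp add: cis_conv_exp)
    have "(\<integral>\<^sup>+\<theta>\<in>{0..<2*pi}. f (cis \<theta> * z) \<partial>lborel) = (\<integral>\<^sup>+\<theta>\<in>{0..<2*pi}. f (of_real (norm z) * cis (\<theta> + Arg2pi z)) \<partial>lborel)"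
      by (subst z) (simp add: cis_mult[symmetric] mult_ac)
    also have "\<dots> = g (norm z)"
      unfolding g_def using Arg2pi_ge_0[of z] Arg2pi_lt_2pi[of z]
      by (intro nn_integral_periodic_shift[of "\<lambda>\<theta>. f (of_real (norm z) * cis \<theta>)"]) (auto simp: cis_mult[symmetric])
    finally show ?thesis .
  qed
  have "ennreal (2 * pi) * I = (\<integral>\<^sup>+\<theta>. indicator {0..<2*pi} \<theta> * I \<partial>lborel)"
    by (subst nn_integral_multc) auto
  also have "\<dots> = (\<integral>\<^sup>+\<theta>. \<integral>\<^sup>+z. indicator {0..<2*pi} \<theta> * (f (cis \<theta> * z) * indicator (ball 0 1) z) \<partial>lborel \<partial>lborel)"
  proof (rule nn_integral_cong)
    fix \<theta> :: real
    have "I = (\<integral>\<^sup>+z. f (cis \<theta> * z) * indicator (ball 0 1) (cis \<theta> * z) \<partial>lborel)"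
      unfolding I_def
      by (rule nn_integral_rotate[symmetric, of "\<lambda>z. f z * indicator (ball 0 1) z"])
         measurable
    also have "\<dots> = (\<integral>\<^sup>+z. f (cis \<theta> * z) * indicator (ball 0 1) z \<partial>lborel)"
      by (intro nn_integral_cong) (simp add: indicator_def norm_mult)
    finally show "indicator {0..<2*pi} \<theta> * I = (\<integral>\<^sup>+z. indicator {0..<2*pi} \<theta> * (f (cis \<theta> * z) * indicator (ball 0 1) z) \<partial>lborel)"
      by (simp add: nn_integral_cmult)
  qed
  also have "\<dots> = (\<integral>\<^sup>+z. \<integral>\<^sup>+\<theta>. indicator {0..<2*pi} \<theta> * (f (cis \<theta> * z) * indicator (ball 0 1) z) \<partial>lborel \<partial>lborel)"
    by (rule lborel_pair.Fubini'[symmetric]) measurable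
  also have "\<dots> = (\<integral>\<^sup>+z\<in>ball (0::complex) 1. g (norm z) \<partial>lborel)"
    unfolding inner[symmetric] by (intro nn_integral_cong) (simp add: nn_integral_cmult mult_ac)
  also have "\<dots> = (\<integral>\<^sup>+r\<in>{0..1}. ennreal (2 * pi * r) * g r \<partial>lborel)"
    by (rule nn_integral_radial) measurable
  also have "\<dots> = (\<integral>\<^sup>+r. ennreal (2 * pi) * (ennreal r * g r * indicator {0..1} r) \<partial>lborel)"
    by (intro nn_integral_cong) (auto simp: indicator_def ennreal_mult' mult_ac)
  also have "\<dots> = ennreal (2 * pi) * (\<integral>\<^sup>+r\<in>{0..1}. ennreal r * g r \<partial>lborel)"
    by (rule nn_integral_cmult) measurable
  finally show ?thesis
    unfolding I_def g_def by (subst (asm) ennreal_mult_cancel_left) auto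
qed

lemma nn_integral_disc_polar:
  fixes G :: "complex \<Rightarrow> real"
  assumes cont: "continuous_on (ball 0 1) G" and nonneg: "\<And>z. norm z < 1 \<Longrightarrow> 0 \<le> G z"
  shows "(\<integral>\<^sup>+z\<in>ball 0 1. ennreal (G z) \<partial>lborel)
    = (\<integral>\<^sup>+r\<in>{0..<1}. ennreal (r * integral {0..2*pi} (\<lambda>\<theta>. G (of_real r * cis \<theta>))) \<partial>lborel)"
proof -
  define f where "f z = ennreal (indicator (ball 0 1) z *\<^sub>R G z)" for z
  have "(\<lambda>z. indicator (ball 0 1) z *\<^sub>R G z) \<in> borel_measurable borel"
    by (rule borel_measurable_continuous_on_indicator[OF _ cont]) simp
  then have [measurable]: "f \<in> borel_measurable borel" unfolding f_def[abs_def] by measurable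
  have "(\<integral>\<^sup>+z\<in>ball 0 1. ennreal (G z) \<partial>lborel) = (\<integral>\<^sup>+z\<in>ball 0 1. f z \<partial>lborel)"
    by (intro nn_integral_cong) (simp add: f_def indicator_def)
  also have "\<dots> = (\<integral>\<^sup>+r\<in>{0..1}. ennreal r * (\<integral>\<^sup>+\<theta>\<in>{0..<2*pi}. f (of_real r * cis \<theta>) \<partial>lborel) \<partial>lborel)"
    by (rule nn_integral_polar) measurable
  also have "\<dots> = (\<integral>\<^sup>+r\<in>{0..<1}. ennreal (r * integral {0..2*pi} (\<lambda>\<theta>. G (of_real r * cis \<theta>))) \<partial>lborel)"
  proof (rule nn_integral_cong_AE)
    have inner: "(\<integral>\<^sup>+\<theta>\<in>{0..<2*pi}. f (of_real r * cis \<theta>) \<partial>lborel) = ennreal (integral {0..2*pi} (\<lambda>\<theta>. G (of_real r * cis \<theta>)))"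
      if r: "0 \<le> r" "r < 1" for r
    proof -
      have "continuous_on {0..2*pi} (\<lambda>\<theta>. G (of_real r * cis \<theta>))"
      proof (rule continuous_on_compose2[OF cont])
        show "(\<lambda>\<theta>. of_real r * cis \<theta>) ` {0..2*pi} \<subseteq> ball 0 1" using r by (auto simp: norm_mult)
      qed (intro continuous_intros)
      then have "((\<lambda>\<theta>. G (of_real r * cis \<theta>)) has_integral integral {0..2*pi} (\<lambda>\<theta>. G (of_real r * cis \<theta>))) {0..2*pi}"
        by (intro integrable_integral integrable_continuous_real)
      then have "(\<integral>\<^sup>+\<theta>. ennreal (G (of_real r * cis \<theta>)) * indicator {0..2*pi} \<theta> \<partial>lborel) = ennreal (integral {0..2*pi} (\<lambda>\<theta>. G (of_real r * cis \<theta>)))"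
        using r by (intro nn_integral_has_integral_lebesgue') (auto intro!: nonneg simp: norm_mult)
      moreover have "(\<integral>\<^sup>+\<theta>\<in>{0..<2*pi}. f (of_real r * cis \<theta>) \<partial>lborel) = (\<integral>\<^sup>+\<theta>. ennreal (G (of_real r * cis \<theta>)) * indicator {0..2*pi} \<theta> \<partial>lborel)"
      proof (rule nn_integral_cong_AE)
        have "AE \<theta> in lborel. \<theta> \<noteq> 2*pi" by (rule AE_lborel_singleton)
        then show "AE \<theta> in lborel. f (of_real r * cis \<theta>) * indicator {0..<2*pi} \<theta> = ennreal (G (of_real r * cis \<theta>)) * indicator {0..2*pi} \<theta>"
          by eventually_elim (use r in \<open>auto simp: f_def indicator_def norm_mult\<close>)
      qed
      ultimately show ?thesis by simp
    qed
    have "AE r in lborel. r \<noteq> (1::real)" by (rule AE_lborel_singleton)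
    then show "AE r in lborel. ennreal r * (\<integral>\<^sup>+\<theta>\<in>{0..<2*pi}. f (of_real r * cis \<theta>) \<partial>lborel) * indicator {0..1} r
      = ennreal (r * integral {0..2*pi} (\<lambda>\<theta>. G (of_real r * cis \<theta>))) * indicator {0..<1} r"
    proof eventually_elim
      case (elim r)
      show ?case
      proof (cases "0 \<le> r \<and> r < 1")
        case True
        then show ?thesis using inner[of r] by (simp add: ennreal_mult')
      next
        case False
        then show ?thesis using elim by (auto simp: indicator_def)
      qed
    qed
  qed
  finally show ?thesis .
qed

section \<open>Forelli-Rudin estimates\<close>

lemma norm_one_minus_cis:
  "norm (1 - of_real \<rho> * cis \<theta>) = norm (cis \<theta> - of_real \<rho>)"
proof -
  have "1 - of_real \<rho> * cis \<theta> = cis \<theta> * cnj (cis \<theta> - of_real \<rho>)"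
    by (simp add: algebra_simps cis_cnj cis_mult)
  then show ?thesis by (metis complex_mod_cnj mult_1 norm_cis norm_mult)
qed

text \<open>
  The distance of \<open>\<rho> * cis \<theta>\<close> to 1 is comparable to the sum of \<open>1 - \<rho>\<close> and the arc distance, and
  the resulting power is integrated over a half-line.
\<close>

lemma circle_kernel_bound:
  fixes \<alpha> :: real
  assumes \<alpha>: "1 < \<alpha>"
  shows "\<exists>C>0. \<forall>\<rho>\<in>{0..<1}. integral {0..2*pi} (\<lambda>\<theta>. norm (1 - of_real \<rho> * cis \<theta>) powr (-\<alpha>)) \<le> C * (1 - \<rho>) powr (1 - \<alpha>)"
proof -
  define C where "C = (1 + pi) powr \<alpha> * (2 / (\<alpha> - 1))"
  have "0 < 1 + pi" using pi_gt_zero by linarith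
  then have C: "0 < C" using \<alpha> unfolding C_def by (intro mult_pos_pos divide_pos_pos) auto
  have "integral {0..2*pi} (\<lambda>\<theta>. norm (1 - of_real \<rho> * cis \<theta>) powr (-\<alpha>)) \<le> C * (1 - \<rho>) powr (1 - \<alpha>)"
    if \<rho>: "\<rho> \<in> {0..<1}" for \<rho>
  proof -
    define e where "e = 1 - \<rho>"
    have e: "0 < e" using \<rho> by (auto simp: e_def)
    let ?g = "\<lambda>\<theta>. norm (1 - of_real \<rho> * cis \<theta>) powr (-\<alpha>)"
    have nz: "1 - of_real \<rho> * cis \<theta> \<noteq> 0" for \<theta>
    proof
      assume "1 - of_real \<rho> * cis \<theta> = 0"
      then have "norm (of_real \<rho> * cis \<theta>) = 1" by simp
      then show False using \<rho> by (simp add: norm_mult)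
    qed
    have "continuous_on {0..2*pi} ?g" using nz by (intro continuous_intros) auto
    then have "?g integrable_on {0..2*pi}" by (rule integrable_continuous_real)
    then have "(?g has_integral integral {0..2*pi} ?g) {0<..<2*pi}"
      by (simp add: has_integral_Icc_iff_Ioo[symmetric] integrable_integral)
    then have "ennreal (integral {0..2*pi} ?g) = (\<integral>\<^sup>+\<theta>. ennreal (?g \<theta>) * indicator {0<..<2*pi} \<theta> \<partial>lborel)"
      by (intro nn_integral_has_integral_lebesgue'[symmetric]) auto
    also have "\<dots> \<le> (\<integral>\<^sup>+\<theta>. ennreal ((1 + pi) powr \<alpha>) * (ennreal ((e + circle_gap \<theta>) powr (-\<alpha>)) * indicator {0<..<2*pi} \<theta>) \<partial>lborel)"
    proof (rule nn_integral_mono)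
      fix \<theta>
      show "ennreal (?g \<theta>) * indicator {0<..<2*pi} \<theta> \<le> ennreal ((1 + pi) powr \<alpha>) * (ennreal ((e + circle_gap \<theta>) powr (-\<alpha>)) * indicator {0<..<2*pi} \<theta>)"
      proof (cases "\<theta> \<in> {0<..<2*pi}")
        case True
        then have d: "0 < circle_gap \<theta>" by (auto simp: circle_gap_def)
        let ?n = "norm (1 - of_real \<rho> * cis \<theta>)"
        have "e \<le> ?n" "circle_gap \<theta> / pi \<le> ?n"
          using norm_cis_minus_real_ge[of \<theta> \<rho>] True \<rho> by (auto simp: norm_one_minus_cis e_def)
        then have "e + circle_gap \<theta> \<le> (1 + pi) * ?n"
          using pi_gt_zero by (simp add: field_simps)
        then have "((1 + pi) * ?n) powr (-\<alpha>) \<le> (e + circle_gap \<theta>) powr (-\<alpha>)"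
          using e d \<alpha> by (intro powr_mono2') auto
        then have "(1 + pi) powr \<alpha> * ((1 + pi) * ?n) powr (-\<alpha>) \<le> (1 + pi) powr \<alpha> * (e + circle_gap \<theta>) powr (-\<alpha>)"
          by (intro mult_left_mono) auto
        moreover have "(1 + pi) powr \<alpha> * ((1 + pi) * ?n) powr (-\<alpha>) = ?n powr (-\<alpha>)"
        proof -
          have "(1 + pi) powr \<alpha> * (1 + pi) powr (-\<alpha>) = 1"
            using \<open>0 < 1 + pi\<close> by (simp flip: powr_add)
          then show ?thesis using pi_gt_zero by (simp add: powr_mult)
        qed
        ultimately show ?thesis using True by (simp add: ennreal_mult[symmetric] ennreal_leI)
      next
        case False
        then have "indicator {0<..<2*pi} \<theta> = (0::ennreal)" by (simp only: indicator_def of_bool_def if_False)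
        then show ?thesis by simp
      qed
    qed
    also have "\<dots> = ennreal ((1 + pi) powr \<alpha>) * (\<integral>\<^sup>+\<theta>\<in>{0<..<2*pi}. ennreal ((e + circle_gap \<theta>) powr (-\<alpha>)) \<partial>lborel)"
      by (rule nn_integral_cmult) measurable
    also have "\<dots> \<le> ennreal ((1 + pi) powr \<alpha>) * (2 * (\<integral>\<^sup>+t\<in>{0<..}. ennreal ((e + t) powr (-\<alpha>)) \<partial>lborel))"
      by (intro mult_left_mono nn_integral_circle_gap_le) auto
    also have "(\<integral>\<^sup>+t\<in>{0<..}. ennreal ((e + t) powr (-\<alpha>)) \<partial>lborel) \<le> (\<integral>\<^sup>+t. ennreal ((e + t) powr (-\<alpha>)) * indicator {e..} (e + t) \<partial>lborel)"
      by (intro nn_integral_mono) (auto simp: indicator_def)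
    also have "\<dots> = (\<integral>\<^sup>+t. ennreal (t powr (-\<alpha>)) * indicator {e..} t \<partial>lborel)"
      using nn_integral_real_affine[of "\<lambda>t. ennreal (t powr (-\<alpha>)) * indicator {e..} t" 1 e] by simp
    also have "\<dots> = ennreal (- (e powr (-\<alpha>+1)) / (-\<alpha>+1))"
      using e \<alpha> by (intro nn_integral_has_integral_lebesgue' has_integral_powr_to_inf) auto
    also have "- (e powr (-\<alpha>+1)) / (-\<alpha>+1) = e powr (1-\<alpha>) / (\<alpha> - 1)"
      using \<alpha> by (simp add: field_simps)
    also have "ennreal ((1 + pi) powr \<alpha>) * (2 * ennreal (e powr (1-\<alpha>) / (\<alpha> - 1))) = ennreal (C * e powr (1 - \<alpha>))"
      using \<alpha> by (simp add: C_def ennreal_mult[symmetric] mult_ac flip: ennreal_numeral)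
    finally have "ennreal (integral {0..2*pi} ?g) \<le> ennreal (C * e powr (1 - \<alpha>))"
      by (simp add: mult_left_mono)
    then show ?thesis using C unfolding e_def by (subst (asm) ennreal_le_iff) auto
  qed
  then show ?thesis using C by blast
qed

lemma nn_integral_powr_to_one:
  assumes "-1 < \<beta>" "t < 1"
  shows "(\<integral>\<^sup>+r\<in>{t..1}. ennreal ((1 - r) powr \<beta>) \<partial>lborel) = ennreal ((1 - t) powr (\<beta> + 1) / (\<beta> + 1))"
proof -
  have "(\<integral>\<^sup>+r\<in>{t..1}. ennreal ((1 - r) powr \<beta>) \<partial>lborel) = (\<integral>\<^sup>+u. ennreal (u powr \<beta>) * indicator {0..1-t} u \<partial>lborel)"
    using nn_integral_real_affine[of "\<lambda>r. ennreal ((1 - r) powr \<beta>) * indicator {t..1} r" "-1" 1]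
    by (auto simp: indicator_def intro!: nn_integral_cong)
  also have "\<dots> = ennreal ((1 - t) powr (\<beta> + 1) / (\<beta> + 1))"
    using assms by (intro nn_integral_has_integral_lebesgue' has_integral_powr_from_0) auto
  finally show ?thesis .
qed

text \<open>
  The integral is split at \<open>r = t\<close>: \<open>1 - t * r\<close> is at least \<open>1 - r\<close> below \<open>t\<close> and at least \<open>1 - t\<close>
  above it.  The bound \<open>F\<close> leaves the integral over \<open>{0..t}\<close> open, since it is a power or a
  logarithm according to the exponent.
\<close>

lemma radial_kernel_bound:
  fixes \<alpha> \<beta> t F :: real
  assumes \<alpha>: "1 < \<alpha>" and \<beta>: "-1 < \<beta>" and t: "0 \<le> t" "t < 1"
    and F: "(\<integral>\<^sup>+r\<in>{0..t}. ennreal ((1 - r) powr (\<beta> + 1 - \<alpha>)) \<partial>lborel) \<le> ennreal F" "0 \<le> F"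
  shows "(\<integral>\<^sup>+r\<in>{0..<1}. ennreal ((1 - r) powr \<beta> * (1 - t * r) powr (1 - \<alpha>)) \<partial>lborel)
     \<le> ennreal (F + (1 - t) powr (\<beta> + 2 - \<alpha>) / (\<beta> + 1))"
proof -
  have "(\<integral>\<^sup>+r\<in>{0..<1}. ennreal ((1 - r) powr \<beta> * (1 - t * r) powr (1 - \<alpha>)) \<partial>lborel) \<le> 
    (\<integral>\<^sup>+r. ennreal ((1 - r) powr (\<beta> + 1 - \<alpha>)) * indicator {0..t} r
       + ennreal ((1 - t) powr (1 - \<alpha>)) * (ennreal ((1 - r) powr \<beta>) * indicator {t..1} r) \<partial>lborel)"
  proof (rule nn_integral_mono)
    fix r :: real
    show "ennreal ((1 - r) powr \<beta> * (1 - t * r) powr (1 - \<alpha>)) * indicator {0..<1} r \<le> 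
     ennreal ((1 - r) powr (\<beta> + 1 - \<alpha>)) * indicator {0..t} r
       + ennreal ((1 - t) powr (1 - \<alpha>)) * (ennreal ((1 - r) powr \<beta>) * indicator {t..1} r)"
    proof (cases "0 \<le> r \<and> r < 1")
      case r: True
      have 1: "t * r \<le> r" "t * r \<le> t" using r t mult_right_mono[of t 1 r] mult_left_mono[of r 1 t] by auto
      show ?thesis
      proof (cases "r \<le> t")
        case True
        have "(1 - t * r) powr (1 - \<alpha>) \<le> (1 - r) powr (1 - \<alpha>)"
          using 1 r \<alpha> by (intro powr_mono2') auto
        then have "(1 - r) powr \<beta> * (1 - t * r) powr (1 - \<alpha>) \<le> (1 - r) powr \<beta> * (1 - r) powr (1 - \<alpha>)"
          by (intro mult_left_mono) auto
        also have "\<dots> = (1 - r) powr (\<beta> + 1 - \<alpha>)" by (simp add: powr_add[symmetric] algebra_simps)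
        finally have "ennreal ((1 - r) powr \<beta> * (1 - t * r) powr (1 - \<alpha>)) \<le> ennreal ((1 - r) powr (\<beta> + 1 - \<alpha>))"
          by (rule ennreal_leI)
        then show ?thesis using r True by (simp add: add_increasing2)
      next
        case False
        have "(1 - t * r) powr (1 - \<alpha>) \<le> (1 - t) powr (1 - \<alpha>)"
          using 1 r t \<alpha> by (intro powr_mono2') auto
        then have "(1 - r) powr \<beta> * (1 - t * r) powr (1 - \<alpha>) \<le> (1 - t) powr (1 - \<alpha>) * (1 - r) powr \<beta>"
          by (subst mult.commute) (rule mult_right_mono, auto)
        then show ?thesis using r False t by (simp add: ennreal_mult[symmetric] ennreal_leI)
      qed
    next
      case False
      then have "indicator {0..<1} r = (0::ennreal)" by (auto simp: indicator_def)
      then show ?thesis by simp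
    qed
  qed
  also have "\<dots> = (\<integral>\<^sup>+r\<in>{0..t}. ennreal ((1 - r) powr (\<beta> + 1 - \<alpha>)) \<partial>lborel)
      + ennreal ((1 - t) powr (1 - \<alpha>)) * (\<integral>\<^sup>+r\<in>{t..1}. ennreal ((1 - r) powr \<beta>) \<partial>lborel)"
    by (subst nn_integral_add, measurable, subst nn_integral_cmult, measurable)
  also have "\<dots> \<le> ennreal F + ennreal ((1 - t) powr (1 - \<alpha>)) * ennreal ((1 - t) powr (\<beta> + 1) / (\<beta> + 1))"
    unfolding nn_integral_powr_to_one[OF \<beta> t(2)] by (intro add_right_mono F)
  also have "\<dots> = ennreal (F + (1 - t) powr (1 - \<alpha>) * ((1 - t) powr (\<beta> + 1) / (\<beta> + 1)))"
    using \<beta> F by (simp add: ennreal_mult[symmetric])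
  also have "(1 - t) powr (1 - \<alpha>) * ((1 - t) powr (\<beta> + 1) / (\<beta> + 1)) = (1 - t) powr (\<beta> + 2 - \<alpha>) / (\<beta> + 1)"
    by (simp add: powr_add[symmetric] algebra_simps)
  finally show ?thesis .
qed

text \<open>
  In polar coordinates \<open>circle_kernel_bound\<close> at \<open>\<rho> = t * r\<close> disposes of the angle, and
  \<open>1 - (norm z)\<^sup>2\<close> is comparable to \<open>1 - norm z\<close>.
\<close>

lemma disc_kernel_le_radial:
  fixes \<alpha> \<beta> :: real
  assumes \<alpha>: "1 < \<alpha>" and \<beta>: "-1 < \<beta>"
  shows "\<exists>C>0. \<forall>t\<in>{0..<1}. (\<integral>\<^sup>+z\<in>ball (0::complex) 1. ennreal (norm (1 - of_real t * z) powr (-\<alpha>) * (1 - (norm z)\<^sup>2) powr \<beta>) \<partial>lborel)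
    \<le> ennreal C * (\<integral>\<^sup>+r\<in>{0..<1}. ennreal ((1 - r) powr \<beta> * (1 - t * r) powr (1 - \<alpha>)) \<partial>lborel)"
proof -
  obtain C where C: "0 < C" "\<And>\<rho>. \<rho> \<in> {0..<1} \<Longrightarrow> integral {0..2*pi} (\<lambda>\<theta>. norm (1 - of_real \<rho> * cis \<theta>) powr (-\<alpha>)) \<le> C * (1 - \<rho>) powr (1 - \<alpha>)"
    using circle_kernel_bound[OF \<alpha>] by blast
  define D where "D = max 1 (2 powr \<beta>)"
  have D: "0 < D" by (simp add: D_def)
  have main: "(\<integral>\<^sup>+z\<in>ball (0::complex) 1. ennreal (norm (1 - of_real t * z) powr (-\<alpha>) * (1 - (norm z)\<^sup>2) powr \<beta>) \<partial>lborel)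
    \<le> ennreal (D * C) * (\<integral>\<^sup>+r\<in>{0..<1}. ennreal ((1 - r) powr \<beta> * (1 - t * r) powr (1 - \<alpha>)) \<partial>lborel)"
    if t: "t \<in> {0..<1}" for t
  proof -
    have nz: "1 - of_real t * z \<noteq> 0" if "norm z < 1" for z :: complex
    proof
      assume "1 - of_real t * z = 0"
      then have "norm (of_real t * z) = 1" by simp
      moreover have "t * norm z \<le> t * 1" using t that by (intro mult_left_mono) auto
      ultimately show False using t by (simp add: norm_mult)
    qed
    have "continuous_on (ball 0 1) (\<lambda>z::complex. norm (1 - of_real t * z) powr (-\<alpha>) * (1 - (norm z)\<^sup>2) powr \<beta>)"
    proof (intro continuous_on_mult continuous_on_powr continuous_intros ballI)
      fix z :: complex assume "z \<in> ball 0 1"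
      then show "norm (1 - of_real t * z) \<noteq> 0" "1 - (norm z)\<^sup>2 \<noteq> 0"
        using nz[of z] by (auto simp: abs_square_eq_1)
    qed
    then have "(\<integral>\<^sup>+z\<in>ball (0::complex) 1. ennreal (norm (1 - of_real t * z) powr (-\<alpha>) * (1 - (norm z)\<^sup>2) powr \<beta>) \<partial>lborel)
      = (\<integral>\<^sup>+r\<in>{0..<1}. ennreal (r * integral {0..2*pi} (\<lambda>\<theta>. norm (1 - of_real t * (of_real r * cis \<theta>)) powr (-\<alpha>) * (1 - (norm (of_real r * cis \<theta>))\<^sup>2) powr \<beta>)) \<partial>lborel)"
      by (rule nn_integral_disc_polar) auto
    also have "\<dots> \<le> (\<integral>\<^sup>+r. ennreal (D * C) * (ennreal ((1 - r) powr \<beta> * (1 - t * r) powr (1 - \<alpha>)) * indicator {0..<1} r) \<partial>lborel)"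
    proof (rule nn_integral_mono)
      fix r :: real
      show "ennreal (r * integral {0..2*pi} (\<lambda>\<theta>. norm (1 - of_real t * (of_real r * cis \<theta>)) powr (-\<alpha>) * (1 - (norm (of_real r * cis \<theta>))\<^sup>2) powr \<beta>)) * indicator {0..<1} r
        \<le> ennreal (D * C) * (ennreal ((1 - r) powr \<beta> * (1 - t * r) powr (1 - \<alpha>)) * indicator {0..<1} r)"
      proof (cases "0 \<le> r \<and> r < 1")
        case r: True
        have tr: "t * r \<in> {0..<1}" using r t mult_right_mono[of t 1 r] by auto
        have "(1 - r\<^sup>2) powr \<beta> = (1 - r) powr \<beta> * (1 + r) powr \<beta>"
          using r by (subst powr_mult[symmetric]) (auto simp: power2_eq_square algebra_simps)
        also have "\<dots> \<le> (1 - r) powr \<beta> * D"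
        proof (rule mult_left_mono)
          show "(1 + r) powr \<beta> \<le> D"
          proof (cases "0 \<le> \<beta>")
            case True
            then have "(1 + r) powr \<beta> \<le> 2 powr \<beta>" using r by (intro powr_mono2) auto
            then show ?thesis by (simp add: D_def)
          next
            case False
            then have "(1 + r) powr \<beta> \<le> 1 powr \<beta>" using r by (intro powr_mono2') auto
            then show ?thesis by (simp add: D_def)
          qed
        qed simp
        finally have w: "(1 - r\<^sup>2) powr \<beta> \<le> (1 - r) powr \<beta> * D" .
        have I0: "0 \<le> integral {0..2*pi} (\<lambda>\<theta>. norm (1 - of_real (t * r) * cis \<theta>) powr (-\<alpha>))"
        proof (rule integral_nonneg)
          have "1 - of_real (t * r) * cis \<theta> \<noteq> 0" for \<theta> using nz[of "of_real r * cis \<theta>"] r by (simp add: norm_mult mult.assoc)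
          then show "(\<lambda>\<theta>. norm (1 - of_real (t * r) * cis \<theta>) powr (-\<alpha>)) integrable_on {0..2*pi}"
            by (intro integrable_continuous_real continuous_intros) auto
        qed simp
        have "r * integral {0..2*pi} (\<lambda>\<theta>. norm (1 - of_real t * (of_real r * cis \<theta>)) powr (-\<alpha>) * (1 - (norm (of_real r * cis \<theta>))\<^sup>2) powr \<beta>)
           = r * (integral {0..2*pi} (\<lambda>\<theta>. norm (1 - of_real (t * r) * cis \<theta>) powr (-\<alpha>)) * (1 - r\<^sup>2) powr \<beta>)"
          using r by (simp add: norm_mult mult.assoc)
        also have "\<dots> \<le> 1 * ((C * (1 - t * r) powr (1 - \<alpha>)) * ((1 - r) powr \<beta> * D))"
          using r w C(2)[OF tr] C(1) I0 by (intro mult_mono) auto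
        finally have "ennreal (r * integral {0..2*pi} (\<lambda>\<theta>. norm (1 - of_real t * (of_real r * cis \<theta>)) powr (-\<alpha>) * (1 - (norm (of_real r * cis \<theta>))\<^sup>2) powr \<beta>))
           \<le> ennreal (D * C * ((1 - r) powr \<beta> * (1 - t * r) powr (1 - \<alpha>)))"
          by (intro ennreal_leI) (simp add: mult_ac)
        then show ?thesis using r C(1) D by (simp add: ennreal_mult)
      next
        case False
        then have "indicator {0..<1} r = (0::ennreal)" by (auto simp: indicator_def)
        then show ?thesis by simp
      qed
    qed
    also have "\<dots> = ennreal (D * C) * (\<integral>\<^sup>+r\<in>{0..<1}. ennreal ((1 - r) powr \<beta> * (1 - t * r) powr (1 - \<alpha>)) \<partial>lborel)"
      by (rule nn_integral_cmult) measurable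
    finally show ?thesis .
  qed
  then show ?thesis using C(1) D by (intro exI[of _ "D * C"]) auto
qed

lemma Forelli_Rudin_power:
  fixes \<alpha> e :: real
  assumes \<alpha>: "1 < \<alpha>" and e: "0 < e" "e < \<alpha> - 1"
  shows "\<exists>C>0. \<forall>t\<in>{0..<1}. (\<integral>\<^sup>+z\<in>ball (0::complex) 1. ennreal (norm (1 - of_real t * z) powr (-\<alpha>) * (1 - (norm z)\<^sup>2) powr (\<alpha> - 2 - e)) \<partial>lborel)
    \<le> ennreal (C * (1 - t) powr (-e))"
proof -
  have \<beta>: "-1 < \<alpha> - 2 - e" using e by simp
  obtain C where C: "0 < C" "\<And>t. t\<in>{0..<1} \<Longrightarrow> (\<integral>\<^sup>+z\<in>ball (0::complex) 1. ennreal (norm (1 - of_real t * z) powr (-\<alpha>) * (1 - (norm z)\<^sup>2) powr (\<alpha> - 2 - e)) \<partial>lborel)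
    \<le> ennreal C * (\<integral>\<^sup>+r\<in>{0..<1}. ennreal ((1 - r) powr (\<alpha> - 2 - e) * (1 - t * r) powr (1 - \<alpha>)) \<partial>lborel)"
    using disc_kernel_le_radial[OF \<alpha> \<beta>] by blast
  define D where "D = 1 / e + 1 / (\<alpha> - 1 - e)"
  have D: "0 < D" using e by (auto simp: D_def intro!: add_pos_pos)
  have "(\<integral>\<^sup>+r\<in>{0..<1}. ennreal ((1 - r) powr (\<alpha> - 2 - e) * (1 - t * r) powr (1 - \<alpha>)) \<partial>lborel) \<le> ennreal (D * (1 - t) powr (-e))"
    if t: "t \<in> {0..<1}" for t
  proof -
    have "(\<integral>\<^sup>+r\<in>{0..t}. ennreal ((1 - r) powr (\<alpha> - 2 - e + 1 - \<alpha>)) \<partial>lborel) = ennreal ((1 - t) powr (-e) / e - (1 - 0) powr (-e) / e)"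
      using t e by (intro nn_integral_FTC_Icc[where F="\<lambda>r. (1 - r) powr (-e) / e"]) (auto intro!: derivative_eq_intros)
    also have "\<dots> \<le> ennreal ((1 - t) powr (-e) / e)" using e by (intro ennreal_leI) auto
    finally have "(\<integral>\<^sup>+r\<in>{0..<1}. ennreal ((1 - r) powr (\<alpha> - 2 - e) * (1 - t * r) powr (1 - \<alpha>)) \<partial>lborel)
     \<le> ennreal ((1 - t) powr (-e) / e + (1 - t) powr (\<alpha> - 2 - e + 2 - \<alpha>) / (\<alpha> - 2 - e + 1))"
      using t e by (intro radial_kernel_bound[OF \<alpha> \<beta>]) auto
    also have "(1 - t) powr (-e) / e + (1 - t) powr (\<alpha> - 2 - e + 2 - \<alpha>) / (\<alpha> - 2 - e + 1) = D * (1 - t) powr (-e)"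
      by (simp add: D_def algebra_simps)
    finally show ?thesis .
  qed
  note that' = this
  have "(\<integral>\<^sup>+z\<in>ball (0::complex) 1. ennreal (norm (1 - of_real t * z) powr (-\<alpha>) * (1 - (norm z)\<^sup>2) powr (\<alpha> - 2 - e)) \<partial>lborel)
     \<le> ennreal C * ennreal (D * (1 - t) powr (-e))" if t: "t \<in> {0..<1}" for t
    by (rule order_trans[OF C(2)[OF t]]) (intro mult_left_mono that' t zero_le)
  then show ?thesis using C(1) D
    by (intro exI[of _ "C * D"]) (simp add: ennreal_mult[symmetric] mult.assoc)
qed

text \<open>
  At the critical exponent the integral over \<open>{0..t}\<close> is that of \<open>1 / (1 - r)\<close>.
\<close>

lemma Forelli_Rudin_log:
  fixes \<alpha> :: real
  assumes \<alpha>: "1 < \<alpha>"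
  shows "\<exists>C>0. \<forall>t\<in>{0..<1}. (\<integral>\<^sup>+z\<in>ball (0::complex) 1. ennreal (norm (1 - of_real t * z) powr (-\<alpha>) * (1 - (norm z)\<^sup>2) powr (\<alpha> - 2)) \<partial>lborel)
    \<le> ennreal (C * ln (2 / (1 - t)))"
proof -
  have \<beta>: "-1 < \<alpha> - 2" using \<alpha> by simp
  obtain C where C: "0 < C" "\<And>t. t\<in>{0..<1} \<Longrightarrow> (\<integral>\<^sup>+z\<in>ball (0::complex) 1. ennreal (norm (1 - of_real t * z) powr (-\<alpha>) * (1 - (norm z)\<^sup>2) powr (\<alpha> - 2)) \<partial>lborel)
    \<le> ennreal C * (\<integral>\<^sup>+r\<in>{0..<1}. ennreal ((1 - r) powr (\<alpha> - 2) * (1 - t * r) powr (1 - \<alpha>)) \<partial>lborel)"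
    using disc_kernel_le_radial[OF \<alpha> \<beta>] by blast
  define D where "D = 1 + 1 / (\<alpha> - 1) / ln 2"
  have D: "0 < D" using \<alpha> by (auto simp: D_def intro!: add_pos_nonneg)
  have "(\<integral>\<^sup>+r\<in>{0..<1}. ennreal ((1 - r) powr (\<alpha> - 2) * (1 - t * r) powr (1 - \<alpha>)) \<partial>lborel) \<le> ennreal (D * ln (2 / (1 - t)))"
    if t: "t \<in> {0..<1}" for t
  proof -
    have "(\<integral>\<^sup>+r\<in>{0..t}. ennreal ((1 - r) powr (\<alpha> - 2 + 1 - \<alpha>)) \<partial>lborel) = ennreal (- ln (1 - t) - (- ln (1 - 0)))"
      using t by (intro nn_integral_FTC_Icc[where F="\<lambda>r. - ln (1 - r)"]) (auto intro!: derivative_eq_intros simp: powr_minus_divide)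
    also have "- ln (1 - t) - (- ln (1 - 0)) = ln (1 / (1 - t))" using t by (simp add: ln_div)
    finally have 1: "(\<integral>\<^sup>+r\<in>{0..t}. ennreal ((1 - r) powr (\<alpha> - 2 + 1 - \<alpha>)) \<partial>lborel) \<le> ennreal (ln (1 / (1 - t)))" by simp
    have "(\<integral>\<^sup>+r\<in>{0..<1}. ennreal ((1 - r) powr (\<alpha> - 2) * (1 - t * r) powr (1 - \<alpha>)) \<partial>lborel)
     \<le> ennreal (ln (1 / (1 - t)) + (1 - t) powr (\<alpha> - 2 + 2 - \<alpha>) / (\<alpha> - 2 + 1))"
      using t by (intro radial_kernel_bound[OF \<alpha> \<beta> _ _ 1]) auto
    also have "\<dots> \<le> ennreal (D * ln (2 / (1 - t)))"
    proof (rule ennreal_leI)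
      have l: "ln (1 / (1 - t)) \<le> ln (2 / (1 - t))" "ln 2 \<le> ln (2 / (1 - t))"
        using t by (auto simp: ln_div divide_right_mono)
      have "1 / (\<alpha> - 1) = 1 / (\<alpha> - 1) / ln 2 * ln 2" by simp
      also have "\<dots> \<le> 1 / (\<alpha> - 1) / ln 2 * ln (2 / (1 - t))"
        using l(2) \<alpha> by (intro mult_left_mono) auto
      finally have "1 / (\<alpha> - 1) \<le> 1 / (\<alpha> - 1) / ln 2 * ln (2 / (1 - t))" .
      moreover have "(1 - t) powr (\<alpha> - 2 + 2 - \<alpha>) / (\<alpha> - 2 + 1) = 1 / (\<alpha> - 1)"
        using t by simp
      moreover have "D * ln (2 / (1 - t)) = ln (2 / (1 - t)) + 1 / (\<alpha> - 1) / ln 2 * ln (2 / (1 - t))"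
        unfolding D_def by (subst distrib_right) simp
      ultimately show "ln (1 / (1 - t)) + (1 - t) powr (\<alpha> - 2 + 2 - \<alpha>) / (\<alpha> - 2 + 1) \<le> D * ln (2 / (1 - t))"
        using l by linarith
    qed
    finally show ?thesis .
  qed
  note that' = this
  have "(\<integral>\<^sup>+z\<in>ball (0::complex) 1. ennreal (norm (1 - of_real t * z) powr (-\<alpha>) * (1 - (norm z)\<^sup>2) powr (\<alpha> - 2)) \<partial>lborel)
     \<le> ennreal C * ennreal (D * ln (2 / (1 - t)))" if t: "t \<in> {0..<1}" for t
    by (rule order_trans[OF C(2)[OF t]]) (intro mult_left_mono that' t zero_le)
  moreover have "0 \<le> D * ln (2 / (1 - t))" if "t \<in> {0..<1}" for t
    using that D by (intro mult_nonneg_nonneg) auto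
  ultimately show ?thesis using C(1) D
    by (intro exI[of _ "C * D"]) (simp add: ennreal_mult[symmetric] mult.assoc)
qed

section \<open>Hardy's inequality, a Beta integral and Tauber's theorem\<close>

text \<open>
  Hardy's inequality for nonnegative coefficients, by duality: \<open>F\<close> is paired on the circle of radius
  \<open>r\<close> with a function bounded by \<open>pi\<close> that gives the \<open>n\<close>-th power the integral \<open>2 * pi / (n + 1)\<close>.
\<close>

lemma Hardy_pairing:
  fixes A :: "nat \<Rightarrow> real" and F :: "complex \<Rightarrow> complex"
  assumes A: "\<And>n. 0 \<le> A n" and F: "\<And>z. norm z < 1 \<Longrightarrow> (\<lambda>n. of_real (A n) * z ^ n) sums F z"
    and r: "0 \<le> r" "r < 1"
  shows "(\<Sum>n<N. A n * r ^ n / (n + 1)) \<le> 1 / 2 * integral {0..2*pi} (\<lambda>\<theta>. norm (F (of_real r * cis \<theta>)))"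
proof -
  (* The sawtooth pi - theta has Fourier coefficients proportional to 1 / n; the factor cis theta
     shifts them, so that the denominators become n + 1. *)
  define \<phi> where "\<phi> \<theta> = - \<i> * of_real (pi - \<theta>) * cis \<theta>" for \<theta>
  define u where "u k \<theta> = of_real (A k) * (of_real r * cis \<theta>) ^ k * \<phi> \<theta>" for k \<theta>
  have sumA: "summable (\<lambda>n. A n * r ^ n)"
  proof -
    have "summable (\<lambda>n. of_real (A n) * (of_real r :: complex) ^ n)"
      using F[of "of_real r"] r by (auto simp: sums_iff)
    then have "summable (\<lambda>n. complex_of_real (A n * r ^ n))" by simp
    then show ?thesis by (simp only: summable_complex_of_real)
  qed
  have u_int: "(u k has_integral of_real (2 * pi * (A k * r ^ k / (k + 1)))) {0..2*pi}" for k
  proof -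
    define m where "m = real (Suc k)"
    have m: "m \<noteq> 0" by (simp add: m_def)
    define G where "G \<theta> = of_real (A k * r ^ k) * (- (of_real (pi - \<theta>) * cis (m * \<theta>) / of_real m) + \<i> * cis (m * \<theta>) / of_real (m\<^sup>2))" for \<theta>
    have "(G has_vector_derivative u k \<theta>) (at \<theta> within {0..2*pi})" for \<theta>
    proof -
      have eq: "u k \<theta> = of_real (A k * r ^ k) * (- \<i> * of_real (pi - \<theta>) * cis (m * \<theta>))"
      proof -
        have "cis (m * \<theta>) = cis (real k * \<theta>) * cis \<theta>" by (simp add: m_def cis_mult algebra_simps)
        then show ?thesis unfolding u_def \<phi>_def by (simp add: power_mult_distrib Complex.DeMoivre)
      qed
      have d: "((\<lambda>\<theta>. cis (m * \<theta>)) has_vector_derivative (of_real m * (\<i> * cis (m * \<theta>)))) (at \<theta> within {0..2*pi})"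
      proof -
        have "((\<lambda>z. exp (\<i> * (of_real m * z))) has_field_derivative (of_real m * (\<i> * exp (\<i> * (of_real m * of_real \<theta>))))) (at (of_real \<theta>))"
          by (auto intro!: derivative_eq_intros)
        from has_vector_derivative_real_field[OF this] show ?thesis by (simp add: cis_conv_exp)
      qed
      have e: "((\<lambda>\<theta>. complex_of_real (pi - \<theta>)) has_vector_derivative - 1) (at \<theta> within {0..2*pi})"
        by (auto intro!: derivative_eq_intros simp: has_vector_derivative_def scaleR_conv_of_real)
      have "(G has_vector_derivative (of_real (A k * r ^ k) * (- ((of_real (pi - \<theta>) * (of_real m * (\<i> * cis (m * \<theta>))) + (-1) * cis (m * \<theta>)) / of_real m)
         + \<i> * (of_real m * (\<i> * cis (m * \<theta>))) / of_real (m\<^sup>2)))) (at \<theta> within {0..2*pi})"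
        unfolding G_def
        by (intro has_vector_derivative_mult_right has_vector_derivative_add has_vector_derivative_minus
            has_vector_derivative_divide has_vector_derivative_mult d e)
      also have "(of_real (A k * r ^ k) * (- ((of_real (pi - \<theta>) * (of_real m * (\<i> * cis (m * \<theta>))) + (-1) * cis (m * \<theta>)) / of_real m)
         + \<i> * (of_real m * (\<i> * cis (m * \<theta>))) / of_real (m\<^sup>2))) = u k \<theta>"
        unfolding eq using m by (simp add: field_simps power2_eq_square)
      finally show ?thesis .
    qed
    then have "(u k has_integral (G (2*pi) - G 0)) {0..2*pi}"
      by (intro fundamental_theorem_of_calculus) auto
    also have "G (2*pi) - G 0 = of_real (2 * pi * (A k * r ^ k / (k + 1)))"
    proof -
      have "cis (m * (2 * pi)) = 1" unfolding m_def by (metis cis_multiple_2pi Ints_of_nat mult.commute)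
      then show ?thesis using m by (simp add: G_def field_simps m_def)
    qed
    finally show ?thesis .
  qed
  have norm_\<phi>: "norm (\<phi> \<theta>) \<le> pi" if "\<theta> \<in> {0..2*pi}" for \<theta>
    using that by (simp add: \<phi>_def norm_mult del: of_real_diff) (auto simp: abs_if)
  have ul: "uniform_limit {0..2*pi} (\<lambda>n \<theta>. \<Sum>k<n. u k \<theta>) (\<lambda>\<theta>. F (of_real r * cis \<theta>) * \<phi> \<theta>) sequentially"
  proof -
    have "uniform_limit {0..2*pi} (\<lambda>n \<theta>. \<Sum>k<n. u k \<theta>) (\<lambda>\<theta>. suminf (\<lambda>k. u k \<theta>)) sequentially"
    proof (rule Weierstrass_m_test[of _ _ "\<lambda>k. A k * r ^ k * pi"])
      fix k \<theta> assume "\<theta> \<in> {0..2*pi}"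
      then show "norm (u k \<theta>) \<le> A k * r ^ k * pi"
        using norm_\<phi> A r by (simp add: u_def norm_mult norm_power mult_left_mono)
    qed (intro summable_mult2 sumA)
    moreover have "suminf (\<lambda>k. u k \<theta>) = F (of_real r * cis \<theta>) * \<phi> \<theta>" for \<theta>
    proof -
      have "(\<lambda>k. u k \<theta>) sums (F (of_real r * cis \<theta>) * \<phi> \<theta>)"
        unfolding u_def by (intro sums_mult2 F) (use r in \<open>simp add: norm_mult\<close>)
      then show ?thesis by (simp add: sums_iff)
    qed
    ultimately show ?thesis by simp
  qed
  have uc: "continuous_on {0..2*pi} (\<lambda>\<theta>. \<Sum>k<n. u k \<theta>)" for n
    unfolding u_def \<phi>_def by (intro continuous_intros)
  obtain I J where IJ: "\<And>n. ((\<lambda>\<theta>. \<Sum>k<n. u k \<theta>) has_integral I n) {0..2*pi}"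
     "((\<lambda>\<theta>. F (of_real r * cis \<theta>) * \<phi> \<theta>) has_integral J) {0..2*pi}" "(I \<longlongrightarrow> J) sequentially"
    using uniform_limit_integral[OF ul uc] by auto
  have I: "I n = of_real (2 * pi * (\<Sum>k<n. A k * r ^ k / (k + 1)))" for n
  proof -
    have "((\<lambda>\<theta>. \<Sum>k<n. u k \<theta>) has_integral (\<Sum>k<n. of_real (2 * pi * (A k * r ^ k / (k + 1))))) {0..2*pi}"
      by (intro has_integral_sum u_int) auto
    from has_integral_unique[OF IJ(1)[of n] this] show ?thesis
      by (simp only: of_real_sum[symmetric] sum_distrib_left[symmetric])
  qed
  have "(\<lambda>n. 2 * pi * (\<Sum>k<n. A k * r ^ k / (k + 1))) \<longlonglongrightarrow> Re J"
    using tendsto_Re[OF IJ(3)] unfolding I Re_complex_of_real .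
  moreover have "incseq (\<lambda>n. 2 * pi * (\<Sum>k<n. A k * r ^ k / (k + 1)))"
    using A r by (intro incseq_SucI mult_left_mono) auto
  ultimately have "2 * pi * (\<Sum>k<N. A k * r ^ k / (k + 1)) \<le> Re J"
    using incseq_le by blast
  also have "\<dots> \<le> norm J" by (rule complex_Re_le_cmod)
  also have "J = integral {0..2*pi} (\<lambda>\<theta>. F (of_real r * cis \<theta>) * \<phi> \<theta>)"
    using IJ(2) by (rule integral_unique[symmetric])
  also have "norm \<dots> \<le> integral {0..2*pi} (\<lambda>\<theta>. norm (F (of_real r * cis \<theta>)) * pi)"
  proof (rule integral_norm_bound_integral)
    show "(\<lambda>\<theta>. F (of_real r * cis \<theta>) * \<phi> \<theta>) integrable_on {0..2*pi}" using IJ(2) by blast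
    have "F holomorphic_on ball 0 1"
      by (rule power_series_holomorphic[where a="\<lambda>n. of_real (A n)"]) (use F in auto)
    then have "continuous_on {0..2*pi} (\<lambda>\<theta>. norm (F (of_real r * cis \<theta>)) powr 1)"
      using r by (intro continuous_on_circle_powr) auto
    then show "(\<lambda>\<theta>. norm (F (of_real r * cis \<theta>)) * pi) integrable_on {0..2*pi}"
      by (intro integrable_continuous_real continuous_on_mult continuous_on_const) simp
    show "norm (F (of_real r * cis \<theta>) * \<phi> \<theta>) \<le> norm (F (of_real r * cis \<theta>)) * pi" if "\<theta> \<in> {0..2*pi}" for \<theta>
      unfolding norm_mult by (intro mult_left_mono norm_\<phi> that) auto
  qed
  also have "\<dots> = integral {0..2*pi} (\<lambda>\<theta>. norm (F (of_real r * cis \<theta>))) * pi" by simp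
  finally show ?thesis by simp
qed

text \<open>
  Replacing \<open>r ^ n\<close> by the smaller \<open>r ^ (2 * n)\<close> makes this a Beta integral in the variable \<open>r\<^sup>2\<close>.
\<close>

lemma radial_Beta_lower:
  fixes \<alpha> :: real
  assumes "1 < \<alpha>"
  shows "ennreal (Beta (real n + 1) (\<alpha> - 1) / 2) \<le> (\<integral>\<^sup>+r\<in>{0..<1}. ennreal (r * r ^ n * (1 - r\<^sup>2) powr (\<alpha> - 2)) \<partial>lborel)"
proof -
  have "ennreal (Beta (real n + 1) (\<alpha> - 1)) = (\<integral>\<^sup>+x. ennreal (x powr (real n + 1 - 1) * (1 - x) powr (\<alpha> - 1 - 1)) * indicator {0..1} x \<partial>lborel)"
    using assms by (intro nn_integral_has_integral_lebesgue'[symmetric] has_integral_Beta_real) auto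
  also have "\<dots> = (\<integral>\<^sup>+x. ennreal (x powr (real n + 1 - 1) * (1 - x) powr (\<alpha> - 1 - 1) * indicator {0\<^sup>2..1\<^sup>2} x) \<partial>lborel)"
    by (intro nn_integral_cong) (auto simp: indicator_def)
  also have "\<dots> = (\<integral>\<^sup>+r. ennreal ((r\<^sup>2) powr (real n + 1 - 1) * (1 - r\<^sup>2) powr (\<alpha> - 1 - 1) * (2 * r) * indicator {0..1} r) \<partial>lborel)"
    by (rule nn_integral_substitution[where g="\<lambda>r. r\<^sup>2" and g'="\<lambda>r. 2 * r" and a=0 and b=1 and
          f="\<lambda>x. x powr (real n + 1 - 1) * (1 - x) powr (\<alpha> - 1 - 1)"])
       (auto intro!: derivative_eq_intros continuous_intros simp: set_borel_measurable_def)
  also have "\<dots> = (\<integral>\<^sup>+r. ennreal ((r\<^sup>2) powr (real n + 1 - 1) * (1 - r\<^sup>2) powr (\<alpha> - 1 - 1) * (2 * r)) * indicator {0..1} r \<partial>lborel)"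
    by (intro nn_integral_cong) (auto simp: indicator_def)
  also have "\<dots> \<le> (\<integral>\<^sup>+r. 2 * (ennreal (r * r ^ n * (1 - r\<^sup>2) powr (\<alpha> - 2)) * indicator {0..<1} r) \<partial>lborel)"
  proof (rule nn_integral_mono_AE)
    have "AE r in lborel. r \<noteq> (1::real)" "AE r in lborel. r \<noteq> (0::real)" by (rule AE_lborel_singleton)+
    then show "AE r in lborel. ennreal ((r\<^sup>2) powr (real n + 1 - 1) * (1 - r\<^sup>2) powr (\<alpha> - 1 - 1) * (2 * r)) * indicator {0..1} r
       \<le> 2 * (ennreal (r * r ^ n * (1 - r\<^sup>2) powr (\<alpha> - 2)) * indicator {0..<1} r)"
    proof eventually_elim
      case (elim r)
      show ?case
      proof (cases "0 < r \<and> r < 1")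
        case True
        have "(r\<^sup>2) powr (real n) = r ^ n * r ^ n"
          using True by (simp add: powr_realpow power_mult_distrib power2_eq_square)
        also have "\<dots> \<le> r ^ n * 1" using True by (intro mult_left_mono) (auto simp: power_le_one)
        finally have "(r\<^sup>2) powr (real n) * (1 - r\<^sup>2) powr (\<alpha> - 2) * (2 * r) \<le> r ^ n * (1 - r\<^sup>2) powr (\<alpha> - 2) * (2 * r)"
          using True by (intro mult_right_mono) auto
        then have "ennreal ((r\<^sup>2) powr (real n) * (1 - r\<^sup>2) powr (\<alpha> - 2) * (2 * r)) \<le> ennreal (2 * (r * r ^ n * (1 - r\<^sup>2) powr (\<alpha> - 2)))"
          by (intro ennreal_leI) (simp add: mult_ac)
        then show ?thesis using True by (simp add: ennreal_mult)
      qed (use elim in \<open>auto simp: indicator_def\<close>)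
    qed
  qed
  also have "\<dots> = 2 * (\<integral>\<^sup>+r\<in>{0..<1}. ennreal (r * r ^ n * (1 - r\<^sup>2) powr (\<alpha> - 2)) \<partial>lborel)"
    by (rule nn_integral_cmult) measurable
  finally have "ennreal (1 / 2) * ennreal (Beta (real n + 1) (\<alpha> - 1)) \<le> ennreal (1 / 2) * (2 * (\<integral>\<^sup>+r\<in>{0..<1}. ennreal (r * r ^ n * (1 - r\<^sup>2) powr (\<alpha> - 2)) \<partial>lborel))"
    by (rule mult_left_mono) simp
  moreover have "ennreal (1 / 2) * 2 = 1"
  proof -
    have "ennreal (1 / 2) * ennreal 2 = ennreal (1 / 2 * 2)" by (rule ennreal_mult[symmetric]) auto
    then show ?thesis by (simp only: ennreal_numeral) simp
  qed
  moreover have "ennreal (1 / 2) * ennreal (Beta (real n + 1) (\<alpha> - 1)) = ennreal (Beta (real n + 1) (\<alpha> - 1) / 2)"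
    by (subst ennreal_mult'[symmetric]) auto
  ultimately show ?thesis
    by (simp only: mult.assoc[symmetric] mult_1)
qed

text \<open>
  Compare the partial sum up to \<open>n\<close> with the Abel mean at \<open>r = 1 - 1 / (n + 2)\<close>.  They differ by at
  most the average of \<open>k * norm (c k)\<close> over \<open>k \<le> n\<close>, plus a tail bounded by twice the supremum of
  \<open>k * norm (c k)\<close> over \<open>k > n\<close>, and both tend to 0.
\<close>

lemma Tauber:
  fixes c :: "nat \<Rightarrow> complex" and A :: "real \<Rightarrow> complex"
  assumes c: "(\<lambda>k. real k * norm (c k)) \<longlonglongrightarrow> 0"
    and A: "\<And>r. 0 < r \<Longrightarrow> r < 1 \<Longrightarrow> (\<lambda>k. c k * of_real r ^ k) sums A r"
    and L: "(A \<longlongrightarrow> L) (at_left 1)"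
  shows "c sums L"
proof -
  (* The shift by 2 keeps the radius positive for n = 0. *)
  define \<rho> where "\<rho> n = 1 - 1 / real (n + 2)" for n
  have \<rho>: "0 < \<rho> n" "\<rho> n < 1" for n by (auto simp: \<rho>_def field_simps)
  have "(\<lambda>n. (\<Sum>k\<le>n. c k) - A (\<rho> n)) \<longlonglongrightarrow> 0"
  proof (rule LIMSEQ_I)
    fix e :: real assume e: "0 < e"
    obtain K where K: "\<And>k. k \<ge> K \<Longrightarrow> real k * norm (c k) \<le> e / 4"
      using order_tendstoD(2)[OF c, of "e / 4"] e by (auto simp: eventually_sequentially dest: less_imp_le)
    define B where "B = (\<Sum>k<K. real k * norm (c k))"
    have B: "0 \<le> B" by (auto simp: B_def intro!: sum_nonneg)
    obtain M :: nat where M: "4 * B / e < real M" using reals_Archimedean2 by blast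
    have "norm ((\<Sum>k\<le>n. c k) - A (\<rho> n)) < e" if n: "n \<ge> max K M" for n
    proof -
      let ?r = "\<rho> n"
      have s: "(\<lambda>k. c k * of_real ?r ^ k) sums A ?r" using A[OF \<rho>] .
      have tail_bound: "norm (c (k + Suc n) * of_real ?r ^ (k + Suc n)) \<le> e / 4 / real (n + 1) * ?r ^ k" for k
      proof -
        have "real (n + 1) * norm (c (k + Suc n)) \<le> real (k + Suc n) * norm (c (k + Suc n))"
          by (intro mult_right_mono) auto
        also have "\<dots> \<le> e / 4" using n by (intro K) auto
        finally have "norm (c (k + Suc n)) \<le> e / 4 / real (n + 1)" by (simp add: field_simps)
        moreover have "?r ^ (k + Suc n) \<le> ?r ^ k" using \<rho>[of n] by (intro power_decreasing) auto
        ultimately have "norm (c (k + Suc n)) * ?r ^ (k + Suc n) \<le> e / 4 / real (n + 1) * ?r ^ k"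
          using \<rho>[of n] e by (intro mult_mono) auto
        moreover have "norm (of_real ?r :: complex) = ?r" using \<rho>[of n] by simp
        ultimately show ?thesis unfolding norm_mult norm_power by simp
      qed
      have geo: "summable (\<lambda>k. e / 4 / real (n + 1) * ?r ^ k)"
        using \<rho>[of n] by (intro summable_mult summable_geometric) auto
      have "A ?r = (\<Sum>k<Suc n. c k * of_real ?r ^ k) + (\<Sum>k. c (k + Suc n) * of_real ?r ^ (k + Suc n))"
        using s suminf_split_initial_segment[of "\<lambda>k. c k * of_real ?r ^ k" "Suc n"] by (simp add: sums_iff)
      moreover have "norm (\<Sum>k. c (k + Suc n) * of_real ?r ^ (k + Suc n)) \<le> (\<Sum>k. e / 4 / real (n + 1) * ?r ^ k)"
        by (rule norm_suminf_le[OF tail_bound geo])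
      moreover have "(\<Sum>k. e / 4 / real (n + 1) * ?r ^ k) = e / 4 / real (n + 1) * real (n + 2)"
        using \<rho>[of n] by (subst suminf_mult) (auto simp: suminf_geometric summable_geometric \<rho>_def)
      moreover have "e / 4 / real (n + 1) * real (n + 2) \<le> e / 2" using e by (simp add: field_simps)
      moreover have "norm ((\<Sum>k\<le>n. c k) - (\<Sum>k<Suc n. c k * of_real ?r ^ k)) \<le> B / real (n + 2) + e / 4"
      proof -
        have "norm ((\<Sum>k\<le>n. c k) - (\<Sum>k<Suc n. c k * of_real ?r ^ k)) = norm (\<Sum>k\<le>n. c k * (1 - of_real ?r ^ k))"
          by (simp add: lessThan_Suc_atMost sum_subtractf algebra_simps)
        also have "\<dots> \<le> (\<Sum>k\<le>n. real k * norm (c k) / real (n + 2))"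
        proof (rule sum_norm_le)
          fix k
          have "1 + real k * (- (1 / real (n + 2))) \<le> (1 + - (1 / real (n + 2))) ^ k"
            by (rule Bernoulli_inequality) (auto simp: field_simps)
          then have "1 - ?r ^ k \<le> real k / real (n + 2)" by (simp add: \<rho>_def)
          moreover have "norm (1 - of_real ?r ^ k :: complex) = 1 - ?r ^ k"
          proof -
            have "0 \<le> 1 - ?r ^ k" using \<rho>[of n] by (simp add: power_le_one)
            then show ?thesis by (metis abs_of_nonneg norm_of_real of_real_1 of_real_diff of_real_power)
          qed
          ultimately have "norm (c k) * norm (1 - of_real ?r ^ k :: complex) \<le> norm (c k) * (real k / real (n + 2))"
            by (intro mult_left_mono) auto
          then show "norm (c k * (1 - of_real ?r ^ k)) \<le> real k * norm (c k) / real (n + 2)"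
            by (simp add: norm_mult mult_ac)
        qed
        also have "\<dots> = (\<Sum>k\<le>n. real k * norm (c k)) / real (n + 2)" by (simp add: sum_divide_distrib)
        also have "\<dots> \<le> (B + real (n + 2) * (e / 4)) / real (n + 2)"
        proof (rule divide_right_mono)
          have "(\<Sum>k\<le>n. real k * norm (c k)) \<le> (\<Sum>k\<le>n. (if k < K then real k * norm (c k) else 0) + e / 4)"
            using K e by (intro sum_mono) (auto simp: not_less)
          also have "\<dots> = (\<Sum>k\<le>n. if k < K then real k * norm (c k) else 0) + real (n + 1) * (e / 4)"
            by (simp add: sum.distrib)
          also have "(\<Sum>k\<le>n. if k < K then real k * norm (c k) else 0) \<le> B"
            unfolding B_def using n by (subst sum.inter_filter[symmetric]) (auto intro!: sum_mono2)
          also have "real (n + 1) * (e / 4) \<le> real (n + 2) * (e / 4)"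
            using e by (intro mult_right_mono) auto
          finally show "(\<Sum>k\<le>n. real k * norm (c k)) \<le> B + real (n + 2) * (e / 4)"
            by simp
        qed simp
        also have "\<dots> = B / real (n + 2) + e / 4"
          by (subst add_divide_distrib, subst nonzero_mult_div_cancel_left) auto
        finally show ?thesis .
      qed
      moreover have "B / real (n + 2) < e / 4"
      proof -
        have "4 * B / e < real (n + 2)" using M n by linarith
        then show ?thesis using e by (simp add: field_simps)
      qed
      moreover have "norm ((\<Sum>k\<le>n. c k) - A ?r) \<le> norm ((\<Sum>k\<le>n. c k) - (\<Sum>k<Suc n. c k * of_real ?r ^ k))
          + norm (\<Sum>k. c (k + Suc n) * of_real ?r ^ (k + Suc n))"
        if "A ?r = (\<Sum>k<Suc n. c k * of_real ?r ^ k) + (\<Sum>k. c (k + Suc n) * of_real ?r ^ (k + Suc n))"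
        unfolding that using norm_triangle_ineq4[of "(\<Sum>k\<le>n. c k) - (\<Sum>k<Suc n. c k * of_real ?r ^ k)"] by (simp only: diff_diff_eq)
      ultimately show ?thesis by linarith
    qed
    then show "\<exists>no. \<forall>n\<ge>no. norm ((\<Sum>k\<le>n. c k) - A (\<rho> n) - 0) < e"
      by (intro exI[of _ "max K M"]) simp
  qed
  moreover have "(\<lambda>n. A (\<rho> n)) \<longlonglongrightarrow> L"
  proof (rule filterlim_compose[OF L])
    have "\<rho> \<longlonglongrightarrow> 1 - 0" unfolding \<rho>_def
      by (intro tendsto_intros LIMSEQ_ignore_initial_segment[OF lim_1_over_n])
    then show "filterlim \<rho> (at_left 1) sequentially"
      using \<rho> less_imp_neq[OF \<rho>(2)] by (auto simp: filterlim_at intro!: always_eventually)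
  qed
  ultimately have "(\<lambda>n. ((\<Sum>k\<le>n. c k) - A (\<rho> n)) + A (\<rho> n)) \<longlonglongrightarrow> 0 + L" by (rule tendsto_add)
  then show ?thesis by (simp add: sums_def_le)
qed

section \<open>Carleson measures in dyadic form\<close>

definition dyadic_interval :: "nat \<Rightarrow> real set" where
  "dyadic_interval j = {1 - (1/2)^j ..< 1 - (1/2)^Suc j}"

lemma dyadic_interval_subset: "dyadic_interval j \<subseteq> {0..<1}"
  using half_powers(1)[of "Suc j"] half_powers(2)[of j] by (auto simp: dyadic_interval_def simp del: power_Suc)

lemma space_borel_01:
  assumes "borel_measure_01 \<mu>"
  shows "space \<mu> = {0..<1}"
  using sets_eq_imp_space_eq[OF assms[unfolded borel_measure_01_def]] by (simp add: space_restrict_space)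

lemma sets_borel_01:
  assumes "borel_measure_01 \<mu>" "A \<in> sets borel" "A \<subseteq> {0..<1}"
  shows "A \<in> sets \<mu>"
  using assms by (simp add: borel_measure_01_def sets_restrict_space_iff)

lemma measurable_borel_01:
  fixes f :: "real \<Rightarrow> 'b::topological_space"
  assumes "borel_measure_01 \<mu>" "continuous_on {0..<1} f"
  shows "f \<in> borel_measurable \<mu>"
  using borel_measurable_continuous_on_restrict[OF assms(2)] assms(1)
  by (simp add: borel_measure_01_def cong: measurable_cong_sets)

lemma integrable_power_01:
  assumes \<mu>: "borel_measure_01 \<mu>" and fin: "finite_measure \<mu>"
  shows "integrable \<mu> (\<lambda>t. c * t ^ n)"
proof -
  interpret finite_measure \<mu> by (rule fin)
  show ?thesis
  proof (rule integrable_const_bound[of _ "\<bar>c\<bar>"])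
    show "(\<lambda>t. c * t ^ n) \<in> borel_measurable \<mu>" by (intro measurable_borel_01[OF \<mu>] continuous_intros)
    show "AE t in \<mu>. norm (c * t ^ n) \<le> \<bar>c\<bar>"
      by (rule AE_I2) (auto simp: space_borel_01[OF \<mu>] abs_mult power_le_one mult_left_le)
  qed
qed

lemma nn_integral_le_dyadic_sum:
  assumes \<mu>: "borel_measure_01 \<mu>" and B: "\<And>j t. t \<in> dyadic_interval j \<Longrightarrow> \<phi> t \<le> B j"
  shows "(\<integral>\<^sup>+t. \<phi> t \<partial>\<mu>) \<le> (\<Sum>j. B j * emeasure \<mu> (dyadic_interval j))"
proof -
  have s: "dyadic_interval j \<in> sets \<mu>" for j
    by (rule sets_borel_01[OF \<mu> _ dyadic_interval_subset]) (simp add: dyadic_interval_def)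
  have "(\<integral>\<^sup>+t. \<phi> t \<partial>\<mu>) \<le> (\<integral>\<^sup>+t. (\<Sum>j. B j * indicator (dyadic_interval j) t) \<partial>\<mu>)"
  proof (rule nn_integral_mono)
    fix t assume "t \<in> space \<mu>"
    then have "0 \<le> t" "t < 1" by (auto simp: space_borel_01[OF \<mu>])
    then obtain i where i: "t \<in> dyadic_interval i"
      using dyadic_interval_exists[of t] by (auto simp: dyadic_interval_def)
    define g where "g j = B j * indicator (dyadic_interval j) t" for j
    have "\<phi> t \<le> sum g {i}" using i B by (simp add: g_def)
    also have "\<dots> \<le> (\<Sum>j. g j)" by (rule sum_le_suminf) auto
    also have "\<dots> = (\<Sum>j. B j * indicator (dyadic_interval j) t)" by (simp only: g_def)
    finally show "\<phi> t \<le> (\<Sum>j. B j * indicator (dyadic_interval j) t)" .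
  qed
  also have "\<dots> = (\<Sum>j. (\<integral>\<^sup>+t. B j * indicator (dyadic_interval j) t \<partial>\<mu>))"
    using s by (intro nn_integral_suminf) auto
  also have "\<dots> = (\<Sum>j. B j * emeasure \<mu> (dyadic_interval j))"
    using s by (simp add: nn_integral_cmult_indicator)
  finally show ?thesis .
qed

lemma log_carleson_finite:
  assumes \<mu>: "borel_measure_01 \<mu>" and c: "log_carleson a s \<mu>"
  shows "finite_measure \<mu>"
proof -
  obtain C where C: "\<And>t. t \<in> {0..<1} \<Longrightarrow> ennreal (ln (2 / (1 - t)) powr a) * emeasure \<mu> {t..<1} \<le> ennreal (C * (1 - t) powr s)"
    using c unfolding log_carleson_def by blast
  have "ennreal (ln 2 powr a) * emeasure \<mu> {0..<1} \<le> ennreal C" using C[of 0] by simp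
  moreover have "ennreal (ln 2 powr a) \<noteq> 0" by simp
  ultimately have "emeasure \<mu> {0..<1} < \<infinity>"
    by (metis ennreal_less_top ennreal_mult_eq_top_iff infinity_ennreal_def less_top linorder_not_le top.not_eq_extremum top_unique)
  then show ?thesis by (intro finite_measureI) (simp add: space_borel_01[OF \<mu>])
qed

text \<open>
  At the left end point \<open>t = 1 - (1/2) ^ j\<close> the logarithm \<open>ln (2 / (1 - t))\<close> is \<open>(j + 1) * ln 2\<close>.
\<close>

lemma log_carleson_dyadic:
  assumes \<mu>: "borel_measure_01 \<mu>" and c: "log_carleson a s \<mu>"
  shows "\<exists>C>0. \<forall>j. emeasure \<mu> (dyadic_interval j) \<le> ennreal (C * ((1/2)^j) powr s * real (Suc j) powr (-a))"
proof -
  obtain C where C: "0 < C" "\<And>t. t \<in> {0..<1} \<Longrightarrow> ennreal (ln (2 / (1 - t)) powr a) * emeasure \<mu> {t..<1} \<le> ennreal (C * (1 - t) powr s)"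
    using c by (auto simp: log_carleson_def)
  have "emeasure \<mu> (dyadic_interval j) \<le> ennreal (C * ln 2 powr (-a) * ((1/2)^j) powr s * real (Suc j) powr (-a))" for j
  proof -
    define h where "h = (1/2::real)^j"
    have h: "0 < h" "h \<le> 1" using half_powers[of j] by (auto simp: h_def)
    have l: "ln (2 / (1 - (1 - h))) = real (Suc j) * ln 2"
      by (simp add: h_def ln_div ln_realpow algebra_simps ln_mult)
    have l0: "0 < real (Suc j) * ln 2" by simp
    have "emeasure \<mu> (dyadic_interval j) \<le> emeasure \<mu> {1 - h..<1}"
      using dyadic_interval_subset[of j] h
      by (intro emeasure_mono sets_borel_01[OF \<mu>]) (auto simp: dyadic_interval_def h_def[symmetric])
    also have "\<dots> = ennreal ((real (Suc j) * ln 2) powr (-a)) * (ennreal ((real (Suc j) * ln 2) powr a) * emeasure \<mu> {1 - h..<1})"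
    proof -
      have "ennreal ((real (Suc j) * ln 2) powr (-a)) * ennreal ((real (Suc j) * ln 2) powr a) = ennreal 1"
        using l0 by (subst ennreal_mult[symmetric]) (auto simp: powr_add[symmetric])
      then show ?thesis by (simp add: mult.assoc[symmetric])
    qed
    also have "\<dots> \<le> ennreal ((real (Suc j) * ln 2) powr (-a)) * ennreal (C * h powr s)"
      using C(2)[of "1 - h"] h unfolding l by (intro mult_left_mono) auto
    also have "\<dots> = ennreal (C * ln 2 powr (-a) * h powr s * real (Suc j) powr (-a))"
      using C(1) by (simp add: ennreal_mult[symmetric] powr_mult mult_ac)
    finally show ?thesis unfolding h_def .
  qed
  then show ?thesis using C(1) by (intro exI[of _ "C * ln 2 powr (-a)"]) auto
qed

text \<open>
  For \<open>t < 1/2\<close> the condition follows from the finiteness of the measure, with a larger constant.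
\<close>

lemma log_carlesonI:
  assumes \<mu>: "borel_measure_01 \<mu>" and fin: "finite_measure \<mu>" and a: "0 \<le> a" and s: "0 \<le> s"
    and C: "0 \<le> C" "\<And>t. 1/2 \<le> t \<Longrightarrow> t < 1 \<Longrightarrow> ln (2 / (1 - t)) powr a * measure \<mu> {t..<1} \<le> C * (1 - t) powr s"
  shows "log_carleson a s \<mu>"
proof -
  interpret finite_measure \<mu> by (rule fin)
  define M where "M = ln 4 powr a * measure \<mu> (space \<mu>) * 2 powr s"
  have M: "0 \<le> M" by (simp add: M_def)
  have "ln (2 / (1 - t)) powr a * measure \<mu> {t..<1} \<le> (C + M + 1) * (1 - t) powr s" if t: "t \<in> {0..<1}" for t
  proof (cases "1/2 \<le> t")
    case True
    then have "ln (2 / (1 - t)) powr a * measure \<mu> {t..<1} \<le> C * (1 - t) powr s" using t C by auto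
    also have "\<dots> \<le> (C + M + 1) * (1 - t) powr s" using M by (intro mult_right_mono) auto
    finally show ?thesis .
  next
    case False
    have "ln (2 / (1 - t)) powr a * measure \<mu> {t..<1} \<le> ln 4 powr a * measure \<mu> (space \<mu>)"
    proof (intro mult_mono powr_mono2 a bounded_measure)
      have "2 / (1 - t) \<le> 4" using False t by (simp add: field_simps)
      then show "ln (2 / (1 - t)) \<le> ln 4" using t by (subst ln_le_cancel_iff) auto
      have "1 \<le> 2 / (1 - t)" using t by (simp add: field_simps)
      then show "0 \<le> ln (2 / (1 - t))" by simp
    qed auto
    also have "\<dots> = M * (1/2) powr s" by (simp add: M_def powr_divide)
    also have "\<dots> \<le> M * (1 - t) powr s" using False s M by (intro mult_left_mono powr_mono2) auto
    also have "\<dots> \<le> (C + M + 1) * (1 - t) powr s" using C by (intro mult_right_mono) auto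
    finally show ?thesis .
  qed
  then have "ennreal (ln (2 / (1 - t)) powr a) * emeasure \<mu> {t..<1} \<le> ennreal ((C + M + 1) * (1 - t) powr s)" if "t \<in> {0..<1}" for t
    using that by (simp add: emeasure_eq_measure ennreal_mult[symmetric] ennreal_leI)
  moreover have "0 < C + M + 1" using C M by simp
  ultimately show ?thesis unfolding log_carleson_def by blast
qed

section \<open>The integral form of the operator\<close>

text \<open>
  The Taylor coefficients of \<open>(1 - w) powr (-\<alpha>)\<close>.
\<close>

definition binom_coeff :: "real \<Rightarrow> nat \<Rightarrow> real" where
  "binom_coeff \<alpha> n = Gamma (real n + \<alpha>) / (fact n * Gamma \<alpha>)"

lemma binom_coeff_pos: "0 < \<alpha> \<Longrightarrow> 0 < binom_coeff \<alpha> n"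
  unfolding binom_coeff_def by (intro divide_pos_pos mult_pos_pos Gamma_real_pos) auto

lemma binom_coeff_Suc:
  assumes "0 < \<alpha>"
  shows "real (Suc n) * binom_coeff \<alpha> (Suc n) = \<alpha> * binom_coeff (\<alpha> + 1) n"
proof -
  have "Gamma (\<alpha> + 1) = \<alpha> * Gamma \<alpha>" using assms by (intro Gamma_plus1) (auto simp: nonpos_Ints_def)
  moreover have "Gamma \<alpha> \<noteq> 0" using Gamma_real_pos[OF assms] by simp
  moreover have "Gamma (real (Suc n) + \<alpha>) = Gamma (real n + (\<alpha> + 1))" by (rule arg_cong[of _ _ Gamma]) simp
  ultimately show ?thesis using assms
    unfolding binom_coeff_def fact_Suc by (simp add: divide_simps del: of_nat_Suc)
qed

lemma binom_coeff_sums: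
  fixes w :: complex
  assumes \<alpha>: "0 < \<alpha>" and w: "norm w < 1"
  shows "(\<lambda>n. of_real (binom_coeff \<alpha> n) * w ^ n) sums (1 - w) powr (- of_real \<alpha>)"
proof -
  have "(\<lambda>n. ((- of_real \<alpha>) gchoose n) * (- w) ^ n) sums (1 + (- w)) powr (- of_real \<alpha>)"
    by (rule gen_binomial_complex) (use w in simp)
  moreover have "((- of_real \<alpha>) gchoose n) * (- w) ^ n = of_real (binom_coeff \<alpha> n) * w ^ n" for n
  proof -
    have "pochhammer \<alpha> n = Gamma (\<alpha> + real n) / Gamma \<alpha>"
      by (rule pochhammer_Gamma) (use \<alpha> in \<open>auto elim!: nonpos_Ints_cases\<close>)
    then have "of_real (binom_coeff \<alpha> n) = pochhammer (of_real \<alpha> :: complex) n / fact n"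
      unfolding binom_coeff_def pochhammer_of_real by (simp add: add.commute)
    moreover have "(- w) ^ n = (-1) ^ n * w ^ n" by (rule power_minus)
    ultimately show ?thesis
      by (simp add: gbinomial_pochhammer flip: power_mult_distrib)
  qed
  ultimately show ?thesis by simp
qed

lemma one_minus_real_mult_nonzero:
  assumes "0 \<le> t" "t \<le> 1" "norm (z::complex) < 1"
  shows "1 - of_real t * z \<noteq> 0" "1 - norm z \<le> norm (1 - of_real t * z)" "1 - t \<le> norm (1 - of_real t * z)"
proof -
  have "norm (of_real t * z) \<le> norm z" "norm (of_real t * z) \<le> t"
    using assms mult_right_mono[of t 1 "norm z"] mult_left_mono[of "norm z" 1 t] by (auto simp: norm_mult)
  moreover have "1 - norm (of_real t * z) \<le> norm (1 - of_real t * z)"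
    using norm_triangle_ineq2[of 1 "of_real t * z"] by simp
  ultimately show 2: "1 - norm z \<le> norm (1 - of_real t * z)" "1 - t \<le> norm (1 - of_real t * z)" by linarith+
  show "1 - of_real t * z \<noteq> 0" using 2(1) assms(3) by auto
qed

lemma norm_powr_minus_real:
  assumes "(w::complex) \<noteq> 0"
  shows "norm (w powr (- of_real \<alpha>)) = norm w powr (- \<alpha>)"
  using assms norm_powr_real_powr'[of "- of_real \<alpha>" w] by simp

text \<open>
  For fixed \<open>z\<close> the binomial series of \<open>(1 - t * z) powr (-\<alpha>)\<close> is dominated, uniformly in \<open>t\<close>, by its
  value at \<open>t = 1\<close> with \<open>z\<close> replaced by \<open>norm z\<close>; hence it may be integrated term by term.
\<close>

lemma kernel_series_integral:
  fixes \<phi> :: "real \<Rightarrow> complex"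
  assumes \<mu>: "borel_measure_01 \<mu>" and \<phi>: "integrable \<mu> \<phi>" and \<alpha>: "0 < \<alpha>" and z: "norm z < 1"
  shows "(\<lambda>n. of_real (binom_coeff \<alpha> n) * (LINT t|\<mu>. of_real (t ^ n) * \<phi> t) * z ^ n)
     sums (LINT t|\<mu>. \<phi> t * (1 - of_real t * z) powr (- of_real \<alpha>))"
    and "integrable \<mu> (\<lambda>t. of_real (t ^ n) * \<phi> t)"
proof -
  have pow: "(\<lambda>t. complex_of_real (t ^ n)) \<in> borel_measurable \<mu>" for n
    by (intro measurable_borel_01[OF \<mu>] continuous_intros)
  have int: "integrable \<mu> (\<lambda>t. of_real (t ^ n) * \<phi> t)" for n
  proof (rule Bochner_Integration.integrable_bound[OF \<phi>])
    show "(\<lambda>t. of_real (t ^ n) * \<phi> t) \<in> borel_measurable \<mu>"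
      using pow \<phi> by (intro borel_measurable_times) auto
    show "AE t in \<mu>. norm (of_real (t ^ n) * \<phi> t) \<le> norm (\<phi> t)"
      by (rule AE_I2) (auto simp: norm_mult space_borel_01[OF \<mu>] norm_power power_le_one mult_left_le_one_le)
  qed
  then show "integrable \<mu> (\<lambda>t. of_real (t ^ n) * \<phi> t)" .
  define u where "u n t = of_real (binom_coeff \<alpha> n) * (of_real (t ^ n) * \<phi> t) * z ^ n" for n t
  have u: "integrable \<mu> (u n)" for n unfolding u_def using int[of n] by (intro integrable_mult_left integrable_mult_right)
  have sumc: "summable (\<lambda>n. binom_coeff \<alpha> n * norm z ^ n)"
  proof -
    have "summable (\<lambda>n. complex_of_real (binom_coeff \<alpha> n * norm z ^ n))"
      using binom_coeff_sums[OF \<alpha>, of "of_real (norm z)"] z by (auto simp: sums_iff)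
    then show ?thesis by (simp only: summable_complex_of_real)
  qed
  have bound: "norm (u n t) \<le> (binom_coeff \<alpha> n * norm z ^ n) * norm (\<phi> t)" if "t \<in> space \<mu>" for n t
  proof -
    have "t ^ n \<le> 1" "0 \<le> t ^ n" using that by (auto simp: space_borel_01[OF \<mu>] power_le_one)
    then have "norm (of_real (t ^ n) * \<phi> t) \<le> norm (\<phi> t)"
      by (simp add: norm_mult mult_left_le_one_le del: of_real_power)
    then have "(binom_coeff \<alpha> n * norm z ^ n) * norm (of_real (t ^ n) * \<phi> t) \<le> (binom_coeff \<alpha> n * norm z ^ n) * norm (\<phi> t)"
      using binom_coeff_pos[OF \<alpha>, of n] by (intro mult_left_mono) auto
    moreover have "norm (u n t) = (binom_coeff \<alpha> n * norm z ^ n) * norm (of_real (t ^ n) * \<phi> t)"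
      using binom_coeff_pos[OF \<alpha>, of n] by (simp add: u_def norm_mult norm_power)
    ultimately show ?thesis by simp
  qed
  have "(\<lambda>n. LINT t|\<mu>. u n t) sums (LINT t|\<mu>. (\<Sum>n. u n t))"
  proof (rule sums_integral[OF u])
    show "AE t in \<mu>. summable (\<lambda>n. norm (u n t))"
      by (rule AE_I2, rule summable_comparison_test'[OF summable_mult2[OF sumc]], simp, rule bound)
    show "summable (\<lambda>n. LINT t|\<mu>. norm (u n t))"
    proof (rule summable_comparison_test'[OF summable_mult2[OF sumc], of _ _ "LINT t|\<mu>. norm (\<phi> t)"])
      fix n :: nat
      have "(LINT t|\<mu>. norm (u n t)) \<le> (LINT t|\<mu>. (binom_coeff \<alpha> n * norm z ^ n) * norm (\<phi> t))"
        using u \<phi> bound by (intro integral_mono) auto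
      also have "\<dots> = (binom_coeff \<alpha> n * norm z ^ n) * (LINT t|\<mu>. norm (\<phi> t))" by simp
      finally show "norm (LINT t|\<mu>. norm (u n t)) \<le> (binom_coeff \<alpha> n * norm z ^ n) * (LINT t|\<mu>. norm (\<phi> t))"
        by simp
    qed
  qed
  also have "(LINT t|\<mu>. (\<Sum>n. u n t)) = (LINT t|\<mu>. \<phi> t * (1 - of_real t * z) powr (- of_real \<alpha>))"
  proof (rule Bochner_Integration.integral_cong[OF refl])
    fix t assume "t \<in> space \<mu>"
    then have "norm (of_real t * z) < 1"
      using z mult_right_mono[of t 1 "norm z"] by (auto simp: norm_mult space_borel_01[OF \<mu>])
    from sums_mult[OF binom_coeff_sums[OF \<alpha> this], of "\<phi> t"]
    have "(\<lambda>n. u n t) sums (\<phi> t * (1 - of_real t * z) powr (- of_real \<alpha>))"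
      by (simp add: u_def power_mult_distrib mult_ac)
    then show "(\<Sum>n. u n t) = \<phi> t * (1 - of_real t * z) powr (- of_real \<alpha>)" by (simp add: sums_iff)
  qed
  also have "(\<lambda>n. LINT t|\<mu>. u n t) = (\<lambda>n. of_real (binom_coeff \<alpha> n) * (LINT t|\<mu>. of_real (t ^ n) * \<phi> t) * z ^ n)"
    unfolding u_def by (simp del: of_real_power)
  finally show "(\<lambda>n. of_real (binom_coeff \<alpha> n) * (LINT t|\<mu>. of_real (t ^ n) * \<phi> t) * z ^ n)
     sums (LINT t|\<mu>. \<phi> t * (1 - of_real t * z) powr (- of_real \<alpha>))" .
qed

text \<open>
  The series that define the coefficients of the image of \<open>f\<close> converge to the moments of the complex
  measure with density \<open>f\<close> with respect to \<open>\<mu>\<close>.  Once this is known, the operator is an integral, and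
  the Taylor series of \<open>f\<close> no longer appears.
\<close>

definition moment_expansion :: "real measure \<Rightarrow> (complex \<Rightarrow> complex) \<Rightarrow> bool" where
  "moment_expansion \<mu> f \<longleftrightarrow> integrable \<mu> (\<lambda>t. f (of_real t)) \<and>
     (\<forall>n. (\<lambda>k. of_real (LINT t|\<mu>. t ^ (n + k)) * taylor_coeff f k) sums (LINT t|\<mu>. of_real (t ^ n) * f (of_real t)))"

lemma hilbert_coeff_eq:
  assumes m: "moment_expansion \<mu> f"
  shows "hilbert_coeff \<mu> \<alpha> f n = of_real (binom_coeff \<alpha> n) * (LINT t|\<mu>. of_real (t ^ n) * f (of_real t))"
    and "summable (\<lambda>k. of_real (hilbert_entry \<mu> \<alpha> n k) * taylor_coeff f k)"
proof -
  have e: "of_real (hilbert_entry \<mu> \<alpha> n k) * taylor_coeff f k =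
     of_real (binom_coeff \<alpha> n) * (of_real (LINT t|\<mu>. t ^ (n + k)) * taylor_coeff f k)" for k
    by (simp add: hilbert_entry_def binom_coeff_def)
  have "(\<lambda>k. of_real (hilbert_entry \<mu> \<alpha> n k) * taylor_coeff f k) sums
     (of_real (binom_coeff \<alpha> n) * (LINT t|\<mu>. of_real (t ^ n) * f (of_real t)))"
    unfolding e using m by (intro sums_mult) (auto simp: moment_expansion_def)
  then show "hilbert_coeff \<mu> \<alpha> f n = of_real (binom_coeff \<alpha> n) * (LINT t|\<mu>. of_real (t ^ n) * f (of_real t))"
    "summable (\<lambda>k. of_real (hilbert_entry \<mu> \<alpha> n k) * taylor_coeff f k)"
    by (auto simp: hilbert_coeff_def sums_iff)
qed

text \<open>
  The formula for the derivative comes from differentiating the power series term by term, by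
  \<open>(n + 1) * binom_coeff \<alpha> (n + 1) = \<alpha> * binom_coeff (\<alpha> + 1) n\<close>.
\<close>

lemma hilbert_op_integral:
  assumes \<mu>: "borel_measure_01 \<mu>" and fin: "finite_measure \<mu>" and \<alpha>: "0 < \<alpha>"
    and m: "moment_expansion \<mu> f"
  shows "hilbert_op_defined \<mu> \<alpha> f"
    and "norm z < 1 \<Longrightarrow> (\<lambda>n. hilbert_coeff \<mu> \<alpha> f n * z ^ n) sums hilbert_op \<mu> \<alpha> f z"
    and "norm z < 1 \<Longrightarrow> hilbert_op \<mu> \<alpha> f z = (LINT t|\<mu>. f (of_real t) * (1 - of_real t * z) powr (- of_real \<alpha>))"
    and "norm z < 1 \<Longrightarrow> deriv (hilbert_op \<mu> \<alpha> f) z =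
       of_real \<alpha> * (LINT t|\<mu>. of_real t * f (of_real t) * (1 - of_real t * z) powr (- of_real (\<alpha> + 1)))"
proof -
  interpret finite_measure \<mu> by (rule fin)
  have int: "integrable \<mu> (\<lambda>t. f (of_real t))" using m by (simp add: moment_expansion_def)
  note K = kernel_series_integral[OF \<mu> int]
  have sums1: "(\<lambda>n. hilbert_coeff \<mu> \<alpha> f n * z ^ n) sums (LINT t|\<mu>. f (of_real t) * (1 - of_real t * z) powr (- of_real \<alpha>))"
    if "norm z < 1" for z
    unfolding hilbert_coeff_eq(1)[OF m] using K(1)[OF \<alpha> that] .
  show sums2: "(\<lambda>n. hilbert_coeff \<mu> \<alpha> f n * z ^ n) sums hilbert_op \<mu> \<alpha> f z" if "norm z < 1" for z
    unfolding hilbert_op_def by (intro summable_sums sums_summable[OF sums1[OF that]])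
  show "norm z < 1 \<Longrightarrow> hilbert_op \<mu> \<alpha> f z = (LINT t|\<mu>. f (of_real t) * (1 - of_real t * z) powr (- of_real \<alpha>))"
    using sums1[of z] sums2[of z] sums_unique2 by blast
  have hol: "hilbert_op \<mu> \<alpha> f holomorphic_on ball 0 1"
    by (rule power_series_holomorphic[where a="hilbert_coeff \<mu> \<alpha> f"]) (use sums2 in auto)
  show "hilbert_op_defined \<mu> \<alpha> f"
    unfolding hilbert_op_defined_def using integrable_power_01[OF \<mu> fin] hilbert_coeff_eq(2)[OF m] sums2 hol
    by (auto simp: sums_iff)
  show "deriv (hilbert_op \<mu> \<alpha> f) z =
       of_real \<alpha> * (LINT t|\<mu>. of_real t * f (of_real t) * (1 - of_real t * z) powr (- of_real (\<alpha> + 1)))"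
    if z: "norm z < 1"
  proof -
    obtain R where R: "norm z < R" "R < 1" using z dense by blast
    have "((\<lambda>z. \<Sum>n. hilbert_coeff \<mu> \<alpha> f n * z ^ n) has_field_derivative (\<Sum>n. diffs (hilbert_coeff \<mu> \<alpha> f) n * z ^ n)) (at z)"
    proof (rule termdiffs_strong[where K="of_real R"])
      show "summable (\<lambda>n. hilbert_coeff \<mu> \<alpha> f n * of_real R ^ n)"
        using sums2[of "of_real R"] R norm_ge_zero[of z] by (auto simp: sums_iff simp del: norm_ge_zero)
    qed (use R norm_ge_zero[of z] in \<open>auto simp del: norm_ge_zero\<close>)
    then have d: "deriv (hilbert_op \<mu> \<alpha> f) z = (\<Sum>n. diffs (hilbert_coeff \<mu> \<alpha> f) n * z ^ n)"
      unfolding hilbert_op_def[abs_def] by (rule DERIV_imp_deriv)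
    have "integrable \<mu> (\<lambda>t. of_real t * f (of_real t))" using K(2)[of \<alpha> 0 1] \<alpha> by simp
    from sums_mult[OF kernel_series_integral(1)[OF \<mu> this _ z, of "\<alpha> + 1"], of "of_real \<alpha>"] \<alpha>
    have "(\<lambda>n. of_real \<alpha> * (of_real (binom_coeff (\<alpha> + 1) n) * (LINT t|\<mu>. of_real (t ^ n) * (of_real t * f (of_real t))) * z ^ n))
       sums (of_real \<alpha> * (LINT t|\<mu>. of_real t * f (of_real t) * (1 - of_real t * z) powr (- of_real (\<alpha> + 1))))"
      by simp
    moreover have "of_real \<alpha> * (of_real (binom_coeff (\<alpha> + 1) n) * (LINT t|\<mu>. of_real (t ^ n) * (of_real t * f (of_real t))) * z ^ n)
       = diffs (hilbert_coeff \<mu> \<alpha> f) n * z ^ n" for n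
    proof -
      have "of_real \<alpha> * of_real (binom_coeff (\<alpha> + 1) n) = (of_nat (Suc n) * of_real (binom_coeff \<alpha> (Suc n)) :: complex)"
        unfolding of_real_mult[symmetric] binom_coeff_Suc[OF \<alpha>, symmetric] by simp
      moreover have "(LINT t|\<mu>. of_real (t ^ n) * (of_real t * f (of_real t))) = (LINT t|\<mu>. of_real (t ^ Suc n) * f (of_real t))"
        by (simp add: mult_ac)
      ultimately show ?thesis unfolding diffs_def hilbert_coeff_eq(1)[OF m] by (simp only: mult.assoc[symmetric])
    qed
    ultimately have "(\<lambda>n. diffs (hilbert_coeff \<mu> \<alpha> f) n * z ^ n) sums
       (of_real \<alpha> * (LINT t|\<mu>. of_real t * f (of_real t) * (1 - of_real t * z) powr (- of_real (\<alpha> + 1))))"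
      by (simp only:)
    then show ?thesis unfolding d by (rule sums_unique[symmetric])
  qed
qed

section \<open>Convergence of the coefficient series on Hardy spaces\<close>

lemma taylor_coeff_circle_bound:
  assumes f: "f holomorphic_on ball 0 1" and r: "0 < r" "r < 1"
  shows "norm (taylor_coeff f k) * r ^ k \<le> 1 / (2*pi) * integral {0..2*pi} (\<lambda>\<theta>. norm (f (of_real r * cis \<theta>)))"
proof -
  have "((\<lambda>u. f u / (u - 0) ^ Suc k) has_contour_integral ((2 * pi * \<i>) / (fact k) * (deriv ^^ k) f 0)) (circlepath 0 r)"
  proof (rule Cauchy_has_contour_integral_higher_derivative_circlepath)
    show "continuous_on (cball 0 r) f"
      using f r by (intro holomorphic_on_imp_continuous_on holomorphic_on_subset[OF f]) auto
    show "f holomorphic_on ball 0 r" using r by (intro holomorphic_on_subset[OF f]) auto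
  qed (use r in auto)
  then have 1: "((\<lambda>t. f (of_real r * cis t) / (of_real r * cis t) ^ Suc k * of_real r * \<i> * cis t) has_integral
      ((2 * pi * \<i>) / (fact k) * (deriv ^^ k) f 0)) {0..2*pi}"
    unfolding circlepath_def by (subst (asm) has_contour_integral_part_circlepath_iff) auto
  have c: "continuous_on {0..2*pi} (\<lambda>\<theta>. norm (f (of_real r * cis \<theta>)))"
    using continuous_on_circle_powr[OF f, of 1 r "{0..2*pi}"] r by simp
  have "2 * pi * norm (taylor_coeff f k) = norm (integral {0..2*pi} (\<lambda>t. f (of_real r * cis t) / (of_real r * cis t) ^ Suc k * of_real r * \<i> * cis t))"
    using integral_unique[OF 1] by (simp add: taylor_coeff_def norm_mult norm_divide)
  also have "\<dots> \<le> integral {0..2*pi} (\<lambda>\<theta>. norm (f (of_real r * cis \<theta>)) * (1 / r ^ k))"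
  proof (rule integral_norm_bound_integral)
    show "(\<lambda>t. f (of_real r * cis t) / (of_real r * cis t) ^ Suc k * of_real r * \<i> * cis t) integrable_on {0..2*pi}"
      using 1 by blast
    show "(\<lambda>\<theta>. norm (f (of_real r * cis \<theta>)) * (1 / r ^ k)) integrable_on {0..2*pi}"
      by (intro integrable_continuous_real continuous_on_mult c continuous_on_const)
    show "norm (f (of_real r * cis t) / (of_real r * cis t) ^ Suc k * of_real r * \<i> * cis t)
       \<le> norm (f (of_real r * cis t)) * (1 / r ^ k)" for t
      using r by (simp add: norm_mult norm_divide norm_power)
  qed
  also have "\<dots> = integral {0..2*pi} (\<lambda>\<theta>. norm (f (of_real r * cis \<theta>))) / r ^ k" by simp
  finally show ?thesis using r by (simp add: field_simps)
qed

text \<open>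
  For \<open>p \<le> 1\<close>, growth controls the second factor of
  \<open>norm f = norm f powr p * norm f powr (1 - p)\<close>; for \<open>p > 1\<close>, \<open>norm f \<le> 1 + norm f powr p\<close>.  The
  maxima unite both cases.
\<close>

lemma hardy_L1_circle_bound:
  assumes f: "f \<in> hardy_space p" and p: "0 < p" and r: "0 < r" "r < 1"
  shows "integral {0..2*pi} (\<lambda>\<theta>. norm (f (of_real r * cis \<theta>)))
    \<le> (4 / (1 - r)) powr (max (1 / p) 1 - 1) * (2 * pi * (1 + hardy_norm p f + hardy_norm p f powr p))"
proof -
  define N where "N = hardy_norm p f"
  have N: "0 \<le> N" unfolding N_def by (rule hardy_norm_nonneg[OF f])
  have hol: "f holomorphic_on ball 0 1" using f by (simp add: hardy_space_def)
  let ?g = "\<lambda>\<theta>. norm (f (of_real r * cis \<theta>))"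
  have c: "continuous_on {0..2*pi} ?g" "continuous_on {0..2*pi} (\<lambda>\<theta>. ?g \<theta> powr p)"
    using continuous_on_circle_powr[OF hol, of 1 r "{0..2*pi}"] continuous_on_circle_powr[OF hol p, of r "{0..2*pi}"] r by auto
  have I: "integral {0..2*pi} (\<lambda>\<theta>. ?g \<theta> powr p) \<le> 2 * pi * N powr p"
    unfolding N_def by (rule hardy_integral_le[OF f p r])
  show ?thesis
  proof (cases "1 < p")
    case True
    have "integral {0..2*pi} ?g \<le> integral {0..2*pi} (\<lambda>\<theta>. 1 + ?g \<theta> powr p)"
    proof (rule integral_le)
      show "?g \<theta> \<le> 1 + ?g \<theta> powr p" for \<theta>
      proof (cases "?g \<theta> \<le> 1")
        case False
        then have "?g \<theta> powr 1 \<le> ?g \<theta> powr p" using True by (intro powr_mono) auto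
        then show ?thesis by simp
      qed (simp add: add_increasing2)
    qed (intro integrable_continuous_real continuous_intros c)+
    also have "\<dots> = 2 * pi + integral {0..2*pi} (\<lambda>\<theta>. ?g \<theta> powr p)"
      by (subst integral_add) (auto intro!: integrable_continuous_real c)
    also have "\<dots> \<le> 2 * pi * (1 + N + N powr p)" using I mult_nonneg_nonneg[OF N pi_ge_zero] by (simp add: algebra_simps)
    also have "max (1 / p) 1 = 1" using True by (simp add: field_simps)
    then have "2 * pi * (1 + N + N powr p) = (4 / (1 - r)) powr (max (1 / p) 1 - 1) * (2 * pi * (1 + N + N powr p))"
      using r by simp
    finally show ?thesis unfolding N_def .
  next
    case False
    define G where "G = (4 / (1 - r)) powr (1 / p)"
    have "integral {0..2*pi} ?g \<le> integral {0..2*pi} (\<lambda>\<theta>. (G * N) powr (1 - p) * ?g \<theta> powr p)"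
    proof (rule integral_le)
      fix \<theta>
      have "?g \<theta> \<le> G * N"
        using hardy_growth[OF f p, of "of_real r * cis \<theta>"] r by (simp add: norm_mult G_def N_def)
      then have "?g \<theta> powr (1 - p) \<le> (G * N) powr (1 - p)" using False by (intro powr_mono2) auto
      then have "?g \<theta> powr (1 - p) * ?g \<theta> powr p \<le> (G * N) powr (1 - p) * ?g \<theta> powr p" by (intro mult_right_mono) auto
      then show "?g \<theta> \<le> (G * N) powr (1 - p) * ?g \<theta> powr p" by (simp flip: powr_add)
    qed (intro integrable_continuous_real continuous_on_mult continuous_on_const c)+
    also have "\<dots> = (G * N) powr (1 - p) * integral {0..2*pi} (\<lambda>\<theta>. ?g \<theta> powr p)" by simp
    also have "\<dots> \<le> (G * N) powr (1 - p) * (2 * pi * N powr p)" by (intro mult_left_mono I) auto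
    also have "\<dots> = G powr (1 - p) * (2 * pi * (N powr (1 - p) * N powr p))"
      using N by (simp add: G_def powr_mult)
    also have "N powr (1 - p) * N powr p = N" using N by (simp flip: powr_add)
    also have "G powr (1 - p) = (4 / (1 - r)) powr (1 / p * (1 - p))" unfolding G_def by (rule powr_powr)
    also have "1 / p * (1 - p) = max (1 / p) 1 - 1" using False p by (simp add: field_simps max_def)
    also have "(4 / (1 - r)) powr (max (1 / p) 1 - 1) * (2 * pi * N) \<le> (4 / (1 - r)) powr (max (1 / p) 1 - 1) * (2 * pi * (1 + N + N powr p))"
      by (intro mult_left_mono) auto
    finally show ?thesis unfolding N_def .
  qed
qed

text \<open>
  Cauchy's estimate on the circle of radius \<open>r = 1 - 1 / (k + 2)\<close>, where \<open>r ^ k\<close> is at least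
  \<open>exp (-1)\<close>.
\<close>

lemma hardy_coeff_bound:
  assumes f: "f \<in> hardy_space p" and p: "0 < p"
  shows "\<exists>C\<ge>0. \<forall>k. norm (taylor_coeff f k) \<le> C * real (Suc k) powr (max (1 / p) 1 - 1)"
proof -
  define K where "K = 1 + hardy_norm p f + hardy_norm p f powr p"
  have K: "0 \<le> K" using hardy_norm_nonneg[OF f] by (simp add: K_def)
  define b where "b = max (1 / p) 1 - 1"
  have b: "0 \<le> b" by (simp add: b_def)
  have hol: "f holomorphic_on ball 0 1" using f by (simp add: hardy_space_def)
  have "norm (taylor_coeff f k) \<le> (exp 1 * 8 powr b * K) * real (Suc k) powr b" for k
  proof -
    define r where "r = 1 - 1 / real (k + 2)"
    have r: "0 < r" "r < 1" by (auto simp: r_def field_simps)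
    have "exp (-1) \<le> r ^ k"
    proof -
      have "1 / r = 1 + 1 / real (k + 1)" by (simp add: r_def field_simps)
      also have "\<dots> \<le> exp (1 / real (k + 1))" by (rule exp_ge_add_one_self)
      finally have "(1 / r) ^ k \<le> exp (1 / real (k + 1)) ^ k" using r by (intro power_mono) auto
      also have "\<dots> = exp (real k * (1 / real (k + 1)))" by (rule exp_of_nat_mult[symmetric])
      also have "\<dots> \<le> exp 1" by simp
      finally show ?thesis using r by (simp add: exp_minus field_simps power_one_over)
    qed
    then have "norm (taylor_coeff f k) * exp (-1) \<le> norm (taylor_coeff f k) * r ^ k" by (intro mult_left_mono) auto
    also have "\<dots> \<le> 1 / (2*pi) * ((4 / (1 - r)) powr b * (2 * pi * K))"
      using order_trans[OF taylor_coeff_circle_bound[OF hol r] mult_left_mono[OF hardy_L1_circle_bound[OF f p r]]]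
      unfolding K_def b_def by simp
    also have "\<dots> = (4 * real (k + 2)) powr b * K" by (simp add: r_def)
    also have "\<dots> \<le> (8 * real (Suc k)) powr b * K" using b K by (intro mult_right_mono powr_mono2) auto
    also have "\<dots> = 8 powr b * real (Suc k) powr b * K" by (subst powr_mult) auto
    finally have "norm (taylor_coeff f k) \<le> exp 1 * (8 powr b * real (Suc k) powr b * K)"
      by (simp add: exp_minus field_simps)
    then show ?thesis by (simp add: mult_ac)
  qed
  moreover have "0 \<le> exp 1 * 8 powr b * K" using K by simp
  ultimately show ?thesis unfolding b_def by blast
qed

lemma exp_minus_le_powr:
  fixes y s :: real
  assumes "0 < y" "0 < s"
  shows "exp (- y) \<le> (s / y) powr s"
proof -
  have "y / s \<le> exp (y / s)" using exp_ge_add_one_self[of "y / s"] by linarith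
  then have "(y / s) powr s \<le> exp (y / s) powr s" using assms by (intro powr_mono2) auto
  also have "\<dots> = exp y" using assms by (simp add: powr_def)
  finally have "inverse (exp y) \<le> inverse ((y / s) powr s)" using assms by (intro le_imp_inverse_le) auto
  also have "inverse ((y / s) powr s) = (s / y) powr s"
    using assms by (simp add: powr_divide divide_simps)
  finally show ?thesis by (simp add: exp_minus)
qed

text \<open>
  With \<open>x = (k + 1) * (1/2) ^ j\<close>, the \<open>j\<close>-th dyadic interval contributes at most a multiple of
  \<open>\<epsilon> j * x powr s * exp (-x/2)\<close>, which is \<open>\<epsilon> j\<close> times a term of a two-sided geometric sum.  Each
  fixed \<open>j\<close> contributes nothing in the limit, and the large \<open>j\<close> contribute little as \<open>\<epsilon>\<close> is small
  there.
\<close>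

lemma moments_little_o:
  assumes \<mu>: "borel_measure_01 \<mu>" and fin: "finite_measure \<mu>" and s: "0 < s"
    and \<epsilon>: "\<epsilon> \<longlonglongrightarrow> 0" "\<And>j. 0 \<le> \<epsilon> j" and b: "\<And>j. emeasure \<mu> (dyadic_interval j) \<le> ennreal (\<epsilon> j * ((1/2)^j) powr s)"
  shows "(\<lambda>k. real (Suc k) powr s * (LINT t|\<mu>. t ^ k)) \<longlonglongrightarrow> 0"
proof -
  interpret finite_measure \<mu> by (rule fin)
  obtain C where C: "0 < C" "\<And>x J. 0 < (x::real) \<Longrightarrow> (\<Sum>j<J. min ((x * (1/2)^j) powr s) ((x * (1/2)^j) powr (-s))) \<le> C"
    using two_sided_geometric_sum[OF s s] by auto
  define m where "m k j = min ((real (Suc k) * (1/2)^j) powr s) ((real (Suc k) * (1/2)^j) powr (-s))" for k j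
  have m0: "0 \<le> m k j" for k j by (simp add: m_def)
  have m_tendsto: "(\<lambda>k. m k j) \<longlonglongrightarrow> 0" for j
  proof (rule tendsto_sandwich[of "\<lambda>_. 0"])
    show "(\<lambda>k. (real (Suc k) * (1/2)^j) powr (-s)) \<longlonglongrightarrow> 0"
    proof -
      have "(\<lambda>k. real (Suc k) powr (-s) * ((1/2)^j) powr (-s)) \<longlonglongrightarrow> 0 * ((1/2)^j) powr (-s)"
        using s by (intro tendsto_mult tendsto_const LIMSEQ_Suc tendsto_neg_powr filterlim_real_sequentially) auto
      then show ?thesis by (simp add: powr_mult del: of_nat_Suc)
    qed
  qed (auto simp: m_def)
  define D where "D = exp 1 * (4 * s) powr (2 * s) + exp 1"
  have D: "0 < D" by (simp add: D_def add_nonneg_pos)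
  (* For x <= 1 the k-th power is at most 1; for x > 1 the exponential decay in x beats the power
     x powr (2 * s). *)
  have key: "real (Suc k) powr s * (1 - (1/2)^Suc j) ^ k * ((1/2)^j) powr s \<le> D * m k j" for k j
  proof -
    define x where "x = real (Suc k) * (1/2)^j"
    have x: "0 < x" by (simp add: x_def)
    have mx: "m k j = min (x powr s) (x powr (-s))" unfolding m_def x_def ..
    have h: "(1/2::real)^j \<le> 1" by (simp add: power_le_one)
    have "(1 - (1/2)^Suc j) ^ k \<le> exp (- ((1/2::real)^Suc j)) ^ k"
      using exp_ge_add_one_self[of "- ((1/2::real)^Suc j)"] half_powers(2)[of "Suc j"] by (intro power_mono) auto
    also have "\<dots> = exp (- (real k * (1/2)^Suc j))" by (simp add: exp_of_nat_mult[symmetric])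
    also have "\<dots> \<le> exp (1 - x / 2)" using h unfolding x_def by (simp add: algebra_simps)
    also have "\<dots> = exp 1 * exp (- (x / 2))" unfolding exp_add[symmetric] by simp
    finally have 1: "(1 - (1/2::real)^Suc j) ^ k \<le> exp 1 * exp (- (x / 2))" .
    have "exp (- (x / 2)) \<le> (2 * s / (x / 2)) powr (2 * s)" using x s by (intro exp_minus_le_powr) auto
    also have "\<dots> = (4 * s) powr (2 * s) * x powr (- (2 * s))" using x s by (simp add: powr_divide powr_minus divide_simps)
    finally have 2: "exp 1 * exp (- (x / 2)) \<le> exp 1 * ((4 * s) powr (2 * s) * x powr (- (2 * s)))" by simp
    have "real (Suc k) powr s * (1 - (1/2)^Suc j) ^ k * ((1/2)^j) powr s = x powr s * (1 - (1/2)^Suc j) ^ k"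
      unfolding x_def by (subst powr_mult) (auto simp: mult_ac)
    also have "\<dots> \<le> D * m k j"
    proof (cases "x \<le> 1")
      case True
      have "(1 - (1/2)^Suc j) ^ k \<le> (1::real)"
        using half_powers(1,2)[of "Suc j"] by (intro power_le_one) auto
      then have "x powr s * (1 - (1/2)^Suc j) ^ k \<le> x powr s * 1" by (intro mult_left_mono) auto
      also have "\<dots> = m k j"
      proof -
        have "x powr s \<le> x powr (-s)" using x True s by (intro powr_mono') auto
        then show ?thesis by (simp add: mx min_def)
      qed
      also have "\<dots> \<le> D * m k j"
      proof -
        have "1 \<le> exp (1::real)" by simp
        then have "1 \<le> D" unfolding D_def by (smt (verit) exp_gt_zero mult_nonneg_nonneg powr_ge_zero)
        then show ?thesis using m0[of k j] mult_right_mono[of 1 D "m k j"] by simp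
      qed
      finally show ?thesis .
    next
      case False
      have "x powr s * (1 - (1/2)^Suc j) ^ k \<le> x powr s * (exp 1 * ((4 * s) powr (2 * s) * x powr (- (2 * s))))"
        by (intro mult_left_mono order_trans[OF 1 2]) auto
      also have "\<dots> = exp 1 * (4 * s) powr (2 * s) * (x powr s * x powr (- (2 * s)))" by (simp only: mult_ac)
      also have "x powr s * x powr (- (2 * s)) = x powr (-s)" by (simp flip: powr_add)
      also have "x powr (-s) = m k j"
      proof -
        have "x powr (-s) \<le> x powr s" using x False s by (intro powr_mono) auto
        then show ?thesis by (simp add: mx min_def)
      qed
      also have "exp 1 * (4 * s) powr (2 * s) * m k j \<le> D * m k j"
        using m0 by (intro mult_right_mono) (auto simp: D_def)
      finally show ?thesis .
    qed
    finally show ?thesis .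
  qed
  have pow_int: "integrable \<mu> (\<lambda>t. t ^ k)" for k
    using integrable_power_01[OF \<mu> fin, of 1] by simp
  have int0: "0 \<le> (LINT t|\<mu>. t ^ k)" for k
    by (rule Bochner_Integration.integral_nonneg) (auto simp: space_borel_01[OF \<mu>])
  have bound: "real (Suc k) powr s * (LINT t|\<mu>. t ^ k) \<le> D * X" if X: "0 \<le> X" "\<And>N. (\<Sum>j<N. \<epsilon> j * m k j) \<le> X" for k X
  proof -
    have "ennreal (real (Suc k) powr s * (LINT t|\<mu>. t ^ k)) = ennreal (real (Suc k) powr s) * (\<integral>\<^sup>+t. ennreal (t ^ k) \<partial>\<mu>)"
      by (subst nn_integral_eq_integral[OF pow_int]) (auto simp: ennreal_mult int0 space_borel_01[OF \<mu>])
    also have "\<dots> \<le> ennreal (real (Suc k) powr s) * (\<Sum>j. ennreal ((1 - (1/2)^Suc j) ^ k) * emeasure \<mu> (dyadic_interval j))"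
    proof (intro mult_left_mono nn_integral_le_dyadic_sum[OF \<mu>] ennreal_leI)
      fix j t assume t: "t \<in> dyadic_interval j"
      then show "t ^ k \<le> (1 - (1/2)^Suc j) ^ k"
        using dyadic_interval_subset[of j] by (intro power_mono) (auto simp: dyadic_interval_def)
    qed simp
    also have "\<dots> \<le> ennreal (D * X)"
    proof -
      have p0: "0 \<le> (1 - (1/2::real)^Suc j) ^ k" for j using half_powers(2)[of "Suc j"] by simp
      have "ennreal (real (Suc k) powr s) * (ennreal ((1 - (1/2)^Suc j) ^ k) * emeasure \<mu> (dyadic_interval j)) \<le> ennreal (D * (\<epsilon> j * m k j))" for j
      proof -
        have "ennreal (real (Suc k) powr s) * (ennreal ((1 - (1/2)^Suc j) ^ k) * emeasure \<mu> (dyadic_interval j))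
          \<le> ennreal (real (Suc k) powr s) * (ennreal ((1 - (1/2)^Suc j) ^ k) * ennreal (\<epsilon> j * ((1/2)^j) powr s))"
          by (intro mult_left_mono b) auto
        also have "\<dots> = ennreal (real (Suc k) powr s * ((1 - (1/2)^Suc j) ^ k * (\<epsilon> j * ((1/2)^j) powr s)))"
          using \<epsilon>(2)[of j] p0[of j] by (simp only: ennreal_mult powr_ge_zero mult_nonneg_nonneg)
        also have "\<dots> \<le> ennreal (D * (\<epsilon> j * m k j))"
          using mult_left_mono[OF key[of k j] \<epsilon>(2)[of j]] by (intro ennreal_leI) (simp only: mult_ac)
        finally show ?thesis .
      qed
      then have "(\<Sum>j. ennreal (real (Suc k) powr s) * (ennreal ((1 - (1/2)^Suc j) ^ k) * emeasure \<mu> (dyadic_interval j))) \<le> (\<Sum>j. ennreal (D * (\<epsilon> j * m k j)))"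
        by (intro suminf_le) auto
      also have "\<dots> \<le> ennreal (D * X)"
      proof (rule suminf_le_const[OF summableI])
        fix N
        have "(\<Sum>j<N. ennreal (D * (\<epsilon> j * m k j))) = ennreal (D * (\<Sum>j<N. \<epsilon> j * m k j))"
          using D \<epsilon>(2) m0 by (subst sum_ennreal) (auto simp: sum_distrib_left)
        also have "\<dots> \<le> ennreal (D * X)" using D X by (intro ennreal_leI mult_left_mono) auto
        finally show "(\<Sum>j<N. ennreal (D * (\<epsilon> j * m k j))) \<le> ennreal (D * X)" .
      qed
      finally show ?thesis by simp
    qed
    finally show ?thesis using D X by (subst (asm) ennreal_le_iff) auto
  qed
  show ?thesis
  proof (rule LIMSEQ_I)
    fix e :: real assume e: "0 < e"
    define d where "d = e / (4 * D * C)"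
    have d: "0 < d" using e D C by (simp add: d_def)
    obtain J where J: "\<And>j. j \<ge> J \<Longrightarrow> \<epsilon> j \<le> d"
      using order_tendstoD(2)[OF \<epsilon>(1) d] by (auto simp: eventually_sequentially dest: less_imp_le)
    have "(\<lambda>k. \<Sum>j<J. \<epsilon> j * m k j) \<longlonglongrightarrow> (\<Sum>j<J. \<epsilon> j * 0)"
      by (intro tendsto_sum tendsto_mult tendsto_const m_tendsto)
    then have "(\<lambda>k. \<Sum>j<J. \<epsilon> j * m k j) \<longlonglongrightarrow> 0" by simp
    then obtain K where K: "\<And>k. k \<ge> K \<Longrightarrow> (\<Sum>j<J. \<epsilon> j * m k j) < e / (4 * D)"
      using order_tendstoD(2)[of _ 0 sequentially "e / (4 * D)"] e D by (auto simp: eventually_sequentially)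
    have "real (Suc k) powr s * (LINT t|\<mu>. t ^ k) < e" if k: "k \<ge> K" for k
    proof -
      have "real (Suc k) powr s * (LINT t|\<mu>. t ^ k) \<le> D * (e / (4 * D) + d * C)"
      proof (rule bound)
        show "0 \<le> e / (4 * D) + d * C" using e D d C by simp
        fix N
        have "(\<Sum>j<N. \<epsilon> j * m k j) \<le> (\<Sum>j<N. (if j < J then \<epsilon> j * m k j else 0) + d * m k j)"
          using J m0 d \<epsilon>(2) by (intro sum_mono) (auto simp: not_less mult_right_mono)
        also have "\<dots> = (\<Sum>j<N. if j < J then \<epsilon> j * m k j else 0) + d * (\<Sum>j<N. m k j)"
          by (simp add: sum.distrib sum_distrib_left)
        also have "(\<Sum>j<N. if j < J then \<epsilon> j * m k j else 0) \<le> (\<Sum>j<J. \<epsilon> j * m k j)"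
          using \<epsilon>(2) m0 by (subst sum.inter_filter[symmetric]) (auto intro!: sum_mono2)
        also have "d * (\<Sum>j<N. m k j) \<le> d * C" unfolding m_def using d by (intro mult_left_mono C(2)) auto
        finally show "(\<Sum>j<N. \<epsilon> j * m k j) \<le> e / (4 * D) + d * C" using K[OF k] by linarith
      qed
      also have "\<dots> = e / 2" using D C by (simp add: d_def field_simps)
      finally show ?thesis using e by linarith
    qed
    then show "\<exists>no. \<forall>k\<ge>no. norm (real (Suc k) powr s * (LINT t|\<mu>. t ^ k) - 0) < e"
      using int0 by (intro exI[of _ K]) simp
  qed
qed

lemma dyadic_interval_unique:
  assumes "t \<in> dyadic_interval i" "t \<in> dyadic_interval j"
  shows "i = j"
proof -
  have "\<not> k < l" if "t \<in> dyadic_interval k" "t \<in> dyadic_interval l" for k l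
  proof
    assume "k < l"
    then have "(1/2::real)^l \<le> (1/2)^Suc k" by (intro power_decreasing) auto
    moreover have "t < 1 - (1/2)^Suc k" "1 - (1/2)^l \<le> t" using that by (auto simp: dyadic_interval_def)
    ultimately show False by linarith
  qed
  then show ?thesis using assms by (meson linorder_neqE_nat)
qed

text \<open>
  With absolutely summable \<open>taylor_coeff f k * \<rho> ^ k\<close> the Taylor series may be integrated term by term.
  The case \<open>\<rho> < 1\<close> serves for Abel means; \<open>\<rho> = 1\<close> serves for functions holomorphic beyond the closed
  disc.
\<close>

lemma dilation_moment_sums:
  assumes \<mu>: "borel_measure_01 \<mu>" and fin: "finite_measure \<mu>"
    and f: "f holomorphic_on ball 0 1" and \<rho>: "0 \<le> \<rho>" "\<rho> \<le> 1"
    and sm: "summable (\<lambda>k. norm (taylor_coeff f k) * \<rho> ^ k)"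
  shows "(\<lambda>k. of_real (LINT t|\<mu>. t ^ (n + k)) * taylor_coeff f k * of_real \<rho> ^ k) sums
     (LINT t|\<mu>. of_real (t ^ n) * f (of_real (\<rho> * t)))"
    and "integrable \<mu> (\<lambda>t. of_real (t ^ n) * f (of_real (\<rho> * t)))"
proof -
  interpret finite_measure \<mu> by (rule fin)
  define u where "u k t = of_real (t ^ (n + k)) * (taylor_coeff f k * of_real \<rho> ^ k)" for k t
  have pow_int: "integrable \<mu> (\<lambda>t. complex_of_real (t ^ k))" for k
    using integrable_power_01[OF \<mu> fin, of 1 k]
    by (simp only: complex_of_real_integrable_eq mult_1)
  have u: "integrable \<mu> (u k)" for k unfolding u_def by (intro integrable_mult_left pow_int)
  have bound: "norm (u k t) \<le> norm (taylor_coeff f k) * \<rho> ^ k" if "t \<in> space \<mu>" for k t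
  proof -
    have "norm (complex_of_real (t ^ (n + k))) \<le> 1" using that by (simp add: space_borel_01[OF \<mu>] norm_power power_le_one)
    then have "norm (u k t) \<le> 1 * norm (taylor_coeff f k * of_real \<rho> ^ k)"
      unfolding u_def norm_mult[of "of_real (t ^ (n + k))"] by (intro mult_right_mono) auto
    then show ?thesis using \<rho> by (simp add: norm_mult norm_power)
  qed
  have pointwise: "(\<lambda>k. u k t) sums (of_real (t ^ n) * f (of_real (\<rho> * t)))" if "t \<in> space \<mu>" for t
  proof -
    have t: "0 \<le> t" "t < 1" using that by (auto simp: space_borel_01[OF \<mu>])
    then have "\<rho> * t < 1" using mult_right_mono[of \<rho> 1 t] \<rho> by linarith
    then have "norm (complex_of_real (\<rho> * t)) < 1" unfolding norm_of_real using t \<rho> by simp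
    then have "(\<lambda>k. taylor_coeff f k * of_real (\<rho> * t) ^ k) sums f (of_real (\<rho> * t))"
      using holomorphic_power_series[OF f, of "of_real (\<rho> * t)"] by (simp add: taylor_coeff_def)
    from sums_mult[OF this, of "of_real (t ^ n)"] show ?thesis
      by (simp add: u_def power_mult_distrib power_add mult_ac)
  qed
  have ae: "AE t in \<mu>. summable (\<lambda>k. norm (u k t))"
    by (rule AE_I2, rule summable_comparison_test'[OF sm], simp, rule bound)
  have smi: "summable (\<lambda>k. LINT t|\<mu>. norm (u k t))"
  proof (rule summable_comparison_test'[OF summable_mult2[OF sm], of _ _ "measure \<mu> (space \<mu>)"])
    fix k :: nat
    have "(LINT t|\<mu>. norm (u k t)) \<le> (LINT t|\<mu>. norm (taylor_coeff f k) * \<rho> ^ k)"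
      using u bound by (intro integral_mono) auto
    then show "norm (LINT t|\<mu>. norm (u k t)) \<le> norm (taylor_coeff f k) * \<rho> ^ k * measure \<mu> (space \<mu>)"
      by (simp add: mult_ac)
  qed
  have eq: "(\<Sum>k. u k t) = of_real (t ^ n) * f (of_real (\<rho> * t))" if "t \<in> space \<mu>" for t
    using pointwise[OF that] by (simp add: sums_iff)
  have "(\<lambda>k. LINT t|\<mu>. u k t) sums (LINT t|\<mu>. (\<Sum>k. u k t))"
    by (rule sums_integral[OF u ae smi])
  also have "(LINT t|\<mu>. (\<Sum>k. u k t)) = (LINT t|\<mu>. of_real (t ^ n) * f (of_real (\<rho> * t)))"
    by (rule Bochner_Integration.integral_cong[OF refl eq])
  also have "(\<lambda>k. LINT t|\<mu>. u k t) = (\<lambda>k. of_real (LINT t|\<mu>. t ^ (n + k)) * taylor_coeff f k * of_real \<rho> ^ k)"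
    unfolding u_def by (simp add: mult.assoc del: of_real_power)
  finally show "(\<lambda>k. of_real (LINT t|\<mu>. t ^ (n + k)) * taylor_coeff f k * of_real \<rho> ^ k) sums
     (LINT t|\<mu>. of_real (t ^ n) * f (of_real (\<rho> * t)))" .
  have "integrable \<mu> (\<lambda>t. \<Sum>k. u k t)"
    by (rule integrable_suminf[OF u ae smi])
  then show "integrable \<mu> (\<lambda>t. of_real (t ^ n) * f (of_real (\<rho> * t)))"
    by (subst (asm) Bochner_Integration.integrable_cong[OF refl eq])
qed

text \<open>
  The integrals of the dilates \<open>f (\<rho> * t)\<close> are the Abel means of the coefficient series, and by
  dominated convergence they tend to the integral of \<open>f\<close>; the majorant takes the value
  \<open>radial_max f j\<close> on the \<open>j\<close>-th dyadic interval.  The coefficients of \<open>f\<close> are of order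
  \<open>k powr (max (1/p) 1 - 1)\<close> and the moments of \<open>\<mu>\<close> are of smaller order than
  \<open>k powr (- max (1/p) 1)\<close>.  So the terms are \<open>o(1/k)\<close> and Tauber's theorem applies.
\<close>

lemma moment_expansion_hardy:
  assumes \<mu>: "borel_measure_01 \<mu>" and fin: "finite_measure \<mu>"
    and f: "f \<in> hardy_space p" and p: "0 < p"
    and \<epsilon>: "\<epsilon> \<longlonglongrightarrow> 0" "\<And>j. 0 \<le> \<epsilon> j"
    and b: "\<And>j. emeasure \<mu> (dyadic_interval j) \<le> ennreal (\<epsilon> j * ((1/2)^j) powr (max (1 / p) 1))"
    and S: "(\<Sum>j. ennreal (radial_max f j) * emeasure \<mu> (dyadic_interval j)) < \<infinity>"
  shows "moment_expansion \<mu> f"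
proof -
  interpret finite_measure \<mu> by (rule fin)
  have hol: "f holomorphic_on ball 0 1" using f by (simp add: hardy_space_def)
  have dm: "dyadic_interval j \<in> sets \<mu>" for j
    by (rule sets_borel_01[OF \<mu> _ dyadic_interval_subset]) (simp add: dyadic_interval_def)
  define G where "G t = (\<Sum>j. radial_max f j * indicator (dyadic_interval j) t)" for t
  have G_eq: "G t = radial_max f j" if "t \<in> dyadic_interval j" for t j
  proof -
    have "G t = (\<Sum>i\<in>{j}. radial_max f i * indicator (dyadic_interval i) t)"
      unfolding G_def by (rule suminf_finite) (use that dyadic_interval_unique in \<open>auto simp: indicator_def\<close>)
    then show ?thesis using that by (simp del: sum_mult_indicator add: indicator_def)
  qed
  have G_meas: "G \<in> borel_measurable \<mu>"
    unfolding G_def[abs_def] using dm by (intro borel_measurable_suminf borel_measurable_times borel_measurable_indicator) auto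
  have G_int: "integrable \<mu> G"
  proof (rule integrableI_bounded[OF G_meas])
    have "(\<integral>\<^sup>+t. ennreal (norm (G t)) \<partial>\<mu>) \<le> (\<Sum>j. ennreal (radial_max f j) * emeasure \<mu> (dyadic_interval j))"
      by (rule nn_integral_le_dyadic_sum[OF \<mu>]) (use G_eq radial_max_nonneg[OF hol] in auto)
    then show "(\<integral>\<^sup>+t. ennreal (norm (G t)) \<partial>\<mu>) < \<infinity>" using S by (rule le_less_trans)
  qed
  have dom: "norm (f (of_real (\<rho> * t))) \<le> G t" if t: "t \<in> space \<mu>" and \<rho>: "0 \<le> \<rho>" "\<rho> \<le> 1" for t \<rho>
  proof -
    have t1: "0 \<le> t" "t < 1" using t by (auto simp: space_borel_01[OF \<mu>])
    then obtain j where j: "t \<in> dyadic_interval j"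
      using dyadic_interval_exists[of t] by (auto simp: dyadic_interval_def)
    have "\<rho> * t \<le> t" using mult_right_mono[of \<rho> 1 t] \<rho> t1 by simp
    then have "\<rho> * t \<le> 1 - (1/2)^Suc j" using j by (simp add: dyadic_interval_def)
    then show ?thesis unfolding G_eq[OF j] by (intro radial_max_upper[OF hol]) (use \<rho> t1 in auto)
  qed
  have fm: "(\<lambda>t. f (of_real (\<rho> * t))) \<in> borel_measurable \<mu>" if "0 \<le> \<rho>" "\<rho> \<le> 1" for \<rho>
  proof (rule measurable_borel_01[OF \<mu>])
    have "(\<lambda>t. \<rho> * t) ` {0..<1} \<subseteq> {0..<1}"
    proof clarify
      fix t :: real assume "t \<in> {0..<1}"
      then show "\<rho> * t \<in> {0..<1}" using that mult_right_mono[of \<rho> 1 t] by auto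
    qed
    then show "continuous_on {0..<1} (\<lambda>t. f (of_real (\<rho> * t)))"
      by (intro continuous_on_compose2[OF continuous_on_radius[OF hol subset_refl]] continuous_intros)
  qed
  have int: "integrable \<mu> (\<lambda>t. f (of_real t))"
    by (rule Bochner_Integration.integrable_bound[OF G_int]) (use fm[of 1] dom[of _ 1] in \<open>auto intro!: AE_I2 intro: order_trans[OF _ abs_ge_self]\<close>)
  have pow01: "norm (complex_of_real (t ^ n)) \<le> 1" if "t \<in> space \<mu>" for t n
    using that by (simp add: space_borel_01[OF \<mu>] norm_power power_le_one)
  have sums: "(\<lambda>k. of_real (LINT t|\<mu>. t ^ (n + k)) * taylor_coeff f k) sums (LINT t|\<mu>. of_real (t ^ n) * f (of_real t))" for n
  proof (rule Tauber[where A="\<lambda>\<rho>. LINT t|\<mu>. of_real (t ^ n) * f (of_real (\<rho> * t))"])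
    show "(\<lambda>k. of_real (LINT t|\<mu>. t ^ (n + k)) * taylor_coeff f k * of_real r ^ k) sums
        (LINT t|\<mu>. of_real (t ^ n) * f (of_real (r * t)))" if r: "0 < r" "r < 1" for r
    proof (rule dilation_moment_sums[OF \<mu> fin hol])
      obtain R where R: "r < R" "R < 1" using r dense by blast
      have "summable (\<lambda>k. taylor_coeff f k * of_real R ^ k)"
        using holomorphic_power_series[OF hol, of "of_real R"] r R by (auto simp: taylor_coeff_def sums_iff)
      from powser_insidea[OF this, of "of_real r"] r R
      show "summable (\<lambda>k. norm (taylor_coeff f k) * r ^ k)" by (simp add: norm_mult norm_power)
    qed (use r in auto)
    show "((\<lambda>\<rho>. LINT t|\<mu>. of_real (t ^ n) * f (of_real (\<rho> * t))) \<longlongrightarrow> (LINT t|\<mu>. of_real (t ^ n) * f (of_real t))) (at_left 1)"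
    proof (rule tendsto_at_left_sequentially[of 0])
      fix \<rho> :: "nat \<Rightarrow> real" assume \<rho>: "\<And>i. \<rho> i < 1" "\<And>i. 0 < \<rho> i" "\<rho> \<longlonglongrightarrow> 1"
      have pm: "(\<lambda>t. complex_of_real (t ^ n)) \<in> borel_measurable \<mu>"
        by (intro measurable_borel_01[OF \<mu>] continuous_intros)
      show "(\<lambda>i. LINT t|\<mu>. of_real (t ^ n) * f (of_real (\<rho> i * t))) \<longlonglongrightarrow> (LINT t|\<mu>. of_real (t ^ n) * f (of_real t))"
      proof (rule integral_dominated_convergence[OF _ _ G_int])
        show "(\<lambda>t. of_real (t ^ n) * f (of_real t)) \<in> borel_measurable \<mu>"
          using pm fm[of 1] by (intro borel_measurable_times) auto
        show "(\<lambda>t. of_real (t ^ n) * f (of_real (\<rho> i * t))) \<in> borel_measurable \<mu>" for i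
          using pm fm[of "\<rho> i"] \<rho>(1,2)[of i] by (intro borel_measurable_times) auto
        show "AE t in \<mu>. norm (of_real (t ^ n) * f (of_real (\<rho> i * t))) \<le> G t" for i
        proof (rule AE_I2)
          fix t assume t: "t \<in> space \<mu>"
          have "norm (of_real (t ^ n) * f (of_real (\<rho> i * t))) \<le> 1 * G t"
            unfolding norm_mult using pow01[OF t, of n] dom[OF t, of "\<rho> i"] \<rho>(1,2)[of i] by (intro mult_mono) auto
          then show "norm (of_real (t ^ n) * f (of_real (\<rho> i * t))) \<le> G t" by simp
        qed
        show "AE t in \<mu>. (\<lambda>i. of_real (t ^ n) * f (of_real (\<rho> i * t))) \<longlonglongrightarrow> of_real (t ^ n) * f (of_real t)"
        proof (rule AE_I2)
          fix t assume "t \<in> space \<mu>"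
          then have "norm (complex_of_real t) < 1" by (auto simp: space_borel_01[OF \<mu>])
          then have c: "isCont f (of_real t)"
            using holomorphic_on_imp_continuous_on[OF hol] by (simp add: continuous_on_eq_continuous_at)
          have "(\<lambda>i. complex_of_real (\<rho> i * t)) \<longlonglongrightarrow> of_real (1 * t)"
            by (intro tendsto_of_real tendsto_mult tendsto_const \<rho>(3))
          then have "(\<lambda>i. f (of_real (\<rho> i * t))) \<longlonglongrightarrow> f (of_real t)"
            by (intro isCont_tendsto_compose[OF c]) simp
          then show "(\<lambda>i. of_real (t ^ n) * f (of_real (\<rho> i * t))) \<longlonglongrightarrow> of_real (t ^ n) * f (of_real t)"
            by (intro tendsto_mult tendsto_const)
        qed
      qed
    qed simp
    show "(\<lambda>k. real k * norm (of_real (LINT t|\<mu>. t ^ (n + k)) * taylor_coeff f k)) \<longlonglongrightarrow> 0"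
    proof -
      obtain C where C: "C \<ge> 0" "\<And>k. norm (taylor_coeff f k) \<le> C * real (Suc k) powr (max (1 / p) 1 - 1)"
        using hardy_coeff_bound[OF f p] by blast
      have lim: "(\<lambda>k. C * (real (Suc k) powr (max (1 / p) 1) * (LINT t|\<mu>. t ^ k))) \<longlonglongrightarrow> C * 0"
        by (intro tendsto_mult tendsto_const moments_little_o[OF \<mu> fin _ \<epsilon> b]) auto
      have pow_int: "integrable \<mu> (\<lambda>t. t ^ k)" for k
        using integrable_power_01[OF \<mu> fin, of 1] by simp
      have int0: "0 \<le> (LINT t|\<mu>. t ^ k)" for k
        by (rule Bochner_Integration.integral_nonneg) (auto simp: space_borel_01[OF \<mu>])
      have "real k * norm (of_real (LINT t|\<mu>. t ^ (n + k)) * taylor_coeff f k)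
         \<le> C * (real (Suc k) powr (max (1 / p) 1) * (LINT t|\<mu>. t ^ k))" for k
      proof -
        have le: "(LINT t|\<mu>. t ^ (n + k)) \<le> (LINT t|\<mu>. t ^ k)"
          by (intro integral_mono pow_int power_decreasing) (auto simp: space_borel_01[OF \<mu>])
        have "real k * norm (of_real (LINT t|\<mu>. t ^ (n + k)) * taylor_coeff f k)
          = real k * ((LINT t|\<mu>. t ^ (n + k)) * norm (taylor_coeff f k))"
          using int0[of "n + k"] by (simp add: norm_mult)
        also have "\<dots> \<le> real (Suc k) * ((LINT t|\<mu>. t ^ k) * (C * real (Suc k) powr (max (1 / p) 1 - 1)))"
          using le int0 C by (intro mult_mono mult_nonneg_nonneg) auto
        also have "\<dots> = C * ((real (Suc k) powr 1 * real (Suc k) powr (max (1 / p) 1 - 1)) * (LINT t|\<mu>. t ^ k))"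
          by (simp only: powr_one of_nat_0_le_iff mult_ac)
        also have "real (Suc k) powr 1 * real (Suc k) powr (max (1 / p) 1 - 1) = real (Suc k) powr (max (1 / p) 1)"
          unfolding powr_add[symmetric] by simp
        finally show ?thesis .
      qed
      then show ?thesis
        using lim by (intro tendsto_sandwich[OF _ _ tendsto_const[of 0] lim[unfolded mult_zero_right]] always_eventually) auto
    qed
  qed
  show ?thesis unfolding moment_expansion_def using int sums by blast
qed

lemma half_power_powr_summable:
  assumes "0 < \<delta>"
  shows "summable (\<lambda>j. ((1/2::real)^j) powr \<delta>)" "(\<lambda>j. ((1/2::real)^j) powr \<delta>) \<longlonglongrightarrow> 0"
proof -
  have "((1/2::real)^j) powr \<delta> = ((1/2) powr \<delta>) ^ j" for j
  proof -
    have "((1/2::real)^j) powr \<delta> = ((1/2) powr real j) powr \<delta>" by (subst powr_realpow) auto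
    also have "\<dots> = ((1/2) powr \<delta>) powr real j" by (simp only: powr_powr mult.commute)
    also have "\<dots> = ((1/2) powr \<delta>) ^ j" by (rule powr_realpow) simp
    finally show ?thesis .
  qed
  moreover have "(1/2::real) powr \<delta> < 1" using powr_less_mono2[OF assms, of "1/2" 1] by simp
  ultimately show "summable (\<lambda>j. ((1/2::real)^j) powr \<delta>)" "(\<lambda>j. ((1/2::real)^j) powr \<delta>) \<longlonglongrightarrow> 0"
    by (auto intro!: summable_geometric LIMSEQ_realpow_zero)
qed

lemma radial_max_le_half_power:
  assumes f: "f \<in> hardy_space p" and p: "0 < p"
  shows "radial_max f j \<le> 8 powr (1 / p) * hardy_norm p f * ((1/2)^j) powr (- (1 / p))"
proof -
  have "(8 * 2^j) powr (1 / p) = 8 powr (1 / p) * ((1/2)^j) powr (- (1 / p))"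
    by (simp add: powr_mult powr_minus powr_divide power_one_over)
  then show ?thesis using radial_max_growth[OF f p, of j] by (simp add: mult_ac)
qed

lemma suminf_ennreal_le:
  fixes x :: "nat \<Rightarrow> real"
  assumes "\<And>j. 0 \<le> x j" "\<And>N. (\<Sum>j<N. x j) \<le> B"
  shows "(\<Sum>j. ennreal (x j)) \<le> ennreal B"
proof (rule suminf_le_const[OF summableI])
  fix N
  have "(\<Sum>j<N. ennreal (x j)) = ennreal (\<Sum>j<N. x j)" using assms(1) by (intro sum_ennreal) auto
  then show "(\<Sum>j<N. ennreal (x j)) \<le> ennreal B" using assms(2) by (simp add: ennreal_leI)
qed

text \<open>
  An exponent above \<open>max (1/p) 1\<close> leaves a positive power of \<open>(1/2) ^ j\<close> to spare, both for the factor
  that has to tend to 0 and for the integrability of the radial maximum.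
\<close>

lemma moment_expansion_power:
  assumes \<mu>: "borel_measure_01 \<mu>" and fin: "finite_measure \<mu>"
    and f: "f \<in> hardy_space p" and p: "0 < p" and C: "0 < C" and s: "max (1 / p) 1 < s"
    and b: "\<And>j. emeasure \<mu> (dyadic_interval j) \<le> ennreal (C * ((1/2)^j) powr s)"
  shows "moment_expansion \<mu> f"
proof (rule moment_expansion_hardy[OF \<mu> fin f p])
  define \<delta> where "\<delta> = s - max (1 / p) 1"
  have \<delta>: "0 < \<delta>" using s by (simp add: \<delta>_def)
  show "(\<lambda>j. C * ((1/2)^j) powr \<delta>) \<longlonglongrightarrow> 0"
    using tendsto_mult[OF tendsto_const half_power_powr_summable(2)[OF \<delta>], of C] by simp
  show "0 \<le> C * ((1/2)^j) powr \<delta>" for j using C by simp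
  show "emeasure \<mu> (dyadic_interval j) \<le> ennreal (C * ((1/2)^j) powr \<delta> * ((1/2)^j) powr (max (1 / p) 1))" for j
    using b[of j] by (simp add: \<delta>_def mult.assoc flip: powr_add)
  have hol: "f holomorphic_on ball 0 1" using f by (simp add: hardy_space_def)
  define K where "K = 8 powr (1 / p) * hardy_norm p f * C"
  have s': "0 < s - 1 / p" using s by simp
  have "(\<Sum>j. ennreal (radial_max f j) * emeasure \<mu> (dyadic_interval j)) \<le> (\<Sum>j. ennreal (K * ((1/2)^j) powr (s - 1 / p)))"
  proof (intro suminf_le summableI)
    fix j
    have "ennreal (radial_max f j) * emeasure \<mu> (dyadic_interval j) \<le>
      ennreal (8 powr (1 / p) * hardy_norm p f * ((1/2)^j) powr (- (1 / p))) * ennreal (C * ((1/2)^j) powr s)"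
      by (intro mult_mono ennreal_leI radial_max_le_half_power[OF f p] b) auto
    also have "\<dots> = ennreal (K * (((1/2)^j) powr (- (1 / p)) * ((1/2)^j) powr s))"
      using C hardy_norm_nonneg[OF f] by (simp add: ennreal_mult[symmetric] K_def mult_ac)
    finally show "ennreal (radial_max f j) * emeasure \<mu> (dyadic_interval j) \<le> ennreal (K * ((1/2)^j) powr (s - 1 / p))"
      by (simp add: powr_add[symmetric])
  qed
  also have "\<dots> = ennreal (\<Sum>j. K * ((1/2)^j) powr (s - 1 / p))"
    using C hardy_norm_nonneg[OF f] half_power_powr_summable(1)[OF s']
    by (intro suminf_ennreal2 summable_mult) (auto simp: K_def)
  also have "\<dots> < \<infinity>" by simp
  finally show "(\<Sum>j. ennreal (radial_max f j) * emeasure \<mu> (dyadic_interval j)) < \<infinity>" .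
qed

section \<open>Sufficiency for the Bloch space\<close>

definition dyadic_point :: "nat \<Rightarrow> real" where
  "dyadic_point j = 1 - (1/2)^j"

lemma dyadic_point: "0 \<le> dyadic_point j" "dyadic_point j < 1"
  using half_powers[of j] by (auto simp: dyadic_point_def)

text \<open>
  Moving \<open>t\<close> to the left end point of its dyadic interval changes \<open>1 - t * z\<close> by at most the length of
  the interval, which is at most \<open>1 - t \<le> norm (1 - t * z)\<close>.
\<close>

lemma dyadic_kernel_comparison:
  assumes t: "t \<in> dyadic_interval j" and z: "norm (z::complex) < 1" and \<beta>: "0 < \<beta>"
  shows "norm (1 - of_real t * z) powr (-\<beta>) \<le> 2 powr \<beta> * norm (1 - of_real (dyadic_point j) * z) powr (-\<beta>)"
proof -
  have t01: "0 \<le> t" "t < 1" using t dyadic_interval_subset[of j] by auto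
  have t': "1 - (1/2)^j \<le> t" "t < 1 - (1/2)^Suc j" using t by (auto simp: dyadic_interval_def)
  have n: "1 - t \<le> norm (1 - of_real t * z)" by (rule one_minus_real_mult_nonzero) (use t01 z in auto)
  have "1 - of_real (dyadic_point j) * z = (1 - of_real t * z) + of_real (t - dyadic_point j) * z"
    by (simp add: algebra_simps)
  then have "norm (1 - of_real (dyadic_point j) * z) \<le> norm (1 - of_real t * z) + norm (of_real (t - dyadic_point j) * z)"
    by (metis norm_triangle_ineq)
  also have "norm (of_real (t - dyadic_point j) * z) \<le> (t - dyadic_point j) * 1"
    unfolding norm_mult norm_of_real using t' z by (intro mult_mono) (auto simp: dyadic_point_def)
  also have "(t - dyadic_point j) * 1 \<le> (1/2)^Suc j"
  proof -
    define h where "h = (1/2::real)^j"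
    have "(1/2::real)^Suc j = h / 2" by (simp add: h_def)
    then show ?thesis using t'(2) unfolding dyadic_point_def h_def[symmetric] by simp
  qed
  also have "(1/2)^Suc j \<le> norm (1 - of_real t * z)" using n t' by linarith
  finally have le: "norm (1 - of_real (dyadic_point j) * z) \<le> 2 * norm (1 - of_real t * z)" by simp
  have pos: "0 < norm (1 - of_real (dyadic_point j) * z)"
    using one_minus_real_mult_nonzero(1)[OF dyadic_point(1) less_imp_le[OF dyadic_point(2)] z, of j] by simp
  have "norm (1 - of_real t * z) powr (-\<beta>) = 2 powr \<beta> * (2 * norm (1 - of_real t * z)) powr (-\<beta>)"
    by (simp add: powr_mult powr_minus)
  also have "\<dots> \<le> 2 powr \<beta> * norm (1 - of_real (dyadic_point j) * z) powr (-\<beta>)"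
    using le pos \<beta> by (intro mult_left_mono powr_mono2') auto
  finally show ?thesis .
qed

lemma ennreal_norm_integral_le:
  fixes f :: "'a \<Rightarrow> complex"
  shows "ennreal (norm (integral\<^sup>L M f)) \<le> (\<integral>\<^sup>+x. ennreal (norm (f x)) \<partial>M)"
  by (cases "integrable M f") (auto intro: integral_norm_bound_ennreal simp: not_integrable_integral_eq)

text \<open>
  The function \<open>\<phi>\<close> is \<open>f\<close> itself for the operator and \<open>\<lambda>t. t * f t\<close> for its derivative.
\<close>

lemma hilbert_integral_dyadic_bound:
  fixes \<phi> :: "real \<Rightarrow> complex" and z :: complex
  assumes \<mu>: "borel_measure_01 \<mu>" and hol: "f holomorphic_on ball 0 1"
    and \<phi>: "\<And>t. 0 \<le> t \<Longrightarrow> t < 1 \<Longrightarrow> norm (\<phi> t) \<le> norm (f (of_real t))"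
    and \<beta>: "0 < \<beta>" and z: "norm z < 1"
  shows "ennreal (norm (LINT t|\<mu>. \<phi> t * (1 - of_real t * z) powr (- of_real \<beta>)))
    \<le> (\<Sum>j. ennreal (2 powr \<beta> * (radial_max f j * norm (1 - of_real (dyadic_point j) * z) powr (-\<beta>))) * emeasure \<mu> (dyadic_interval j))"
proof (rule order_trans[OF ennreal_norm_integral_le nn_integral_le_dyadic_sum[OF \<mu>]], rule ennreal_leI)
  fix j t assume t: "t \<in> dyadic_interval j"
  then have t01: "0 \<le> t" "t < 1" using dyadic_interval_subset[of j] by auto
  have nz: "1 - of_real t * z \<noteq> 0" by (rule one_minus_real_mult_nonzero) (use t01 z in auto)
  have "norm (\<phi> t) \<le> radial_max f j"
    using \<phi>[OF t01] radial_max_upper[OF hol t01(1), of j] t by (auto simp: dyadic_interval_def intro: order_trans)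
  then have "norm (\<phi> t) * norm (1 - of_real t * z) powr (-\<beta>) \<le>
      radial_max f j * (2 powr \<beta> * norm (1 - of_real (dyadic_point j) * z) powr (-\<beta>))"
    by (intro mult_mono dyadic_kernel_comparison[OF t z \<beta>] radial_max_nonneg[OF hol]) auto
  then show "norm (\<phi> t * (1 - of_real t * z) powr (- of_real \<beta>)) \<le>
     2 powr \<beta> * (radial_max f j * norm (1 - of_real (dyadic_point j) * z) powr (-\<beta>))"
    unfolding norm_mult norm_powr_minus_real[OF nz] by (simp add: mult_ac)
qed

text \<open>
  Since \<open>norm (1 - t * z)\<close> is at least \<open>1 - norm z\<close> and at least \<open>1 - t\<close>, the terms are those of a
  two-sided geometric sum centred at the scale \<open>(1/2) ^ j \<approx> 1 - norm z\<close>.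
\<close>

lemma dyadic_kernel_sum:
  assumes c: "0 < c" and \<beta>: "c < \<beta>"
  shows "\<exists>C>0. \<forall>z. norm z < 1 \<longrightarrow> (\<forall>N. (\<Sum>j<N. ((1/2)^j) powr (\<beta> - c) * norm (1 - of_real (dyadic_point j) * (z::complex)) powr (-\<beta>)) \<le> C * (1 - norm z) powr (-c))"
proof -
  obtain C where C: "0 < C" "\<And>x J. 0 < (x::real) \<Longrightarrow> (\<Sum>j<J. min ((x * (1/2)^j) powr (\<beta> - c)) ((x * (1/2)^j) powr (-c))) \<le> C"
    using two_sided_geometric_sum[of "\<beta> - c" c] c \<beta> by auto
  have "(\<Sum>j<N. ((1/2)^j) powr (\<beta> - c) * norm (1 - of_real (dyadic_point j) * z) powr (-\<beta>)) \<le> C * (1 - norm z) powr (-c)"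
    if z: "norm z < 1" for z :: complex and N
  proof -
    define d where "d = 1 - norm z"
    have d: "0 < d" using z by (simp add: d_def)
    have "((1/2)^j) powr (\<beta> - c) * norm (1 - of_real (dyadic_point j) * z) powr (-\<beta>)
       \<le> d powr (-c) * min (((1 / d) * (1/2)^j) powr (\<beta> - c)) (((1 / d) * (1/2)^j) powr (-c))" for j
    proof -
      define h where "h = (1/2::real)^j"
      have h: "0 < h" by (simp add: h_def)
      let ?n = "norm (1 - of_real (dyadic_point j) * z)"
      have n: "d \<le> ?n" "h \<le> ?n"
        using one_minus_real_mult_nonzero(2,3)[OF dyadic_point(1) less_imp_le[OF dyadic_point(2)] z, of j]
        by (auto simp: d_def h_def dyadic_point_def)
      have "h powr (\<beta> - c) * ?n powr (-\<beta>) \<le> h powr (\<beta> - c) * d powr (-\<beta>)"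
        using n d \<beta> c by (intro mult_left_mono powr_mono2') auto
      also have "\<dots> = d powr (-c) * ((1 / d) * h) powr (\<beta> - c)"
      proof -
        have e1: "d powr (-c) * d powr (-(\<beta> - c)) = d powr (-\<beta>)" by (simp flip: powr_add)
        have e2: "((1 / d) * h) powr (\<beta> - c) = d powr (-(\<beta> - c)) * h powr (\<beta> - c)"
        proof -
          have "(1 / d) powr (\<beta> - c) = d powr (-(\<beta> - c))"
            unfolding powr_minus_divide using d by (subst powr_divide) auto
          then show ?thesis using d h by (subst powr_mult) auto
        qed
        show ?thesis unfolding e2 mult.assoc[symmetric] e1 by (rule mult.commute)
      qed
      finally have 1: "h powr (\<beta> - c) * ?n powr (-\<beta>) \<le> d powr (-c) * ((1 / d) * h) powr (\<beta> - c)" .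
      have "h powr (\<beta> - c) * ?n powr (-\<beta>) \<le> h powr (\<beta> - c) * h powr (-\<beta>)"
        using n h \<beta> c by (intro mult_left_mono powr_mono2') auto
      also have "\<dots> = h powr (-c)" by (simp flip: powr_add)
      also have "\<dots> = d powr (-c) * ((1 / d) * h) powr (-c)"
        using d h by (simp add: powr_mult powr_divide)
      finally have 2: "h powr (\<beta> - c) * ?n powr (-\<beta>) \<le> d powr (-c) * ((1 / d) * h) powr (-c)" .
      show ?thesis using 1 2 unfolding h_def[symmetric] by (auto simp: min_def)
    qed
    then have "(\<Sum>j<N. ((1/2)^j) powr (\<beta> - c) * norm (1 - of_real (dyadic_point j) * z) powr (-\<beta>))
       \<le> d powr (-c) * (\<Sum>j<N. min (((1 / d) * (1/2)^j) powr (\<beta> - c)) (((1 / d) * (1/2)^j) powr (-c)))"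
      unfolding sum_distrib_left by (rule sum_mono)
    also have "\<dots> \<le> d powr (-c) * C" using d by (intro mult_left_mono C(2)) auto
    finally show ?thesis by (simp add: d_def mult.commute)
  qed
  then show ?thesis using C(1) by blast
qed

lemma carleson_dyadic:
  assumes \<mu>: "borel_measure_01 \<mu>" and c: "carleson s \<mu>"
  obtains C where "0 < C" "\<And>j. emeasure \<mu> (dyadic_interval j) \<le> ennreal (C * ((1/2)^j) powr s)"
  using log_carleson_dyadic[OF \<mu> c[unfolded carleson_def]] by (auto simp del: of_nat_Suc)

text \<open>
  The growth bound for \<open>f\<close> and the mass of the dyadic intervals multiply to \<open>((1/2) ^ j) powr \<alpha>\<close>.
  The kernel of the derivative has exponent \<open>\<alpha> + 1\<close>, and the dyadic sum is of order
  \<open>1 / (1 - norm z)\<close>.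
\<close>

theorem bloch_sufficiency:
  assumes \<mu>: "borel_measure_01 \<mu>" and p: "0 < p" and \<alpha>: "1 < \<alpha>" and car: "carleson (1 / p + \<alpha>) \<mu>"
  shows "hilbert_bounded \<mu> \<alpha> (hardy_space p) (hardy_norm p) bloch_space bloch_norm"
proof -
  have fin: "finite_measure \<mu>" using log_carleson_finite[OF \<mu>] car by (auto simp: carleson_def)
  obtain C where C: "0 < C" "\<And>j. emeasure \<mu> (dyadic_interval j) \<le> ennreal (C * ((1/2)^j) powr (1 / p + \<alpha>))"
    using carleson_dyadic[OF \<mu> car] by blast
  obtain G where G: "0 < G" "\<And>z N. norm (z::complex) < 1 \<Longrightarrow> (\<Sum>j<N. ((1/2)^j) powr (\<alpha> + 1 - 1) * norm (1 - of_real (dyadic_point j) * z) powr (-(\<alpha> + 1))) \<le> G * (1 - norm z) powr (-1)"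
    using dyadic_kernel_sum[of 1 "\<alpha> + 1"] \<alpha> by auto
  define S where "S = (\<Sum>j. ((1/2::real)^j) powr \<alpha>)"
  have S: "0 \<le> S" "\<And>N. (\<Sum>j<N. ((1/2::real)^j) powr \<alpha>) \<le> S"
    unfolding S_def using half_power_powr_summable(1)[of \<alpha>] \<alpha> by (auto intro!: suminf_nonneg sum_le_suminf)
  define K where "K = 2 powr (\<alpha> + 1) * 8 powr (1 / p) * C"
  have K: "0 < K" using C by (simp add: K_def)
  define K0 where "K0 = 2 powr \<alpha> * 8 powr (1 / p) * C"
  have K0: "0 < K0" using C by (simp add: K0_def)
  have main: "hilbert_op_defined \<mu> \<alpha> f \<and> norm (hilbert_op \<mu> \<alpha> f 0) \<le> K0 * S * hardy_norm p f \<and>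
     (\<forall>z\<in>ball 0 1. (1 - (norm z)\<^sup>2) * norm (deriv (hilbert_op \<mu> \<alpha> f) z) \<le> 2 * \<alpha> * K * G * hardy_norm p f)"
    if f: "f \<in> hardy_space p" for f
  proof -
    have hol: "f holomorphic_on ball 0 1" using f by (simp add: hardy_space_def)
    note N0 = hardy_norm_nonneg[OF f]
    have m: "moment_expansion \<mu> f"
      by (rule moment_expansion_power[OF \<mu> fin f p C(1) _ C(2)]) (use \<alpha> p in \<open>auto simp: add_pos_pos add_less_cancel_left intro: add_strict_increasing\<close>)
    have \<alpha>0: "0 < \<alpha>" using \<alpha> by simp
    note H = hilbert_op_integral[OF \<mu> fin \<alpha>0 m]
    have term_bound: "ennreal (2 powr \<beta> * (radial_max f j * x)) * emeasure \<mu> (dyadic_interval j)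
       \<le> ennreal (2 powr \<beta> * 8 powr (1 / p) * C * hardy_norm p f * (((1/2)^j) powr \<alpha> * x))" if "0 \<le> x" for \<beta> j x
    proof -
      have "ennreal (2 powr \<beta> * (radial_max f j * x)) * emeasure \<mu> (dyadic_interval j)
        \<le> ennreal (2 powr \<beta> * ((8 powr (1 / p) * hardy_norm p f * ((1/2)^j) powr (- (1 / p))) * x)) * ennreal (C * ((1/2)^j) powr (1 / p + \<alpha>))"
        using that by (intro mult_mono ennreal_leI mult_left_mono mult_right_mono radial_max_le_half_power[OF f p] C(2)) auto
      also have "\<dots> = ennreal (2 powr \<beta> * 8 powr (1 / p) * C * hardy_norm p f * ((((1/2)^j) powr (- (1 / p)) * ((1/2)^j) powr (1 / p + \<alpha>)) * x))"
        using that C(1) N0 by (subst ennreal_mult[symmetric]) (auto simp: mult_ac)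
      also have "((1/2::real)^j) powr (- (1 / p)) * ((1/2)^j) powr (1 / p + \<alpha>) = ((1/2)^j) powr \<alpha>"
        by (simp flip: powr_add)
      finally show ?thesis .
    qed
    have "norm (hilbert_op \<mu> \<alpha> f 0) \<le> K0 * S * hardy_norm p f"
    proof -
      have "ennreal (norm (hilbert_op \<mu> \<alpha> f 0)) \<le> (\<Sum>j. ennreal (2 powr \<alpha> * (radial_max f j * norm (1 - of_real (dyadic_point j) * (0::complex)) powr (-\<alpha>))) * emeasure \<mu> (dyadic_interval j))"
        unfolding H(3)[of 0, simplified norm_zero zero_less_one, OF TrueI] by (rule hilbert_integral_dyadic_bound[OF \<mu> hol _ \<alpha>0]) auto
      also have "\<dots> \<le> (\<Sum>j. ennreal (K0 * hardy_norm p f * ((1/2)^j) powr \<alpha>))"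
        using term_bound[of 1 \<alpha>] by (intro suminf_le summableI) (auto simp: K0_def)
      also have "\<dots> \<le> ennreal (K0 * hardy_norm p f * S)"
        using K0 N0 S by (intro suminf_ennreal_le) (auto simp: sum_distrib_left[symmetric] mult_left_mono)
      finally show ?thesis using K0 N0 S by (subst (asm) ennreal_le_iff) (auto simp: mult_ac)
    qed
    moreover have "(1 - (norm z)\<^sup>2) * norm (deriv (hilbert_op \<mu> \<alpha> f) z) \<le> 2 * \<alpha> * K * G * hardy_norm p f" if z: "norm z < 1" for z
    proof -
      let ?I = "LINT t|\<mu>. of_real t * f (of_real t) * (1 - of_real t * z) powr (- of_real (\<alpha> + 1))"
      have "ennreal (norm ?I) \<le> (\<Sum>j. ennreal (2 powr (\<alpha> + 1) * (radial_max f j * norm (1 - of_real (dyadic_point j) * z) powr (-(\<alpha> + 1)))) * emeasure \<mu> (dyadic_interval j))"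
        by (rule hilbert_integral_dyadic_bound[OF \<mu> hol _ _ z]) (use \<alpha> in \<open>auto simp: norm_mult mult_left_le_one_le\<close>)
      also have "\<dots> \<le> (\<Sum>j. ennreal (K * hardy_norm p f * (((1/2)^j) powr (\<alpha> + 1 - 1) * norm (1 - of_real (dyadic_point j) * z) powr (-(\<alpha> + 1)))))"
        using term_bound[of _ "\<alpha> + 1"] by (intro suminf_le summableI) (auto simp: K_def)
      also have "\<dots> \<le> ennreal (K * hardy_norm p f * (G * (1 - norm z) powr (-1)))"
      proof (rule suminf_ennreal_le)
        show "0 \<le> K * hardy_norm p f * (((1/2)^j) powr (\<alpha> + 1 - 1) * norm (1 - of_real (dyadic_point j) * z) powr (-(\<alpha> + 1)))" for j
          using K N0 by simp
        show "(\<Sum>j<N. K * hardy_norm p f * (((1/2)^j) powr (\<alpha> + 1 - 1) * norm (1 - of_real (dyadic_point j) * z) powr (-(\<alpha> + 1))))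
           \<le> K * hardy_norm p f * (G * (1 - norm z) powr (-1))" for N
          unfolding sum_distrib_left[symmetric] using K N0 by (intro mult_left_mono G(2)[OF z]) auto
      qed
      finally have I: "norm ?I \<le> K * hardy_norm p f * (G * (1 - norm z) powr (-1))"
        using K N0 G(1) by (subst (asm) ennreal_le_iff) auto
      have w: "0 \<le> 1 - (norm z)\<^sup>2" "1 - (norm z)\<^sup>2 \<le> 2 * (1 - norm z)"
      proof -
        have e: "1 - (norm z)\<^sup>2 = (1 - norm z) * (1 + norm z)" by (simp add: power2_eq_square algebra_simps)
        show "0 \<le> 1 - (norm z)\<^sup>2" unfolding e using z by (intro mult_nonneg_nonneg) auto
        have "(1 - norm z) * (1 + norm z) \<le> (1 - norm z) * 2" using z by (intro mult_left_mono) auto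
        then show "1 - (norm z)\<^sup>2 \<le> 2 * (1 - norm z)" unfolding e by simp
      qed
      have "(1 - (norm z)\<^sup>2) * norm (deriv (hilbert_op \<mu> \<alpha> f) z) = (1 - (norm z)\<^sup>2) * (\<alpha> * norm ?I)"
        using H(4)[OF z] \<alpha> by (simp add: norm_mult del: of_real_add)
      also have "\<dots> \<le> (2 * (1 - norm z)) * (\<alpha> * (K * hardy_norm p f * (G * (1 - norm z) powr (-1))))"
        using w I \<alpha> z by (intro mult_mono) auto
      also have "\<dots> = 2 * \<alpha> * K * G * hardy_norm p f * ((1 - norm z) * (1 - norm z) powr (-1))" by (simp only: mult_ac)
      also have "(1 - norm z) * (1 - norm z) powr (-1) = 1" using z by (simp add: powr_minus)
      finally show ?thesis by simp
    qed
    ultimately show ?thesis using H(1) by auto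
  qed
  show ?thesis
    unfolding hilbert_bounded_def bounded_operator_def
  proof (intro conjI ballI exI[of _ "K0 * S + 2 * \<alpha> * K * G"])
    fix f assume f: "f \<in> hardy_space p"
    show "hilbert_op_defined \<mu> \<alpha> f" using main[OF f] by blast
    then show "hilbert_op \<mu> \<alpha> f \<in> bloch_space"
      using main[OF f] unfolding bloch_space_def hilbert_op_defined_def by (auto intro!: bdd_aboveI2)
    have "(SUP z\<in>ball 0 1. (1 - (norm z)\<^sup>2) * norm (deriv (hilbert_op \<mu> \<alpha> f) z)) \<le> 2 * \<alpha> * K * G * hardy_norm p f"
      by (rule cSUP_least) (use main[OF f] in auto)
    then show "bloch_norm (hilbert_op \<mu> \<alpha> f) \<le> (K0 * S + 2 * \<alpha> * K * G) * hardy_norm p f"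
      unfolding bloch_norm_def using main[OF f] by (simp add: algebra_simps)
  qed
qed

section \<open>Sufficiency for weighted Bergman spaces\<close>

lemma continuous_on_bergman_integrand:
  assumes F: "F holomorphic_on ball 0 1" and q: "0 < q"
  shows "continuous_on (ball 0 1) (\<lambda>z. norm (F z) powr q * (1 - (norm z)\<^sup>2) powr \<beta>)"
proof (rule continuous_on_mult)
  show "continuous_on (ball 0 1) (\<lambda>z. norm (F z) powr q)"
    using q by (intro continuous_on_powr' continuous_intros holomorphic_on_imp_continuous_on[OF F]) auto
  have "1 - (norm z)\<^sup>2 \<noteq> 0" if "z \<in> ball 0 1" for z :: complex
    using that by (auto simp: abs_square_eq_1)
  then show "continuous_on (ball 0 1) (\<lambda>z::complex. (1 - (norm z)\<^sup>2) powr \<beta>)"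
    by (intro continuous_on_powr continuous_intros) auto
qed

lemma bergman_nn_integral:
  assumes F: "F holomorphic_on ball 0 1" and q: "0 < q"
  shows "F \<in> bergman_space q \<beta> \<longleftrightarrow> (\<integral>\<^sup>+z\<in>ball 0 1. ennreal (norm (F z) powr q * (1 - (norm z)\<^sup>2) powr \<beta>) \<partial>lborel) < \<infinity>"
    and "F \<in> bergman_space q \<beta> \<Longrightarrow> -1 < \<beta> \<Longrightarrow>
      (\<integral>\<^sup>+z\<in>ball 0 1. ennreal (norm (F z) powr q * (1 - (norm z)\<^sup>2) powr \<beta>) \<partial>lborel) = ennreal (pi / (\<beta> + 1) * bergman_norm q \<beta> F powr q)"
proof -
  let ?G = "\<lambda>z. norm (F z) powr q * (1 - (norm z)\<^sup>2) powr \<beta>"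
  let ?g = "\<lambda>z. indicator (ball 0 1) z *\<^sub>R ?G z"
  have m: "?g \<in> borel_measurable borel"
    by (rule borel_measurable_continuous_on_indicator[OF _ continuous_on_bergman_integrand[OF F q]]) simp
  have eq: "(\<integral>\<^sup>+z\<in>ball 0 1. ennreal (?G z) \<partial>lborel) = (\<integral>\<^sup>+z. ennreal (norm (?g z)) \<partial>lborel)"
    by (intro nn_integral_cong) (auto simp: indicator_def)
  have "set_integrable lborel (ball 0 1) ?G \<longleftrightarrow> (\<integral>\<^sup>+z\<in>ball 0 1. ennreal (?G z) \<partial>lborel) < \<infinity>"
    unfolding set_integrable_def eq integrable_iff_bounded using m by simp
  then show "F \<in> bergman_space q \<beta> \<longleftrightarrow> (\<integral>\<^sup>+z\<in>ball 0 1. ennreal (?G z) \<partial>lborel) < \<infinity>"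
    using F by (simp add: bergman_space_def)
  assume "F \<in> bergman_space q \<beta>" and \<beta>: "-1 < \<beta>"
  then have int: "integrable lborel ?g" by (simp add: bergman_space_def set_integrable_def)
  define L where "L = (LINT z:ball 0 1|lborel. ?G z)"
  have L: "L = (\<integral>z. ?g z \<partial>lborel)" by (simp add: L_def set_lebesgue_integral_def)
  have L0: "0 \<le> L" unfolding L by (intro Bochner_Integration.integral_nonneg) (auto simp: indicator_def)
  have "bergman_norm q \<beta> F powr q = (\<beta> + 1) * (1 / pi * L)"
    unfolding bergman_norm_def L_def[symmetric] using \<beta> L0 q by (simp add: powr_powr)
  then have "pi / (\<beta> + 1) * bergman_norm q \<beta> F powr q = L" using \<beta> by simp
  moreover have "(\<integral>\<^sup>+z\<in>ball 0 1. ennreal (?G z) \<partial>lborel) = (\<integral>\<^sup>+z. ennreal (?g z) \<partial>lborel)"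
    by (intro nn_integral_cong) (auto simp: indicator_def)
  moreover have "\<dots> = ennreal L"
    unfolding L by (rule nn_integral_eq_integral[OF int]) (auto simp: indicator_def)
  ultimately show "(\<integral>\<^sup>+z\<in>ball 0 1. ennreal (?G z) \<partial>lborel) = ennreal (pi / (\<beta> + 1) * bergman_norm q \<beta> F powr q)"
    by simp
qed

lemma bergman_norm_nonneg: "0 \<le> bergman_norm q \<beta> F"
  by (simp add: bergman_norm_def)

lemma bergman_norm_le:
  assumes F: "F holomorphic_on ball 0 1" and q: "0 < q" and \<beta>: "-1 < \<beta>" and B: "0 \<le> B" and N: "0 \<le> N"
    and le: "(\<integral>\<^sup>+z\<in>ball 0 1. ennreal (norm (F z) powr q * (1 - (norm z)\<^sup>2) powr \<beta>) \<partial>lborel) \<le> ennreal (B * N powr q)"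
  shows "F \<in> bergman_space q \<beta>" "bergman_norm q \<beta> F \<le> ((\<beta> + 1) / pi * B) powr (1 / q) * N"
proof -
  show mem: "F \<in> bergman_space q \<beta>"
    unfolding bergman_nn_integral(1)[OF F q] by (rule le_less_trans[OF le]) simp
  have "ennreal (pi / (\<beta> + 1) * bergman_norm q \<beta> F powr q) \<le> ennreal (B * N powr q)"
    using le unfolding bergman_nn_integral(2)[OF F q mem \<beta>] .
  then have "pi / (\<beta> + 1) * bergman_norm q \<beta> F powr q \<le> B * N powr q"
    using B by (subst (asm) ennreal_le_iff) auto
  then have "bergman_norm q \<beta> F powr q \<le> (\<beta> + 1) / pi * B * N powr q"
    using \<beta> by (simp add: field_simps)
  then have "(bergman_norm q \<beta> F powr q) powr (1 / q) \<le> ((\<beta> + 1) / pi * B * N powr q) powr (1 / q)"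
    using q by (intro powr_mono2) auto
  also have "\<dots> = ((\<beta> + 1) / pi * B) powr (1 / q) * (N powr q) powr (1 / q)"
    by (rule powr_mult)
  finally show "bergman_norm q \<beta> F \<le> ((\<beta> + 1) / pi * B) powr (1 / q) * N"
    using q N bergman_norm_nonneg by (simp add: powr_powr)
qed

lemma hilbert_bounded_bergmanI:
  assumes q: "0 < q" and \<beta>: "-1 < \<beta>" and B: "0 \<le> B"
    and main: "\<And>f. f \<in> hardy_space p \<Longrightarrow> hilbert_op_defined \<mu> \<alpha> f \<and>
      (\<integral>\<^sup>+z\<in>ball 0 1. ennreal (norm (hilbert_op \<mu> \<alpha> f z) powr q * (1 - (norm z)\<^sup>2) powr \<beta>) \<partial>lborel)
        \<le> ennreal (B * hardy_norm p f powr q)"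
  shows "hilbert_bounded \<mu> \<alpha> (hardy_space p) (hardy_norm p) (bergman_space q \<beta>) (bergman_norm q \<beta>)"
  unfolding hilbert_bounded_def bounded_operator_def
proof (intro conjI ballI exI[of _ "((\<beta> + 1) / pi * B) powr (1 / q)"])
  fix f assume f: "f \<in> hardy_space p"
  show d: "hilbert_op_defined \<mu> \<alpha> f" using main[OF f] by blast
  have hF: "hilbert_op \<mu> \<alpha> f holomorphic_on ball 0 1" using d by (simp add: hilbert_op_defined_def)
  show "hilbert_op \<mu> \<alpha> f \<in> bergman_space q \<beta>"
    "bergman_norm q \<beta> (hilbert_op \<mu> \<alpha> f) \<le> ((\<beta> + 1) / pi * B) powr (1 / q) * hardy_norm p f"
    using bergman_norm_le[OF hF q \<beta> B hardy_norm_nonneg[OF f]] main[OF f] by auto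
qed

lemma dyadic_kernel_measurable:
  "(\<lambda>z::complex. ennreal (norm (1 - of_real t * z) powr (-\<alpha>) * (1 - (norm z)\<^sup>2) powr \<beta>) * indicator (ball 0 1) z) \<in> borel_measurable lborel"
  by (intro borel_measurable_times_ennreal borel_measurable_indicator measurable_compose[OF _ measurable_ennreal]) measurable

text \<open>
  The dyadic majorant of the image is integrated term by term.  The \<open>j\<close>-th kernel has an integral of
  order \<open>j + 1\<close> by \<open>Forelli_Rudin_log\<close>, exactly what the logarithmic Carleson condition divides by.
  The remaining sum is the one of \<open>radial_max_embedding\<close> with exponent 1.
\<close>

theorem bergman_one_sufficiency:
  assumes \<mu>: "borel_measure_01 \<mu>" and p: "0 < p" "p \<le> 1" and \<alpha>: "1 < \<alpha>" and car: "log_carleson 1 (1 / p) \<mu>"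
  shows "hilbert_bounded \<mu> \<alpha> (hardy_space p) (hardy_norm p) (bergman_space 1 (\<alpha> - 2)) (bergman_norm 1 (\<alpha> - 2))"
proof -
  have fin: "finite_measure \<mu>" using log_carleson_finite[OF \<mu> car] .
  obtain C where C: "0 < C" "\<And>j. emeasure \<mu> (dyadic_interval j) \<le> ennreal (C * ((1/2)^j) powr (1 / p) * real (Suc j) powr (-1))"
    using log_carleson_dyadic[OF \<mu> car] by blast
  obtain E where E: "0 < E" "\<And>f N. f \<in> hardy_space p \<Longrightarrow> (\<Sum>j<N. ((1/2)^j) powr (1 / p) * radial_max f j powr 1) \<le> E * hardy_norm p f powr 1"
    using radial_max_embedding[OF p(1) p(2)] by blast
  obtain R where R: "0 < R" "\<And>t. t\<in>{0..<1} \<Longrightarrow> (\<integral>\<^sup>+z\<in>ball (0::complex) 1. ennreal (norm (1 - of_real t * z) powr (-\<alpha>) * (1 - (norm z)\<^sup>2) powr (\<alpha> - 2)) \<partial>lborel)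
    \<le> ennreal (R * ln (2 / (1 - t)))" using Forelli_Rudin_log[OF \<alpha>] by blast
  define B where "B = 2 powr \<alpha> * C * R * ln 2 * E"
  have B: "0 \<le> B" using C R E by (auto simp: B_def)
  have main: "hilbert_op_defined \<mu> \<alpha> f \<and> (\<integral>\<^sup>+z\<in>ball 0 1. ennreal (norm (hilbert_op \<mu> \<alpha> f z) powr 1 * (1 - (norm z)\<^sup>2) powr (\<alpha> - 2)) \<partial>lborel) \<le> ennreal (B * hardy_norm p f powr 1)"
    if f: "f \<in> hardy_space p" for f
  proof -
    have hol: "f holomorphic_on ball 0 1" using f by (simp add: hardy_space_def)
    note N0 = hardy_norm_nonneg[OF f]
    note rm0 = radial_max_nonneg[OF hol]
    have Ef: "(\<Sum>j<N. ((1/2)^j) powr (1 / p) * radial_max f j) \<le> E * hardy_norm p f" for N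
      using E(2)[OF f, of N] N0 rm0 by simp
    have m: "moment_expansion \<mu> f"
    proof (rule moment_expansion_hardy[OF \<mu> fin f p(1)])
      have "(\<lambda>j. real (Suc j) powr (-1)) \<longlonglongrightarrow> 0"
        by (intro LIMSEQ_Suc tendsto_neg_powr filterlim_real_sequentially) simp
      from tendsto_mult[OF tendsto_const this, of C]
      show "(\<lambda>j. C * real (Suc j) powr (-1)) \<longlonglongrightarrow> 0" by simp
      show "0 \<le> C * real (Suc j) powr (-1)" for j using C by simp
      show "emeasure \<mu> (dyadic_interval j) \<le> ennreal (C * real (Suc j) powr (-1) * ((1/2)^j) powr (max (1 / p) 1))" for j
      proof -
        have "max (1 / p) 1 = 1 / p" using p by (simp add: max_def)
        then show ?thesis using C(2)[of j] by (simp add: mult_ac)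
      qed
      have "(\<Sum>j. ennreal (radial_max f j) * emeasure \<mu> (dyadic_interval j)) \<le> (\<Sum>j. ennreal (C * (((1/2)^j) powr (1 / p) * radial_max f j)))"
      proof (intro suminf_le summableI)
        fix j
        have "real (Suc j) powr (-1) \<le> 1" by (simp add: powr_minus_divide)
        then have "C * ((1/2)^j) powr (1 / p) * real (Suc j) powr (-1) \<le> C * ((1/2)^j) powr (1 / p) * 1"
          using C by (intro mult_left_mono) auto
        then have "emeasure \<mu> (dyadic_interval j) \<le> ennreal (C * ((1/2)^j) powr (1 / p))"
          using C(2)[of j] by (auto intro: order_trans ennreal_leI)
        then have "ennreal (radial_max f j) * emeasure \<mu> (dyadic_interval j) \<le> ennreal (radial_max f j) * ennreal (C * ((1/2)^j) powr (1 / p))"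
          by (intro mult_left_mono) auto
        then show "ennreal (radial_max f j) * emeasure \<mu> (dyadic_interval j) \<le> ennreal (C * (((1/2)^j) powr (1 / p) * radial_max f j))"
          using C rm0 by (simp add: ennreal_mult[symmetric] mult_ac)
      qed
      also have "\<dots> \<le> ennreal (C * (E * hardy_norm p f))"
        using C rm0 Ef by (intro suminf_ennreal_le) (auto simp: sum_distrib_left[symmetric])
      also have "\<dots> < \<infinity>" by simp
      finally show "(\<Sum>j. ennreal (radial_max f j) * emeasure \<mu> (dyadic_interval j)) < \<infinity>" .
    qed
    have \<alpha>0: "0 < \<alpha>" using \<alpha> by simp
    note H = hilbert_op_integral[OF \<mu> fin \<alpha>0 m]
    define c where "c j = 2 powr \<alpha> * C * (((1/2)^j) powr (1 / p) * radial_max f j) * real (Suc j) powr (-1)" for j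
    have c0: "0 \<le> c j" for j using C rm0 by (simp add: c_def)
    have pt: "ennreal (norm (hilbert_op \<mu> \<alpha> f z)) \<le> (\<Sum>j. ennreal (c j * norm (1 - of_real (dyadic_point j) * z) powr (-\<alpha>)))"
      if z: "norm z < 1" for z
    proof -
      have "ennreal (norm (hilbert_op \<mu> \<alpha> f z)) \<le> (\<Sum>j. ennreal (2 powr \<alpha> * (radial_max f j * norm (1 - of_real (dyadic_point j) * z) powr (-\<alpha>))) * emeasure \<mu> (dyadic_interval j))"
        unfolding H(3)[OF z] by (rule hilbert_integral_dyadic_bound[OF \<mu> hol _ \<alpha>0 z]) simp
      also have "\<dots> \<le> (\<Sum>j. ennreal (c j * norm (1 - of_real (dyadic_point j) * z) powr (-\<alpha>)))"
      proof (intro suminf_le summableI)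
        fix j
        have "ennreal (2 powr \<alpha> * (radial_max f j * norm (1 - of_real (dyadic_point j) * z) powr (-\<alpha>))) * emeasure \<mu> (dyadic_interval j)
          \<le> ennreal (2 powr \<alpha> * (radial_max f j * norm (1 - of_real (dyadic_point j) * z) powr (-\<alpha>))) * ennreal (C * ((1/2)^j) powr (1 / p) * real (Suc j) powr (-1))"
          by (intro mult_left_mono C(2)) auto
        also have "\<dots> = ennreal (c j * norm (1 - of_real (dyadic_point j) * z) powr (-\<alpha>))"
          using C(1) rm0 by (subst ennreal_mult[symmetric]) (auto simp: c_def mult_ac)
        finally show "ennreal (2 powr \<alpha> * (radial_max f j * norm (1 - of_real (dyadic_point j) * z) powr (-\<alpha>))) * emeasure \<mu> (dyadic_interval j)
          \<le> ennreal (c j * norm (1 - of_real (dyadic_point j) * z) powr (-\<alpha>))" .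
      qed
      finally show ?thesis .
    qed
    have "(\<integral>\<^sup>+z\<in>ball 0 1. ennreal (norm (hilbert_op \<mu> \<alpha> f z) powr 1 * (1 - (norm z)\<^sup>2) powr (\<alpha> - 2)) \<partial>lborel)
      \<le> (\<integral>\<^sup>+z. (\<Sum>j. ennreal (c j) * (ennreal (norm (1 - of_real (dyadic_point j) * z) powr (-\<alpha>) * (1 - (norm z)\<^sup>2) powr (\<alpha> - 2)) * indicator (ball (0::complex) 1) z)) \<partial>lborel)"
    proof (rule nn_integral_mono)
      fix z :: complex
      show "ennreal (norm (hilbert_op \<mu> \<alpha> f z) powr 1 * (1 - (norm z)\<^sup>2) powr (\<alpha> - 2)) * indicator (ball 0 1) z
        \<le> (\<Sum>j. ennreal (c j) * (ennreal (norm (1 - of_real (dyadic_point j) * z) powr (-\<alpha>) * (1 - (norm z)\<^sup>2) powr (\<alpha> - 2)) * indicator (ball (0::complex) 1) z))"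
      proof (cases "norm z < 1")
        case True
        have "ennreal (norm (hilbert_op \<mu> \<alpha> f z) powr 1 * (1 - (norm z)\<^sup>2) powr (\<alpha> - 2)) = ennreal (norm (hilbert_op \<mu> \<alpha> f z)) * ennreal ((1 - (norm z)\<^sup>2) powr (\<alpha> - 2))"
          by (simp add: ennreal_mult)
        also have "\<dots> \<le> (\<Sum>j. ennreal (c j * norm (1 - of_real (dyadic_point j) * z) powr (-\<alpha>))) * ennreal ((1 - (norm z)\<^sup>2) powr (\<alpha> - 2))"
          by (intro mult_right_mono pt True) auto
        also have "\<dots> = (\<Sum>j. ennreal (c j * norm (1 - of_real (dyadic_point j) * z) powr (-\<alpha>)) * ennreal ((1 - (norm z)\<^sup>2) powr (\<alpha> - 2)))"
          by (rule ennreal_suminf_multc[symmetric])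
        also have "\<dots> = (\<Sum>j. ennreal (c j) * ennreal (norm (1 - of_real (dyadic_point j) * z) powr (-\<alpha>) * (1 - (norm z)\<^sup>2) powr (\<alpha> - 2)))"
          using c0 by (simp add: ennreal_mult mult.assoc)
        finally show ?thesis using True by simp
      qed simp
    qed
    also have "\<dots> = (\<Sum>j. ennreal (c j) * (\<integral>\<^sup>+z\<in>ball (0::complex) 1. ennreal (norm (1 - of_real (dyadic_point j) * z) powr (-\<alpha>) * (1 - (norm z)\<^sup>2) powr (\<alpha> - 2)) \<partial>lborel))"
      by (subst nn_integral_suminf, intro borel_measurable_times_ennreal borel_measurable_const dyadic_kernel_measurable,
          intro suminf_cong nn_integral_cmult dyadic_kernel_measurable)
    also have "\<dots> \<le> (\<Sum>j. ennreal (2 powr \<alpha> * C * R * ln 2 * (((1/2)^j) powr (1 / p) * radial_max f j)))"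
    proof (intro suminf_le summableI)
      fix j
      have l: "ln (2 / (1 - dyadic_point j)) = real (Suc j) * ln 2"
        by (simp add: dyadic_point_def ln_div ln_realpow algebra_simps)
      have "ennreal (c j) * (\<integral>\<^sup>+z\<in>ball (0::complex) 1. ennreal (norm (1 - of_real (dyadic_point j) * z) powr (-\<alpha>) * (1 - (norm z)\<^sup>2) powr (\<alpha> - 2)) \<partial>lborel)
        \<le> ennreal (c j) * ennreal (R * (real (Suc j) * ln 2))"
        using R(2)[of "dyadic_point j"] dyadic_point[of j] unfolding l by (intro mult_left_mono) auto
      also have "\<dots> = ennreal (2 powr \<alpha> * C * R * ln 2 * (((1/2)^j) powr (1 / p) * radial_max f j) * (real (Suc j) powr (-1) * real (Suc j)))"
        using c0[of j] R(1) by (subst ennreal_mult[symmetric]) (auto simp: c_def mult_ac)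
      also have "real (Suc j) powr (-1) * real (Suc j) = 1" by (simp add: powr_minus_divide del: of_nat_Suc)
      finally show "ennreal (c j) * (\<integral>\<^sup>+z\<in>ball (0::complex) 1. ennreal (norm (1 - of_real (dyadic_point j) * z) powr (-\<alpha>) * (1 - (norm z)\<^sup>2) powr (\<alpha> - 2)) \<partial>lborel)
        \<le> ennreal (2 powr \<alpha> * C * R * ln 2 * (((1/2)^j) powr (1 / p) * radial_max f j))" by simp
    qed
    also have "\<dots> \<le> ennreal (2 powr \<alpha> * C * R * ln 2 * (E * hardy_norm p f))"
    proof (rule suminf_ennreal_le)
      show "0 \<le> 2 powr \<alpha> * C * R * ln 2 * (((1/2)^j) powr (1 / p) * radial_max f j)" for j
        using C R rm0 by simp
      show "(\<Sum>j<N. 2 powr \<alpha> * C * R * ln 2 * (((1/2)^j) powr (1 / p) * radial_max f j)) \<le> 2 powr \<alpha> * C * R * ln 2 * (E * hardy_norm p f)" for N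
        unfolding sum_distrib_left[symmetric] using C R by (intro mult_left_mono Ef) auto
    qed
    also have "2 powr \<alpha> * C * R * ln 2 * (E * hardy_norm p f) = B * hardy_norm p f powr 1"
      using N0 by (simp add: B_def)
    finally show ?thesis using H(1) by blast
  qed
  show ?thesis
    by (rule hilbert_bounded_bergmanI[OF _ _ B main]) (use \<alpha> in auto)
qed

text \<open>
  Young's inequality, after dividing both sequences by their norms.
\<close>

lemma Holder_sum:
  fixes x y :: "nat \<Rightarrow> real"
  assumes q: "1 < q" and q': "1 / q + 1 / q' = 1" and x: "\<And>j. 0 \<le> x j" and y: "\<And>j. 0 \<le> y j"
  shows "(\<Sum>j<N. x j * y j) powr q \<le> (\<Sum>j<N. x j powr q) * (\<Sum>j<N. y j powr q') powr (q - 1)"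
proof -
  have q'1: "1 < q'"
  proof -
    have "1 / q < 1" "0 < 1 / q" using q by auto
    then have "0 < 1 / q'" "1 / q' < 1" using q' by linarith+
    then show ?thesis by (simp add: field_simps split: if_splits)
  qed
  have qq: "q / q' = q - 1"
  proof -
    have "q * (1 / q + 1 / q') = q" unfolding q' by simp
    then show ?thesis using q by (simp add: distrib_left)
  qed
  define A where "A = (\<Sum>j<N. x j powr q)"
  define B where "B = (\<Sum>j<N. y j powr q')"
  have AB: "0 \<le> A" "0 \<le> B" by (auto simp: A_def B_def intro!: sum_nonneg)
  show ?thesis
  proof (cases "A = 0 \<or> B = 0")
    case True
    then have "x j * y j = 0" if "j < N" for j
    proof
      assume "A = 0"
      then have "x j powr q = 0" using that sum_nonneg_eq_0_iff[of "{..<N}" "\<lambda>j. x j powr q"] by (auto simp: A_def)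
      then show ?thesis by simp
    next
      assume "B = 0"
      then have "y j powr q' = 0" using that sum_nonneg_eq_0_iff[of "{..<N}" "\<lambda>j. y j powr q'"] by (auto simp: B_def)
      then show ?thesis by simp
    qed
    then have "(\<Sum>j<N. x j * y j) = 0" by (intro sum.neutral) auto
    then show ?thesis using AB by (simp add: A_def B_def)
  next
    case False
    then have AB': "0 < A" "0 < B" using AB by auto
    define a b where "a = A powr (1 / q)" and "b = B powr (1 / q')"
    have ab: "0 < a" "0 < b" using AB' by (auto simp: a_def b_def)
    have "(\<Sum>j<N. (x j / a) * (y j / b)) \<le> (\<Sum>j<N. (x j / a) powr q / q + (y j / b) powr q' / q')"
      using q q' q'1 x y ab by (intro sum_mono Youngs_inequality) auto
    also have "\<dots> = (\<Sum>j<N. x j powr q) / (A * q) + (\<Sum>j<N. y j powr q') / (B * q')"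
      using q q'1 AB' by (simp add: a_def b_def powr_divide powr_powr sum.distrib sum_divide_distrib)
    also have "\<dots> = 1" using AB' q' unfolding A_def[symmetric] B_def[symmetric] by simp
    also have "(\<Sum>j<N. (x j / a) * (y j / b)) = (\<Sum>j<N. x j * y j) / (a * b)"
      by (simp add: sum_divide_distrib)
    finally have "(\<Sum>j<N. x j * y j) \<le> a * b" using ab by (simp add: field_simps)
    then have "(\<Sum>j<N. x j * y j) powr q \<le> (a * b) powr q"
      using q x y by (intro powr_mono2 sum_nonneg) auto
    also have "\<dots> = a powr q * b powr q" by (rule powr_mult)
    also have "a powr q = A" using q AB' by (simp add: a_def powr_powr)
    also have "b powr q = B powr (q - 1)" using qq by (simp add: b_def powr_powr)
    finally show ?thesis by (simp add: A_def B_def)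
  qed
qed

text \<open>
  Write \<open>h = (1/2) ^ j\<close>, \<open>m\<close> for the radial maximum and \<open>k\<close> for the kernel
  $|1 - (1-h)z|^{-\<alpha>}$.  The dyadic majorant has the terms \<open>h powr s * m * k\<close> with \<open>s = 1/p + \<alpha>/q'\<close>, and
  is split by Hoelder's inequality into \<open>h powr u * m * k powr (1/q)\<close> and \<open>h powr v * k powr (1/q')\<close>.
  The exponents are chosen with a small parameter \<open>d\<close> such that \<open>v * q' = \<alpha> - d\<close>: the second factor
  then sums geometrically to \<open>(1 - norm z) powr (-d)\<close>, whose power \<open>q - 1\<close> costs
  \<open>(1 - norm z) powr (-e)\<close> with \<open>e = d * (q - 1)\<close>.  This leaves \<open>u * q = q/p + e\<close>, and the loss is
  recovered in the integration: \<open>Forelli_Rudin_power\<close> with the weight lowered by \<open>e\<close> yields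
  \<open>h powr (-e)\<close>, so that exactly the sum in \<open>radial_max_embedding\<close> remains.  The hypothesis
  \<open>q \<ge> \<alpha> * p\<close> yields \<open>p \<le> q\<close>, as the embedding requires, and \<open>s > 1\<close>, which makes the coefficient
  series converge.
\<close>

theorem bergman_power_sufficiency:
  assumes \<mu>: "borel_measure_01 \<mu>" and p: "0 < p" and \<alpha>: "1 < \<alpha>" and q: "1 < q" "\<alpha> * p \<le> q" and q': "1 / q + 1 / q' = 1"
    and car: "carleson (1 / p + \<alpha> / q') \<mu>"
  shows "hilbert_bounded \<mu> \<alpha> (hardy_space p) (hardy_norm p) (bergman_space q (\<alpha> - 2)) (bergman_norm q (\<alpha> - 2))"
proof -
  have fin: "finite_measure \<mu>" using log_carleson_finite[OF \<mu>] car by (auto simp: carleson_def)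
  have \<alpha>0: "0 < \<alpha>" and q0: "0 < q" using \<alpha> q by auto
  have "1 * p \<le> \<alpha> * p" using \<alpha> p by (intro mult_right_mono) auto
  then have pq: "p \<le> q" using q(2) by linarith
  have iq': "1 / q' = 1 - 1 / q" using q' by linarith
  have iq: "0 < 1 / q'" using iq' q by simp
  have q'0: "0 < q'" using iq by (simp add: zero_less_divide_iff)
  have qq': "(q - 1) * q' = q"
  proof -
    have "(q - 1) = q * (1 / q')" unfolding iq' using q0 by (simp add: field_simps)
    then show ?thesis using q'0 by simp
  qed
  define s where "s = 1 / p + \<alpha> / q'"
  have s1: "max (1 / p) 1 < s"
  proof -
    have "\<alpha> / q' = \<alpha> * (1 / q')" by simp
    also have "\<dots> = \<alpha> - \<alpha> / q" unfolding iq' by (simp add: algebra_simps)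
    finally have e: "\<alpha> / q' = \<alpha> - \<alpha> / q" .
    have "\<alpha> / q \<le> 1 / p" using q(2) p q0 by (simp add: field_simps)
    then have "1 < s" using \<alpha> unfolding s_def e by linarith
    moreover have "1 / p < s" using \<alpha> q'0 by (simp add: s_def)
    ultimately show ?thesis by simp
  qed
  (* The first bound on e is required by Forelli_Rudin_power, the second one makes d < \<alpha>. *)
  define e where "e = min ((\<alpha> - 1) / 2) (\<alpha> * (q - 1) / 2)"
  have e: "0 < e" "e < \<alpha> - 1" "e < \<alpha> * (q - 1)"
    using \<alpha> q by (auto simp: e_def min_def)
  define d where "d = e / (q - 1)"
  have d: "0 < d" "d < \<alpha>" "d * (q - 1) = e" using e q by (auto simp: d_def field_simps)
  define v where "v = (\<alpha> - d) / q'"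
  define u where "u = 1 / p + d / q'"
  have uv: "u + v = s" by (simp add: u_def v_def s_def diff_divide_distrib)
  have vq: "v * q' = \<alpha> - d" using q'0 by (simp add: v_def)
  have uq: "u * q = q / p + e"
  proof -
    have "d / q' * q = d / q' * ((q - 1) * q')" by (simp only: qq')
    also have "\<dots> = d * (q - 1)" using q'0 by simp
    finally have "d / q' * q = d * (q - 1)" .
    then show ?thesis unfolding u_def d(3) by (simp add: distrib_right)
  qed
  obtain C where C: "0 < C" "\<And>j. emeasure \<mu> (dyadic_interval j) \<le> ennreal (C * ((1/2)^j) powr s)"
    using carleson_dyadic[OF \<mu> car] unfolding s_def by blast
  obtain E where E: "0 < E" "\<And>f N. f \<in> hardy_space p \<Longrightarrow> (\<Sum>j<N. ((1/2)^j) powr (q / p) * radial_max f j powr q) \<le> E * hardy_norm p f powr q"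
    using radial_max_embedding[OF p pq] by blast
  obtain R where R: "0 < R" "\<And>t. t\<in>{0..<1} \<Longrightarrow> (\<integral>\<^sup>+z\<in>ball (0::complex) 1. ennreal (norm (1 - of_real t * z) powr (-\<alpha>) * (1 - (norm z)\<^sup>2) powr (\<alpha> - 2 - e)) \<partial>lborel)
    \<le> ennreal (R * (1 - t) powr (-e))" using Forelli_Rudin_power[OF \<alpha> e(1,2)] by blast
  obtain G where G: "0 < G" "\<And>z N. norm (z::complex) < 1 \<Longrightarrow> (\<Sum>j<N. ((1/2)^j) powr (\<alpha> - d) * norm (1 - of_real (dyadic_point j) * z) powr (-\<alpha>)) \<le> G * (1 - norm z) powr (-d)"
    using dyadic_kernel_sum[OF d(1,2)] by blast
  define K where "K = (2 powr \<alpha> * C) powr q * G powr (q - 1) * 2 powr e"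
  have K: "0 < K" using C G by (simp add: K_def)
  define B where "B = K * R * E"
  have B: "0 \<le> B" using K R E by (simp add: B_def)
  have main: "hilbert_op_defined \<mu> \<alpha> f \<and> (\<integral>\<^sup>+z\<in>ball 0 1. ennreal (norm (hilbert_op \<mu> \<alpha> f z) powr q * (1 - (norm z)\<^sup>2) powr (\<alpha> - 2)) \<partial>lborel) \<le> ennreal (B * hardy_norm p f powr q)"
    if f: "f \<in> hardy_space p" for f
  proof -
    have hol: "f holomorphic_on ball 0 1" using f by (simp add: hardy_space_def)
    note rm0 = radial_max_nonneg[OF hol]
    have m: "moment_expansion \<mu> f"
      by (rule moment_expansion_power[OF \<mu> fin f p C(1) s1 C(2)])
    note H = hilbert_op_integral[OF \<mu> fin \<alpha>0 m]
    define k where "k j z = norm (1 - of_real (dyadic_point j) * z) powr (-\<alpha>)" for j and z :: complex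
    have k0: "0 \<le> k j z" for j z by (simp add: k_def)
    define c where "c j = ((1/2)^j) powr (q / p + e) * radial_max f j powr q" for j
    have c0: "0 \<le> c j" for j by (simp add: c_def)
    have pt: "ennreal (norm (hilbert_op \<mu> \<alpha> f z) powr q) \<le> ennreal (K * (1 - (norm z)\<^sup>2) powr (-e)) * (\<Sum>j. ennreal (c j * k j z))"
      (is "_ \<le> ?R") if z: "norm z < 1" for z
    proof (cases "?R = top")
      case False
      then obtain M where M: "?R = ennreal M" "0 \<le> M" by (cases ?R) auto
      have w: "1 - norm z \<le> 1 - (norm z)\<^sup>2" "0 < 1 - (norm z)\<^sup>2" "1 - (norm z)\<^sup>2 \<le> 2 * (1 - norm z)"
      proof -
        have f1: "1 - (norm z)\<^sup>2 = (1 - norm z) * (1 + norm z)" by (simp add: power2_eq_square algebra_simps)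
        have "(1 - norm z) * 1 \<le> (1 - norm z) * (1 + norm z)" using z by (intro mult_left_mono) auto
        then show "1 - norm z \<le> 1 - (norm z)\<^sup>2" unfolding f1 by simp
        then show "0 < 1 - (norm z)\<^sup>2" using z by linarith
        have "(1 - norm z) * (1 + norm z) \<le> (1 - norm z) * 2" using z by (intro mult_left_mono) auto
        then show "1 - (norm z)\<^sup>2 \<le> 2 * (1 - norm z)" unfolding f1 by simp
      qed
      have wd: "((1 - norm z) powr (-d)) powr (q - 1) \<le> 2 powr e * (1 - (norm z)\<^sup>2) powr (-e)"
      proof -
        have "((1 - norm z) powr (-d)) powr (q - 1) = (1 - norm z) powr (-e)" using d(3) by (simp add: powr_powr)
        also have "\<dots> = 2 powr e * (2 * (1 - norm z)) powr (-e)"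
        proof -
          have "(2::real) powr e * 2 powr (-e) = 1" by (simp flip: powr_add)
          then show ?thesis unfolding powr_mult mult.assoc[symmetric] by (simp only: mult_1)
        qed
        also have "\<dots> \<le> 2 powr e * (1 - (norm z)\<^sup>2) powr (-e)"
          using w e by (intro mult_left_mono powr_mono2') auto
        finally show ?thesis .
      qed
      define x where "x j = ((1/2)^j) powr u * radial_max f j * k j z powr (1 / q)" for j
      define y where "y j = ((1/2)^j) powr v * k j z powr (1 / q')" for j
      have x0: "0 \<le> x j" and y0: "0 \<le> y j" for j using rm0 by (auto simp: x_def y_def)
      have xy: "((1/2)^j) powr s * (radial_max f j * k j z) = x j * y j" for j
      proof -
        have "x j * y j = (((1/2)^j) powr u * ((1/2)^j) powr v) * (radial_max f j * (k j z powr (1 / q) * k j z powr (1 / q')))"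
          unfolding x_def y_def by (simp only: mult_ac)
        also have "((1/2::real)^j) powr u * ((1/2)^j) powr v = ((1/2)^j) powr s" by (simp add: uv flip: powr_add)
        also have "k j z powr (1 / q) * k j z powr (1 / q') = k j z" unfolding powr_add[symmetric] q' using k0 by simp
        finally show ?thesis by simp
      qed
      have xq: "x j powr q = c j * k j z" for j
        using rm0[of j] k0[of j z] q0 uq by (simp add: x_def c_def powr_mult powr_powr mult_ac)
      have yq: "y j powr q' = ((1/2)^j) powr (\<alpha> - d) * k j z" for j
        using k0[of j z] q'0 vq by (simp add: y_def powr_mult powr_powr mult_ac)
      have part: "(\<Sum>j<N. x j * y j) powr q \<le> (\<Sum>j<N. c j * k j z) * (G powr (q - 1) * (2 powr e * (1 - (norm z)\<^sup>2) powr (-e)))" for N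
      proof -
        have "(\<Sum>j<N. x j * y j) powr q \<le> (\<Sum>j<N. x j powr q) * (\<Sum>j<N. y j powr q') powr (q - 1)"
          by (rule Holder_sum[OF q(1) q' x0 y0])
        also have "(\<Sum>j<N. x j powr q) = (\<Sum>j<N. c j * k j z)" by (simp add: xq)
        also have "(\<Sum>j<N. y j powr q') = (\<Sum>j<N. ((1/2)^j) powr (\<alpha> - d) * k j z)" by (simp add: yq)
        also have "(\<Sum>j<N. c j * k j z) * (\<Sum>j<N. ((1/2)^j) powr (\<alpha> - d) * k j z) powr (q - 1)
          \<le> (\<Sum>j<N. c j * k j z) * (G * (1 - norm z) powr (-d)) powr (q - 1)"
          using G(2)[OF z] q c0 k0 by (intro mult_left_mono powr_mono2 sum_nonneg mult_nonneg_nonneg) (auto simp: k_def)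
        also have "(G * (1 - norm z) powr (-d)) powr (q - 1) = G powr (q - 1) * ((1 - norm z) powr (-d)) powr (q - 1)"
          by (rule powr_mult)
        also have "(\<Sum>j<N. c j * k j z) * (G powr (q - 1) * ((1 - norm z) powr (-d)) powr (q - 1))
          \<le> (\<Sum>j<N. c j * k j z) * (G powr (q - 1) * (2 powr e * (1 - (norm z)\<^sup>2) powr (-e)))"
          using wd c0 k0 by (intro mult_left_mono sum_nonneg mult_nonneg_nonneg) auto
        finally show ?thesis .
      qed
      have "ennreal (norm (hilbert_op \<mu> \<alpha> f z)) \<le> (\<Sum>j. ennreal (2 powr \<alpha> * (radial_max f j * k j z)) * emeasure \<mu> (dyadic_interval j))"
        unfolding H(3)[OF z] k_def by (rule hilbert_integral_dyadic_bound[OF \<mu> hol _ \<alpha>0 z]) simp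
      also have "\<dots> \<le> (\<Sum>j. ennreal (2 powr \<alpha> * C * (x j * y j)))"
      proof (intro suminf_le summableI)
        fix j
        have "ennreal (2 powr \<alpha> * (radial_max f j * k j z)) * emeasure \<mu> (dyadic_interval j)
          \<le> ennreal (2 powr \<alpha> * (radial_max f j * k j z)) * ennreal (C * ((1/2)^j) powr s)"
          by (intro mult_left_mono C(2)) auto
        also have "\<dots> = ennreal (2 powr \<alpha> * C * (((1/2)^j) powr s * (radial_max f j * k j z)))"
          using C(1) rm0 k0 by (subst ennreal_mult[symmetric]) (auto simp: mult_ac)
        finally show "ennreal (2 powr \<alpha> * (radial_max f j * k j z)) * emeasure \<mu> (dyadic_interval j) \<le> ennreal (2 powr \<alpha> * C * (x j * y j))"
          unfolding xy .
      qed
      also have "\<dots> \<le> ennreal (M powr (1 / q))"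
      proof (rule suminf_ennreal_le)
        show "0 \<le> 2 powr \<alpha> * C * (x j * y j)" for j using C x0 y0 by simp
        fix N
        have "ennreal (K * (1 - (norm z)\<^sup>2) powr (-e) * (\<Sum>j<N. c j * k j z)) = ennreal (K * (1 - (norm z)\<^sup>2) powr (-e)) * (\<Sum>j<N. ennreal (c j * k j z))"
          using K c0 k0 by (subst sum_ennreal) (auto simp: ennreal_mult sum_nonneg)
        also have "\<dots> \<le> ?R" by (intro mult_left_mono sum_le_suminf) auto
        finally have le: "K * (1 - (norm z)\<^sup>2) powr (-e) * (\<Sum>j<N. c j * k j z) \<le> M"
          unfolding M(1) using M(2) by (subst (asm) ennreal_le_iff) auto
        have "(2 powr \<alpha> * C * (\<Sum>j<N. x j * y j)) powr q = (2 powr \<alpha> * C) powr q * (\<Sum>j<N. x j * y j) powr q"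
          by (rule powr_mult)
        also have "\<dots> \<le> (2 powr \<alpha> * C) powr q * ((\<Sum>j<N. c j * k j z) * (G powr (q - 1) * (2 powr e * (1 - (norm z)\<^sup>2) powr (-e))))"
          by (intro mult_left_mono part) auto
        also have "\<dots> = K * (1 - (norm z)\<^sup>2) powr (-e) * (\<Sum>j<N. c j * k j z)"
          unfolding K_def by (simp only: mult_ac)
        finally have "(2 powr \<alpha> * C * (\<Sum>j<N. x j * y j)) powr q \<le> M" using le by linarith
        then have "((2 powr \<alpha> * C * (\<Sum>j<N. x j * y j)) powr q) powr (1 / q) \<le> M powr (1 / q)"
          using q0 by (intro powr_mono2) auto
        moreover have "0 \<le> 2 powr \<alpha> * C * (\<Sum>j<N. x j * y j)" using C x0 y0 by (intro mult_nonneg_nonneg sum_nonneg) auto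
        ultimately show "(\<Sum>j<N. 2 powr \<alpha> * C * (x j * y j)) \<le> M powr (1 / q)"
          unfolding sum_distrib_left[symmetric] using q0 by (simp add: powr_powr)
      qed
      finally have "norm (hilbert_op \<mu> \<alpha> f z) \<le> M powr (1 / q)" by (subst (asm) ennreal_le_iff) auto
      then have "norm (hilbert_op \<mu> \<alpha> f z) powr q \<le> (M powr (1 / q)) powr q" using q0 by (intro powr_mono2) auto
      also have "\<dots> = M" using q0 M(2) by (simp add: powr_powr)
      finally show ?thesis unfolding M(1) by (rule ennreal_leI)
    qed simp
    have "(\<integral>\<^sup>+z\<in>ball 0 1. ennreal (norm (hilbert_op \<mu> \<alpha> f z) powr q * (1 - (norm z)\<^sup>2) powr (\<alpha> - 2)) \<partial>lborel)
      \<le> (\<integral>\<^sup>+z. (\<Sum>j. ennreal (K * c j) * (ennreal (norm (1 - of_real (dyadic_point j) * z) powr (-\<alpha>) * (1 - (norm z)\<^sup>2) powr (\<alpha> - 2 - e)) * indicator (ball (0::complex) 1) z)) \<partial>lborel)"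
    proof (rule nn_integral_mono)
      fix z :: complex
      show "ennreal (norm (hilbert_op \<mu> \<alpha> f z) powr q * (1 - (norm z)\<^sup>2) powr (\<alpha> - 2)) * indicator (ball 0 1) z
        \<le> (\<Sum>j. ennreal (K * c j) * (ennreal (norm (1 - of_real (dyadic_point j) * z) powr (-\<alpha>) * (1 - (norm z)\<^sup>2) powr (\<alpha> - 2 - e)) * indicator (ball (0::complex) 1) z))"
      proof (cases "norm z < 1")
        case True
        let ?W = "(1 - (norm z)\<^sup>2) powr (\<alpha> - 2)"
        have "ennreal (norm (hilbert_op \<mu> \<alpha> f z) powr q * ?W) = ennreal (norm (hilbert_op \<mu> \<alpha> f z) powr q) * ennreal ?W"
          by (simp add: ennreal_mult)
        also have "\<dots> \<le> (ennreal (K * (1 - (norm z)\<^sup>2) powr (-e)) * (\<Sum>j. ennreal (c j * k j z))) * ennreal ?W"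
          by (intro mult_right_mono pt True) auto
        also have "\<dots> = (\<Sum>j. ennreal (c j * k j z)) * (ennreal (K * (1 - (norm z)\<^sup>2) powr (-e)) * ennreal ?W)"
          by (simp only: mult_ac)
        also have "\<dots> = (\<Sum>j. ennreal (c j * k j z) * (ennreal (K * (1 - (norm z)\<^sup>2) powr (-e)) * ennreal ?W))"
          by (rule ennreal_suminf_multc[symmetric])
        also have "\<dots> = (\<Sum>j. ennreal (K * c j) * ennreal (norm (1 - of_real (dyadic_point j) * z) powr (-\<alpha>) * (1 - (norm z)\<^sup>2) powr (\<alpha> - 2 - e)))"
        proof (intro suminf_cong)
          fix j
          have "(1 - (norm z)\<^sup>2) powr (-e) * ?W = (1 - (norm z)\<^sup>2) powr (\<alpha> - 2 - e)" by (simp flip: powr_add)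
          then have eq: "c j * k j z * (K * (1 - (norm z)\<^sup>2) powr (-e) * ?W) = K * c j * (k j z * (1 - (norm z)\<^sup>2) powr (\<alpha> - 2 - e))"
            by (simp add: mult_ac)
          have "ennreal (c j * k j z) * (ennreal (K * (1 - (norm z)\<^sup>2) powr (-e)) * ennreal ?W) = ennreal (c j * k j z * (K * (1 - (norm z)\<^sup>2) powr (-e) * ?W))"
            using K c0[of j] k0[of j z] by (simp add: ennreal_mult mult_ac)
          also have "\<dots> = ennreal (K * c j) * ennreal (k j z * (1 - (norm z)\<^sup>2) powr (\<alpha> - 2 - e))"
            unfolding eq using K c0[of j] k0[of j z] by (intro ennreal_mult) auto
          finally show "ennreal (c j * k j z) * (ennreal (K * (1 - (norm z)\<^sup>2) powr (-e)) * ennreal ?W)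
            = ennreal (K * c j) * ennreal (norm (1 - of_real (dyadic_point j) * z) powr (-\<alpha>) * (1 - (norm z)\<^sup>2) powr (\<alpha> - 2 - e))"
            unfolding k_def .
        qed
        finally show ?thesis using True by simp
      qed simp
    qed
    also have "\<dots> = (\<Sum>j. ennreal (K * c j) * (\<integral>\<^sup>+z\<in>ball (0::complex) 1. ennreal (norm (1 - of_real (dyadic_point j) * z) powr (-\<alpha>) * (1 - (norm z)\<^sup>2) powr (\<alpha> - 2 - e)) \<partial>lborel))"
      by (subst nn_integral_suminf, intro borel_measurable_times_ennreal borel_measurable_const dyadic_kernel_measurable,
          intro suminf_cong nn_integral_cmult dyadic_kernel_measurable)
    also have "\<dots> \<le> (\<Sum>j. ennreal (K * R * (((1/2)^j) powr (q / p) * radial_max f j powr q)))"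
    proof (intro suminf_le summableI)
      fix j
      have l: "1 - dyadic_point j = (1/2)^j" by (simp add: dyadic_point_def)
      have "ennreal (K * c j) * (\<integral>\<^sup>+z\<in>ball (0::complex) 1. ennreal (norm (1 - of_real (dyadic_point j) * z) powr (-\<alpha>) * (1 - (norm z)\<^sup>2) powr (\<alpha> - 2 - e)) \<partial>lborel)
        \<le> ennreal (K * c j) * ennreal (R * ((1/2)^j) powr (-e))"
        using R(2)[of "dyadic_point j"] dyadic_point[of j] unfolding l by (intro mult_left_mono) auto
      also have "\<dots> = ennreal (K * R * ((((1/2)^j) powr (q / p + e) * ((1/2)^j) powr (-e)) * radial_max f j powr q))"
        using c0[of j] R(1) K by (subst ennreal_mult[symmetric]) (auto simp: c_def mult_ac)
      also have "((1/2::real)^j) powr (q / p + e) * ((1/2)^j) powr (-e) = ((1/2)^j) powr (q / p)" by (simp flip: powr_add)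
      finally show "ennreal (K * c j) * (\<integral>\<^sup>+z\<in>ball (0::complex) 1. ennreal (norm (1 - of_real (dyadic_point j) * z) powr (-\<alpha>) * (1 - (norm z)\<^sup>2) powr (\<alpha> - 2 - e)) \<partial>lborel)
        \<le> ennreal (K * R * (((1/2)^j) powr (q / p) * radial_max f j powr q))" .
    qed
    also have "\<dots> \<le> ennreal (K * R * (E * hardy_norm p f powr q))"
    proof (rule suminf_ennreal_le)
      show "0 \<le> K * R * (((1/2)^j) powr (q / p) * radial_max f j powr q)" for j
        using K R by simp
      show "(\<Sum>j<N. K * R * (((1/2)^j) powr (q / p) * radial_max f j powr q)) \<le> K * R * (E * hardy_norm p f powr q)" for N
        unfolding sum_distrib_left[symmetric] using K R by (intro mult_left_mono E(2)[OF f]) auto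
    qed
    also have "K * R * (E * hardy_norm p f powr q) = B * hardy_norm p f powr q"
      by (simp add: B_def)
    finally show ?thesis using H(1) by blast
  qed
  show ?thesis
    by (rule hilbert_bounded_bergmanI[OF q0 _ B main]) (use \<alpha> in auto)
qed

section \<open>Test functions and necessity\<close>

text \<open>
  The power \<open>norm (peak_fun p a z) powr p\<close> equals $(1-a^2)/|1-az|^2$, which is the Poisson kernel
  when \<open>z\<close> is on the unit circle.  Functions of this family have Hardy norm at most 1 and are as large at
  \<open>a\<close> as the growth bound permits, up to a constant.
\<close>

definition peak_fun :: "real \<Rightarrow> real \<Rightarrow> complex \<Rightarrow> complex" where
  "peak_fun p a z = of_real ((1 - a\<^sup>2) powr (1 / p)) * (1 - of_real a * z) powr (- of_real (2 / p))"

lemma peak_fun_holomorphic: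
  assumes "0 < a"
  shows "peak_fun p a holomorphic_on ball 0 (1 / a)"
proof -
  have "1 - of_real a * z \<notin> \<real>\<^sub>\<le>\<^sub>0" if "z \<in> ball 0 (1 / a)" for z :: complex
  proof -
    have "norm (of_real a * z) < 1" using that assms by (simp add: norm_mult field_simps)
    then have "Re (of_real a * z) < 1" using complex_Re_le_cmod[of "of_real a * z"] by linarith
    then show ?thesis by (auto simp: complex_nonpos_Reals_iff)
  qed
  then show ?thesis unfolding peak_fun_def[abs_def] by (intro holomorphic_intros) auto
qed

lemma peak_fun_holomorphic_disc:
  assumes "0 < a" "a < 1"
  shows "peak_fun p a holomorphic_on ball 0 1"
  by (rule holomorphic_on_subset[OF peak_fun_holomorphic[OF assms(1)]]) (use assms in \<open>intro subset_ball, simp\<close>)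

lemma peak_fun_of_real:
  assumes "0 \<le> a" "a < 1" "0 \<le> t" "t < 1"
  shows "peak_fun p a (of_real t) = of_real ((1 - a\<^sup>2) powr (1 / p) * (1 - a * t) powr (- (2 / p)))"
proof -
  have "a * t < 1" using assms mult_strict_mono[of a 1 t 1] by simp
  then have "complex_of_real (1 - a * t) powr of_real (- (2 / p)) = of_real ((1 - a * t) powr (- (2 / p)))"
    by (intro powr_of_real) auto
  then show ?thesis by (simp add: peak_fun_def)
qed

lemma peak_fun_hardy:
  assumes p: "0 < p" and a: "0 < a" "a < 1"
  shows "peak_fun p a \<in> hardy_space p" "hardy_norm p (peak_fun p a) \<le> 1"
proof -
  have hol: "peak_fun p a holomorphic_on ball 0 1" by (rule peak_fun_holomorphic_disc[OF a])
  have mean: "hardy_mean p (peak_fun p a) r \<le> 1" if r: "0 < r" "r < 1" for r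
  proof -
    have ar: "0 < a * r" "a * r < 1" using a r mult_strict_mono[of a 1 r 1] by auto
    have ar2: "(a * r)\<^sup>2 < 1" using ar by (simp add: abs_square_less_1)
    have eq: "norm (peak_fun p a (of_real r * cis \<theta>)) powr p = (1 - a\<^sup>2) / (1 - (a * r)\<^sup>2) * ((1 - (a * r)\<^sup>2) / (norm (cis \<theta> - of_real (a * r)))\<^sup>2)" for \<theta>
    proof -
      have n: "norm (1 - of_real a * (of_real r * cis \<theta>)) = norm (cis \<theta> - of_real (a * r))"
        using norm_one_minus_cis[of "a * r" \<theta>] by (simp add: mult.assoc)
      have nz: "1 - of_real a * (of_real r * cis \<theta>) \<noteq> 0"
        by (rule one_minus_real_mult_nonzero) (use a r in \<open>auto simp: norm_mult\<close>)
      have a2: "0 \<le> 1 - a\<^sup>2" using a by (simp add: abs_square_le_1)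
      have "norm (peak_fun p a (of_real r * cis \<theta>)) = (1 - a\<^sup>2) powr (1 / p) * norm (cis \<theta> - of_real (a * r)) powr (- (2 / p))"
        unfolding peak_fun_def norm_mult norm_powr_minus_real[OF nz] n by simp
      then have "norm (peak_fun p a (of_real r * cis \<theta>)) powr p = (1 - a\<^sup>2) * norm (cis \<theta> - of_real (a * r)) powr (- 2)"
        using p a2 by (simp add: powr_mult powr_powr)
      also have "norm (cis \<theta> - of_real (a * r)) powr (- 2) = 1 / (norm (cis \<theta> - of_real (a * r)))\<^sup>2"
        by (simp add: powr_minus_divide)
      finally show ?thesis using ar2 by simp
    qed
    have "((\<lambda>\<theta>. (1 - a\<^sup>2) / (1 - (a * r)\<^sup>2) * ((1 - (a * r)\<^sup>2) / (norm (cis \<theta> - of_real (a * r)))\<^sup>2)) has_integral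
        (1 - a\<^sup>2) / (1 - (a * r)\<^sup>2) * (2 * pi)) {0..2*pi}"
    proof (rule has_integral_mult_right)
      have nr: "norm (complex_of_real (a * r)) = a * r" unfolding norm_of_real using ar by simp
      show "((\<lambda>\<theta>. (1 - (a * r)\<^sup>2) / (norm (cis \<theta> - of_real (a * r)))\<^sup>2) has_integral 2 * pi) {0..2*pi}"
        by (rule Poisson_kernel_integral[of "of_real (a * r)", unfolded nr, OF ar(2)])
    qed
    then have "2 * pi * hardy_mean p (peak_fun p a) r powr p = (1 - a\<^sup>2) / (1 - (a * r)\<^sup>2) * (2 * pi)"
      unfolding hardy_mean_powr[OF hol p r, symmetric] eq by (rule integral_unique)
    then have "2 * pi * hardy_mean p (peak_fun p a) r powr p = 2 * pi * ((1 - a\<^sup>2) / (1 - (a * r)\<^sup>2))"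
      by (simp only: mult.commute)
    then have "hardy_mean p (peak_fun p a) r powr p = (1 - a\<^sup>2) / (1 - (a * r)\<^sup>2)"
      by (rule mult_left_cancel[THEN iffD1, rotated]) simp
    also have "\<dots> \<le> 1"
    proof -
      have "(a * r)\<^sup>2 \<le> a\<^sup>2" using a r ar by (intro power_mono) auto
      then show ?thesis using ar2 by simp
    qed
    finally have "(hardy_mean p (peak_fun p a) r powr p) powr (1 / p) \<le> 1 powr (1 / p)"
      using p by (intro powr_mono2) auto
    then show ?thesis using p hardy_mean_nonneg by (simp add: powr_powr)
  qed
  show "peak_fun p a \<in> hardy_space p"
    unfolding hardy_space_def using hol mean by (auto intro!: bdd_aboveI2)
  show "hardy_norm p (peak_fun p a) \<le> 1"
    unfolding hardy_norm_def by (rule cSUP_least) (use mean in auto)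
qed

text \<open>
  The test functions are holomorphic on the disc of radius \<open>1 / a > 1\<close>, so their Taylor coefficients
  are absolutely summable.
\<close>

lemma peak_fun_moment_expansion:
  assumes \<mu>: "borel_measure_01 \<mu>" and fin: "finite_measure \<mu>" and a: "0 < a" "a < 1"
  shows "moment_expansion \<mu> (peak_fun p a)"
proof -
  have hol: "peak_fun p a holomorphic_on ball 0 1" by (rule peak_fun_holomorphic_disc[OF a])
  obtain R where R: "1 < R" "R < 1 / a" using a dense[of 1 "1 / a"] by auto
  have "summable (\<lambda>k. taylor_coeff (peak_fun p a) k * of_real R ^ k)"
    using holomorphic_power_series[OF peak_fun_holomorphic[OF a(1)], of "of_real R" p] R
    by (auto simp: taylor_coeff_def sums_iff)
  from powser_insidea[OF this, of 1] R
  have "summable (\<lambda>k. norm (taylor_coeff (peak_fun p a) k) * 1 ^ k)" by simp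
  from dilation_moment_sums[OF \<mu> fin hol _ _ this] show ?thesis
    unfolding moment_expansion_def using dilation_moment_sums(2)[OF \<mu> fin hol _ _ \<open>summable (\<lambda>k. norm (taylor_coeff (peak_fun p a) k) * 1 ^ k)\<close>, of 0]
    by auto
qed

lemma peak_fun_lower:
  fixes a p t :: real
  assumes p: "0 < p" and a: "0 < a" "a < 1" and t: "a \<le> t" "t < 1"
  shows "2 powr (- (2 / p)) * (1 - a) powr (- (1 / p)) \<le> (1 - a\<^sup>2) powr (1 / p) * (1 - a * t) powr (- (2 / p))"
proof -
  have at: "a * t < 1" "a * a \<le> a * t" using a t mult_strict_mono[of a 1 t 1] by auto
  have f: "1 - a\<^sup>2 = (1 - a) * (1 + a)" by (simp add: power2_eq_square algebra_simps)
  have "(1 - a) * 1 \<le> (1 - a) * (1 + a)" "(1 - a) * (1 + a) \<le> (1 - a) * 2" using a by (intro mult_left_mono; simp)+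
  then have s: "1 - a \<le> 1 - a\<^sup>2" "1 - a * t \<le> 2 * (1 - a)" using at f by (auto simp: power2_eq_square)
  have "2 powr (- (2 / p)) * (1 - a) powr (- (1 / p)) = (1 - a) powr (1 / p) * (2 * (1 - a)) powr (- (2 / p))"
  proof -
    have e: "1 / p + - (2 / p) = - (1 / p)" using p by (simp add: field_simps)
    have "(1 - a) powr (1 / p) * (1 - a) powr (- (2 / p)) = (1 - a) powr (- (1 / p))"
      unfolding powr_add[symmetric] e ..
    then show ?thesis unfolding powr_mult by (simp only: mult.left_commute[of "(1 - a) powr (1 / p)"])
  qed
  also have "\<dots> \<le> (1 - a\<^sup>2) powr (1 / p) * (1 - a * t) powr (- (2 / p))"
    using s at a p by (intro mult_mono powr_mono2 powr_mono2') auto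
  finally show ?thesis .
qed

lemma integral_lower_bound_tail:
  fixes g :: "real \<Rightarrow> real"
  assumes \<mu>: "borel_measure_01 \<mu>" and fin: "finite_measure \<mu>" and g: "integrable \<mu> g"
    and nn: "\<And>t. 0 \<le> t \<Longrightarrow> t < 1 \<Longrightarrow> 0 \<le> g t" and a: "0 \<le> a" and c: "\<And>t. a \<le> t \<Longrightarrow> t < 1 \<Longrightarrow> c \<le> g t"
  shows "c * measure \<mu> {a..<1} \<le> (LINT t|\<mu>. g t)"
proof -
  interpret finite_measure \<mu> by (rule fin)
  have s: "{a..<1} \<in> sets \<mu>" using a by (intro sets_borel_01[OF \<mu>]) auto
  have "integrable \<mu> (\<lambda>t. c * indicator {a..<1} t)"
    using s by (intro integrable_mult_right integrable_real_indicator) (auto simp: emeasure_eq_measure)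
  then have "(LINT t|\<mu>. c * indicator {a..<1} t) \<le> (LINT t|\<mu>. g t)"
    using nn a c by (intro integral_mono g) (auto simp: indicator_def space_borel_01[OF \<mu>])
  moreover have "{a..<1} \<inter> space \<mu> = {a..<1}" using a by (auto simp: space_borel_01[OF \<mu>])
  ultimately show ?thesis by simp
qed

text \<open>
  The integrand is positive, and on \<open>{a..<1}\<close> the numbers \<open>1 - a * t\<close> are at most \<open>2 * (1 - a)\<close>.
\<close>

lemma peak_fun_image_lower:
  assumes \<mu>: "borel_measure_01 \<mu>" and fin: "finite_measure \<mu>" and p: "0 < p" and a: "0 < a" "a < 1" and \<beta>: "0 < \<beta>"
  shows "2 powr (- (2 / p) - \<beta>) * a ^ n * (1 - a) powr (- (1 / p) - \<beta>) * measure \<mu> {a..<1}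
    \<le> norm (LINT t|\<mu>. of_real (t ^ n) * peak_fun p a (of_real t) * (1 - of_real t * of_real a) powr (- of_real \<beta>))"
proof -
  interpret finite_measure \<mu> by (rule fin)
  define g where "g t = t ^ n * ((1 - a\<^sup>2) powr (1 / p) * (1 - a * t) powr (- (2 / p))) * (1 - t * a) powr (- \<beta>)" for t
  have at: "a * t < 1" if "t < 1" "0 \<le> t" for t using a that mult_strict_mono[of a 1 t 1] by simp
  have cont: "continuous_on {0..1} g"
  proof -
    have "1 - a * t \<noteq> 0" "1 - t * a \<noteq> 0" if "t \<in> {0..1}" for t
    proof -
      have "a * t \<le> a" using that a by (intro mult_left_le) auto
      then have "a * t < 1" using a by linarith
      then show "1 - a * t \<noteq> 0" "1 - t * a \<noteq> 0" by (auto simp: mult.commute)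
    qed
    then show ?thesis unfolding g_def
      by (intro continuous_on_mult continuous_on_powr continuous_intros) auto
  qed
  have "compact (g ` {0..1})" by (rule compact_continuous_image[OF cont]) simp
  then obtain M where "\<forall>x\<in>g ` {0..1}. norm x \<le> M"
    using compact_imp_bounded bounded_iff by blast
  then have M: "norm (g t) \<le> M" if "t \<in> {0..1}" for t using that by blast
  have int: "integrable \<mu> g"
  proof (rule integrable_const_bound[of _ M])
    show "g \<in> borel_measurable \<mu>" by (rule measurable_borel_01[OF \<mu> continuous_on_subset[OF cont]]) auto
    show "AE t in \<mu>. norm (g t) \<le> M" by (rule AE_I2) (auto simp: space_borel_01[OF \<mu>] intro!: M[simplified])
  qed
  have eq: "of_real (t ^ n) * peak_fun p a (of_real t) * (1 - of_real t * of_real a) powr (- of_real \<beta>) = complex_of_real (g t)"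
    if "t \<in> space \<mu>" for t
  proof -
    have t: "0 \<le> t" "t < 1" using that by (auto simp: space_borel_01[OF \<mu>])
    have "complex_of_real (1 - t * a) powr of_real (- \<beta>) = of_real ((1 - t * a) powr (- \<beta>))"
      using at[OF t(2,1)] by (intro powr_of_real) (auto simp: mult.commute)
    then show ?thesis using a t by (simp add: g_def peak_fun_of_real)
  qed
  have "2 powr (- (2 / p) - \<beta>) * a ^ n * (1 - a) powr (- (1 / p) - \<beta>) * measure \<mu> {a..<1} \<le> (LINT t|\<mu>. g t)"
  proof (rule integral_lower_bound_tail[OF \<mu> fin int])
    fix t assume t: "a \<le> t" "t < 1"
    have "a * a \<le> a * t" using a t by (intro mult_left_mono) auto
    moreover have "1 - a * a \<le> 2 * (1 - a)"
    proof -
      have "0 \<le> (1 - a) * (1 - a)" by simp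
      then show ?thesis by (simp add: algebra_simps)
    qed
    ultimately have "1 - t * a \<le> 2 * (1 - a)" by (simp add: mult.commute)
    then have 1: "(2 * (1 - a)) powr (- \<beta>) \<le> (1 - t * a) powr (- \<beta>)"
      using at[of t] t a \<beta> by (intro powr_mono2') (auto simp: mult.commute)
    have "2 powr (- (2 / p) - \<beta>) * a ^ n * (1 - a) powr (- (1 / p) - \<beta>)
       = (a ^ n * (2 powr (- (2 / p)) * (1 - a) powr (- (1 / p)))) * (2 * (1 - a)) powr (- \<beta>)"
    proof -
      have "2 powr (- (2 / p) - \<beta>) = 2 powr (- (2 / p)) * 2 powr (- \<beta>)"
        "(1 - a) powr (- (1 / p) - \<beta>) = (1 - a) powr (- (1 / p)) * (1 - a) powr (- \<beta>)"
        by (simp_all flip: powr_add)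
      then show ?thesis unfolding powr_mult by (simp only: mult_ac)
    qed
    also have "\<dots> \<le> g t"
      unfolding g_def using 1 a t by (intro mult_mono power_mono peak_fun_lower[OF p a t]) auto
    finally show "2 powr (- (2 / p) - \<beta>) * a ^ n * (1 - a) powr (- (1 / p) - \<beta>) \<le> g t" .
  qed (use a in \<open>auto simp: g_def\<close>)
  also have "\<dots> \<le> norm (complex_of_real (LINT t|\<mu>. g t))" by simp
  also have "complex_of_real (LINT t|\<mu>. g t) = (LINT t|\<mu>. of_real (t ^ n) * peak_fun p a (of_real t) * (1 - of_real t * of_real a) powr (- of_real \<beta>))"
    unfolding integral_complex_of_real[symmetric] by (rule Bochner_Integration.integral_cong[OF refl eq[symmetric]])
  finally show ?thesis .
qed

lemma hilbert_bounded_peak: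
  assumes b: "hilbert_bounded \<mu> \<alpha> (hardy_space p) (hardy_norm p) Y NY" and p: "0 < p"
  shows "\<exists>C\<ge>0. \<forall>a. 0 < a \<longrightarrow> a < 1 \<longrightarrow> hilbert_op \<mu> \<alpha> (peak_fun p a) \<in> Y \<and> NY (hilbert_op \<mu> \<alpha> (peak_fun p a)) \<le> C"
proof -
  obtain C where C: "\<And>f. f \<in> hardy_space p \<Longrightarrow> hilbert_op \<mu> \<alpha> f \<in> Y \<and> NY (hilbert_op \<mu> \<alpha> f) \<le> C * hardy_norm p f"
    using b unfolding hilbert_bounded_def bounded_operator_def by blast
  have "hilbert_op \<mu> \<alpha> (peak_fun p a) \<in> Y \<and> NY (hilbert_op \<mu> \<alpha> (peak_fun p a)) \<le> \<bar>C\<bar>" if a: "0 < a" "a < 1" for a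
  proof -
    note P = peak_fun_hardy[OF p a]
    have "C * hardy_norm p (peak_fun p a) \<le> \<bar>C\<bar> * 1"
      using P hardy_norm_nonneg[OF P(1)] by (intro mult_mono) auto
    then show ?thesis using C[OF P(1)] by auto
  qed
  then show ?thesis by (intro exI[of _ "\<bar>C\<bar>"]) auto
qed

lemma carlesonI:
  assumes \<mu>: "borel_measure_01 \<mu>" and fin: "finite_measure \<mu>" and s: "0 \<le> s"
    and C: "0 \<le> C" "\<And>t. 1/2 \<le> t \<Longrightarrow> t < 1 \<Longrightarrow> measure \<mu> {t..<1} \<le> C * (1 - t) powr s"
  shows "carleson s \<mu>"
  unfolding carleson_def
proof (rule log_carlesonI[OF \<mu> fin _ s C(1)])
  fix t :: real assume t: "1/2 \<le> t" "t < 1"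
  have "ln (2 / (1 - t)) powr 0 * measure \<mu> {t..<1} \<le> measure \<mu> {t..<1}" by (simp add: powr_zero_eq_one)
  also have "\<dots> \<le> C * (1 - t) powr s" by (rule C(2)[OF t])
  finally show "ln (2 / (1 - t)) powr 0 * measure \<mu> {t..<1} \<le> C * (1 - t) powr s" .
qed simp

text \<open>
  The derivative of the image of the test function is evaluated at \<open>a\<close>, where the Bloch norm allows at
  most \<open>C / (1 - a)\<close>.
\<close>

theorem bloch_necessity:
  assumes \<mu>: "borel_measure_01 \<mu>" and fin: "finite_measure \<mu>" and p: "0 < p" and \<alpha>: "1 < \<alpha>"
    and b: "hilbert_bounded \<mu> \<alpha> (hardy_space p) (hardy_norm p) bloch_space bloch_norm"
  shows "carleson (1 / p + \<alpha>) \<mu>"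
proof -
  obtain C where C: "0 \<le> C" "\<And>a. 0 < a \<Longrightarrow> a < 1 \<Longrightarrow> hilbert_op \<mu> \<alpha> (peak_fun p a) \<in> bloch_space \<and> bloch_norm (hilbert_op \<mu> \<alpha> (peak_fun p a)) \<le> C"
    using hilbert_bounded_peak[OF b p] by blast
  define c where "c = \<alpha> * (2 powr (- (2 / p) - (\<alpha> + 1)) * (1 / 2))"
  have c: "0 < c" using \<alpha> by (simp add: c_def)
  show ?thesis
  proof (rule carlesonI[OF \<mu> fin])
    show "0 \<le> 1 / p + \<alpha>" "0 \<le> C / c" using p \<alpha> C c by auto
    fix a :: real assume a2: "1/2 \<le> a" "a < 1"
    then have a: "0 < a" "a < 1" by auto
    let ?F = "hilbert_op \<mu> \<alpha> (peak_fun p a)"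
    have m: "moment_expansion \<mu> (peak_fun p a)" by (rule peak_fun_moment_expansion[OF \<mu> fin a])
    have \<alpha>0: "0 < \<alpha>" using \<alpha> by simp
    have "deriv ?F (of_real a) = of_real \<alpha> * (LINT t|\<mu>. of_real (t ^ 1) * peak_fun p a (of_real t) * (1 - of_real t * of_real a) powr (- of_real (\<alpha> + 1)))"
      using hilbert_op_integral(4)[OF \<mu> fin \<alpha>0 m, of "of_real a"] a by simp
    then have "norm (deriv ?F (of_real a)) = \<alpha> * norm (LINT t|\<mu>. of_real (t ^ 1) * peak_fun p a (of_real t) * (1 - of_real t * of_real a) powr (- of_real (\<alpha> + 1)))"
      using \<alpha>0 by (simp add: norm_mult)
    moreover have "\<alpha> * (2 powr (- (2 / p) - (\<alpha> + 1)) * a ^ 1 * (1 - a) powr (- (1 / p) - (\<alpha> + 1)) * measure \<mu> {a..<1})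
       \<le> \<alpha> * norm (LINT t|\<mu>. of_real (t ^ 1) * peak_fun p a (of_real t) * (1 - of_real t * of_real a) powr (- of_real (\<alpha> + 1)))"
      using \<alpha>0 by (intro mult_left_mono peak_fun_image_lower[OF \<mu> fin p a]) auto
    ultimately have low: "\<alpha> * (2 powr (- (2 / p) - (\<alpha> + 1)) * a ^ 1 * (1 - a) powr (- (1 / p) - (\<alpha> + 1)) * measure \<mu> {a..<1}) \<le> norm (deriv ?F (of_real a))"
      by linarith
    have bdd: "bdd_above ((\<lambda>z. (1 - (norm z)\<^sup>2) * norm (deriv ?F z)) ` ball 0 1)"
      using C(2)[OF a] by (auto simp: bloch_space_def)
    have "(1 - (norm (of_real a :: complex))\<^sup>2) * norm (deriv ?F (of_real a)) \<le> (SUP z\<in>ball 0 1. (1 - (norm z)\<^sup>2) * norm (deriv ?F z))"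
      by (rule cSUP_upper[OF _ bdd]) (use a in auto)
    also have "\<dots> \<le> bloch_norm ?F" by (simp add: bloch_norm_def)
    also have "\<dots> \<le> C" using C(2)[OF a] by simp
    finally have up: "(1 - a\<^sup>2) * norm (deriv ?F (of_real a)) \<le> C" using a by simp
    have a2': "1 - a \<le> 1 - a\<^sup>2" using a mult_left_mono[of a 1 a] by (simp add: power2_eq_square)
    have "c * (1 - a) powr (- (1 / p) - \<alpha>) * measure \<mu> {a..<1} = (1 - a) * (\<alpha> * (2 powr (- (2 / p) - (\<alpha> + 1)) * (1 / 2) * (1 - a) powr (- (1 / p) - (\<alpha> + 1)) * measure \<mu> {a..<1}))"
    proof -
      have "(1 - a) powr (- (1 / p) - \<alpha>) = (1 - a) * (1 - a) powr (- (1 / p) - (\<alpha> + 1))"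
        using a powr_add[of "1 - a" 1 "- (1 / p) - (\<alpha> + 1)"] by simp
      then show ?thesis by (simp add: c_def)
    qed
    also have "\<dots> \<le> (1 - a) * (\<alpha> * (2 powr (- (2 / p) - (\<alpha> + 1)) * a ^ 1 * (1 - a) powr (- (1 / p) - (\<alpha> + 1)) * measure \<mu> {a..<1}))"
      using a2 \<alpha>0 by (intro mult_left_mono mult_right_mono) auto
    also have "\<dots> \<le> (1 - a\<^sup>2) * norm (deriv ?F (of_real a))"
      using low a2' a \<alpha>0 by (intro mult_mono mult_nonneg_nonneg) auto
    also note up
    finally have "c * (1 - a) powr (- (1 / p) - \<alpha>) * measure \<mu> {a..<1} \<le> C" .
    moreover have "(1 - a) powr (- (1 / p) - \<alpha>) * (1 - a) powr (1 / p + \<alpha>) = 1" using a by (simp flip: powr_add)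
    ultimately show "measure \<mu> {a..<1} \<le> C / c * (1 - a) powr (1 / p + \<alpha>)"
      using c mult_right_mono[of "c * (1 - a) powr (- (1 / p) - \<alpha>) * measure \<mu> {a..<1}" C "(1 - a) powr (1 / p + \<alpha>)"]
      by (simp add: field_simps)
  qed
qed

text \<open>
  The circle-mean bound for \<open>norm F powr q\<close> is integrated over the radii between \<open>(1 + a) / 2\<close> and 1,
  for which the distance from \<open>a\<close> is comparable to \<open>1 - a\<close>.
\<close>

lemma bergman_growth:
  assumes q: "0 < q" and \<beta>: "-1 < \<beta>"
  shows "\<exists>D>0. \<forall>F\<in>bergman_space q \<beta>. \<forall>a\<in>{0..<1}.
    norm (F (of_real a)) powr q * (1 - a) powr (\<beta> + 2) \<le> D * bergman_norm q \<beta> F powr q"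
proof -
  define c where "c = min 1 (2 powr \<beta>)"
  have c: "0 < c" by (simp add: c_def)
  define k where "k = 1 / 2 * (c * (pi / 2))"
  have k: "0 < k" using c by (simp add: k_def)
  define D where "D = pi / (\<beta> + 1) * (2 powr (\<beta> + 1) * (\<beta> + 1) / k)"
  have D: "0 < D" using k \<beta> by (simp add: D_def)
  have "norm (F (of_real a)) powr q * (1 - a) powr (\<beta> + 2) \<le> D * bergman_norm q \<beta> F powr q"
    if F: "F \<in> bergman_space q \<beta>" and a: "a \<in> {0..<1}" for F and a :: real
  proof -
    have hol: "F holomorphic_on ball 0 1" using F by (simp add: bergman_space_def)
    (* On the circles of radius at least b the distance r - a is at least (1 - a) / 2, and r >= 1/2
       takes care of the Jacobian factor r. *)
    define b where "b = (1 + a) / 2"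
    have b: "1 / 2 \<le> b" "b < 1" "1 - b = (1 - a) / 2" "a < b" using a by (auto simp: b_def field_simps)
    define X where "X = norm (F (of_real a)) powr q"
    have X: "0 \<le> X" by (simp add: X_def)
    have "ennreal (k * (1 - a) * X * ((1 - b) powr (\<beta> + 1) / (\<beta> + 1))) = ennreal (k * (1 - a) * X) * (\<integral>\<^sup>+r\<in>{b..1}. ennreal ((1 - r) powr \<beta>) \<partial>lborel)"
      unfolding nn_integral_powr_to_one[OF \<beta> b(2)] using k a X \<beta> by (intro ennreal_mult) auto
    also have "\<dots> = (\<integral>\<^sup>+r. ennreal (k * (1 - a) * X) * (ennreal ((1 - r) powr \<beta>) * indicator {b..1} r) \<partial>lborel)"
      by (rule nn_integral_cmult[symmetric]) measurable
    also have "\<dots> \<le> (\<integral>\<^sup>+r\<in>{0..<1}. ennreal (r * integral {0..2*pi} (\<lambda>\<theta>. norm (F (of_real r * cis \<theta>)) powr q * (1 - (norm (of_real r * cis \<theta>))\<^sup>2) powr \<beta>)) \<partial>lborel)"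
    proof (rule nn_integral_mono_AE)
      have "AE r in lborel. r \<noteq> (1::real)" by (rule AE_lborel_singleton)
      then show "AE r in lborel. ennreal (k * (1 - a) * X) * (ennreal ((1 - r) powr \<beta>) * indicator {b..1} r) \<le>
        ennreal (r * integral {0..2*pi} (\<lambda>\<theta>. norm (F (of_real r * cis \<theta>)) powr q * (1 - (norm (of_real r * cis \<theta>))\<^sup>2) powr \<beta>)) * indicator {0..<1} r"
      proof eventually_elim
        case (elim r)
        show ?case
        proof (cases "b \<le> r \<and> r < 1")
          case r: True
          then have r0: "0 < r" "1 / 2 \<le> r" "a < r" using b by auto
          let ?J = "integral {0..2*pi} (\<lambda>\<theta>. norm (F (of_real r * cis \<theta>)) powr q)"
          have "X \<le> 1 / (pi * (r - a)) * ?J"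
            using norm_powr_le_circle_mean[OF hol q, of "of_real a" r] r r0 a by (simp add: X_def)
          then have "pi * (r - a) * X \<le> ?J" using r0 by (simp add: field_simps)
          moreover have "pi * ((1 - a) / 2) * X \<le> pi * (r - a) * X"
            using r b X by (intro mult_right_mono mult_left_mono) auto
          ultimately have J: "pi * ((1 - a) / 2) * X \<le> ?J" by linarith
          have w: "c * (1 - r) powr \<beta> \<le> (1 - r\<^sup>2) powr \<beta>"
          proof -
            have "c \<le> (1 + r) powr \<beta>"
            proof (cases "0 \<le> \<beta>")
              case True
              have "1 powr \<beta> \<le> (1 + r) powr \<beta>" using True r0 by (intro powr_mono2) auto
              then show ?thesis by (simp add: c_def)
            next
              case False
              have "2 powr \<beta> \<le> (1 + r) powr \<beta>" using False r0 r by (intro powr_mono2') auto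
              then show ?thesis by (simp add: c_def)
            qed
            then have "c * (1 - r) powr \<beta> \<le> (1 + r) powr \<beta> * (1 - r) powr \<beta>" by (intro mult_right_mono) auto
            also have "\<dots> = (1 - r\<^sup>2) powr \<beta>"
              using r r0 by (subst powr_mult[symmetric]) (auto simp: power2_eq_square algebra_simps)
            finally show ?thesis .
          qed
          have "k * (1 - a) * X * (1 - r) powr \<beta> = 1 / 2 * ((pi * ((1 - a) / 2) * X) * (c * (1 - r) powr \<beta>))"
            by (simp add: k_def)
          also have "\<dots> \<le> r * (?J * (1 - r\<^sup>2) powr \<beta>)"
            using r0 J w X a c by (intro mult_mono mult_nonneg_nonneg order_trans[OF _ J]) auto
          also have "\<dots> = r * integral {0..2*pi} (\<lambda>\<theta>. norm (F (of_real r * cis \<theta>)) powr q * (1 - (norm (of_real r * cis \<theta>))\<^sup>2) powr \<beta>)"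
            using r0 by (simp add: norm_mult)
          finally have "ennreal (k * (1 - a) * X * (1 - r) powr \<beta>) \<le> ennreal (r * integral {0..2*pi} (\<lambda>\<theta>. norm (F (of_real r * cis \<theta>)) powr q * (1 - (norm (of_real r * cis \<theta>))\<^sup>2) powr \<beta>))"
            by (rule ennreal_leI)
          then show ?thesis using r r0 k X a by (simp add: ennreal_mult)
        next
          case False
          then have "indicator {b..1} r = (0::ennreal)" using elim by (auto simp: indicator_def)
          then show ?thesis by simp
        qed
      qed
    qed
    also have "\<dots> = (\<integral>\<^sup>+z\<in>ball 0 1. ennreal (norm (F z) powr q * (1 - (norm z)\<^sup>2) powr \<beta>) \<partial>lborel)"
      by (rule nn_integral_disc_polar[OF continuous_on_bergman_integrand[OF hol q], symmetric]) auto
    also have "\<dots> = ennreal (pi / (\<beta> + 1) * bergman_norm q \<beta> F powr q)"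
      by (rule bergman_nn_integral(2)[OF hol q F \<beta>])
    finally have le: "k * (1 - a) * X * ((1 - b) powr (\<beta> + 1) / (\<beta> + 1)) \<le> pi / (\<beta> + 1) * bergman_norm q \<beta> F powr q"
      using \<beta> by (subst (asm) ennreal_le_iff) auto
    have "(1 - b) powr (\<beta> + 1) = (1 - a) powr (\<beta> + 1) / 2 powr (\<beta> + 1)"
      unfolding b(3) using a by (subst powr_divide) auto
    moreover have "(1 - a) powr (\<beta> + 2) = (1 - a) * (1 - a) powr (\<beta> + 1)"
    proof -
      have "(1 - a) powr (\<beta> + 2) = (1 - a) powr (1 + (\<beta> + 1))" by (rule arg_cong[where f="\<lambda>x. (1 - a) powr x"]) simp
      then show ?thesis using a by (simp only: powr_add[of _ 1]) simp
    qed
    ultimately have "X * (1 - a) powr (\<beta> + 2) = (k * (1 - a) * X * ((1 - b) powr (\<beta> + 1) / (\<beta> + 1))) * (2 powr (\<beta> + 1) * (\<beta> + 1) / k)"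
      using k \<beta> by simp
    also have "\<dots> \<le> (pi / (\<beta> + 1) * bergman_norm q \<beta> F powr q) * (2 powr (\<beta> + 1) * (\<beta> + 1) / k)"
      using k \<beta> by (intro mult_right_mono le) auto
    also have "\<dots> = D * bergman_norm q \<beta> F powr q" by (simp add: D_def)
    finally show ?thesis unfolding X_def .
  qed
  then show ?thesis using D by blast
qed

text \<open>
  The lower bound for the image of the test function at \<open>a\<close>, compared with the growth
  \<open>(1 - a) powr (-\<alpha>/q)\<close> that the Bergman norm permits there.
\<close>

theorem bergman_power_necessity:
  assumes \<mu>: "borel_measure_01 \<mu>" and fin: "finite_measure \<mu>" and p: "0 < p" and \<alpha>: "1 < \<alpha>"
    and q: "1 < q" and q': "1 / q + 1 / q' = 1"
    and b: "hilbert_bounded \<mu> \<alpha> (hardy_space p) (hardy_norm p) (bergman_space q (\<alpha> - 2)) (bergman_norm q (\<alpha> - 2))"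
  shows "carleson (1 / p + \<alpha> / q') \<mu>"
proof -
  have q0: "0 < q" and \<alpha>0: "0 < \<alpha>" using q \<alpha> by auto
  have s: "\<alpha> / q' = \<alpha> - \<alpha> / q"
  proof -
    have "\<alpha> * (1 / q + 1 / q') = \<alpha>" unfolding q' by simp
    then show ?thesis by (simp add: distrib_left)
  qed
  obtain C where C: "0 \<le> C" "\<And>a. 0 < a \<Longrightarrow> a < 1 \<Longrightarrow> hilbert_op \<mu> \<alpha> (peak_fun p a) \<in> bergman_space q (\<alpha> - 2) \<and> bergman_norm q (\<alpha> - 2) (hilbert_op \<mu> \<alpha> (peak_fun p a)) \<le> C"
    using hilbert_bounded_peak[OF b p] by blast
  obtain D where D: "0 < D" "\<And>F a. F \<in> bergman_space q (\<alpha> - 2) \<Longrightarrow> a \<in> {0..<1} \<Longrightarrow>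
     norm (F (of_real a)) powr q * (1 - a) powr (\<alpha> - 2 + 2) \<le> D * bergman_norm q (\<alpha> - 2) F powr q"
    using bergman_growth[OF q0, of "\<alpha> - 2"] \<alpha> by auto
  define c where "c = 2 powr (- (2 / p) - \<alpha>)"
  have c: "0 < c" by (simp add: c_def)
  define K where "K = (D * C powr q) powr (1 / q)"
  show ?thesis
  proof (rule carlesonI[OF \<mu> fin])
    have "\<alpha> / q \<le> \<alpha>" using q \<alpha> by (simp add: field_simps)
    then show "0 \<le> 1 / p + \<alpha> / q'" using p unfolding s by simp
    show "0 \<le> K / c" using c by (simp add: K_def)
    fix a :: real assume a2: "1/2 \<le> a" "a < 1"
    then have a: "0 < a" "a < 1" by auto
    let ?F = "hilbert_op \<mu> \<alpha> (peak_fun p a)"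
    have m: "moment_expansion \<mu> (peak_fun p a)" by (rule peak_fun_moment_expansion[OF \<mu> fin a])
    have "?F (of_real a) = (LINT t|\<mu>. of_real (t ^ 0) * peak_fun p a (of_real t) * (1 - of_real t * of_real a) powr (- of_real \<alpha>))"
      using hilbert_op_integral(3)[OF \<mu> fin \<alpha>0 m, of "of_real a"] a by simp
    then have low: "c * (1 - a) powr (- (1 / p) - \<alpha>) * measure \<mu> {a..<1} \<le> norm (?F (of_real a))"
      using peak_fun_image_lower[OF \<mu> fin p a \<alpha>0, of 0] by (simp add: c_def)
    have "norm (?F (of_real a)) powr q * (1 - a) powr (\<alpha> - 2 + 2) \<le> D * bergman_norm q (\<alpha> - 2) ?F powr q"
      using C(2)[OF a] a by (intro D(2)) auto
    also have "\<dots> \<le> D * C powr q"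
      using C(2)[OF a] D(1) q0 by (intro mult_left_mono powr_mono2 bergman_norm_nonneg) auto
    finally have "norm (?F (of_real a)) powr q * (1 - a) powr \<alpha> \<le> D * C powr q" by simp
    then have "(norm (?F (of_real a)) powr q * (1 - a) powr \<alpha>) powr (1 / q) \<le> K"
      unfolding K_def using q0 by (intro powr_mono2) auto
    moreover have "(norm (?F (of_real a)) powr q * (1 - a) powr \<alpha>) powr (1 / q) = norm (?F (of_real a)) * (1 - a) powr (\<alpha> / q)"
      using q0 by (simp add: powr_mult powr_powr)
    ultimately have up: "norm (?F (of_real a)) * (1 - a) powr (\<alpha> / q) \<le> K" by simp
    have "c * (1 - a) powr (- (1 / p) - \<alpha>) * measure \<mu> {a..<1} * (1 - a) powr (\<alpha> / q) \<le> norm (?F (of_real a)) * (1 - a) powr (\<alpha> / q)"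
      by (intro mult_right_mono low) auto
    also note up
    finally have "c * measure \<mu> {a..<1} * ((1 - a) powr (- (1 / p) - \<alpha>) * (1 - a) powr (\<alpha> / q)) \<le> K"
      by (simp only: mult_ac)
    moreover have "(1 - a) powr (- (1 / p) - \<alpha>) * (1 - a) powr (\<alpha> / q) = (1 - a) powr (- (1 / p + \<alpha> / q'))"
      unfolding s powr_add[symmetric] by (rule arg_cong[where f="\<lambda>x. (1 - a) powr x"]) simp
    ultimately have "c * measure \<mu> {a..<1} * (1 - a) powr (- (1 / p + \<alpha> / q')) \<le> K" by simp
    then have "c * measure \<mu> {a..<1} * (1 - a) powr (- (1 / p + \<alpha> / q')) * (1 - a) powr (1 / p + \<alpha> / q') \<le> K * (1 - a) powr (1 / p + \<alpha> / q')"
      by (rule mult_right_mono) simp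
    moreover have "(1 - a) powr (- (1 / p + \<alpha> / q')) * (1 - a) powr (1 / p + \<alpha> / q') = 1"
      using a by (simp flip: powr_add)
    ultimately have "c * measure \<mu> {a..<1} \<le> K * (1 - a) powr (1 / p + \<alpha> / q')"
      unfolding mult.assoc by simp
    then show "measure \<mu> {a..<1} \<le> K / c * (1 - a) powr (1 / p + \<alpha> / q')"
      using c by (simp add: field_simps)
  qed
qed

text \<open>
  The series of \<open>a ^ n / (n + 1)\<close> is the logarithmic series divided by \<open>a < 1\<close>.
\<close>

lemma ln_le_power_sum_limit:
  assumes a: "0 < a" "a < (1::real)" and B: "\<And>N. (\<Sum>n<N. a ^ n / (n + 1)) \<le> B"
  shows "ln (1 / (1 - a)) \<le> B"
proof -
  have "ln (1 - a) = (\<Sum>n. (-1) ^ n * (1 / real (n + 1)) * ((1 - a) - 1) ^ Suc n)"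
    by (rule ln_series) (use a in auto)
  also have "(\<lambda>n. (-1) ^ n * (1 / real (n + 1)) * ((1 - a) - 1) ^ Suc n) = (\<lambda>n. - (a * (a ^ n / (n + 1))))"
  proof
    fix n
    have e1: "((1 - a) - 1) ^ Suc n = (-1) ^ Suc n * a ^ Suc n" by (simp add: power_minus[of a])
    have "(-1::real) ^ n * (-1) ^ Suc n = -1" by (simp flip: power_mult_distrib)
    have "(-1) ^ n * (1 / real (n + 1)) * ((1 - a) - 1) ^ Suc n = ((-1) ^ n * (-1) ^ Suc n) * (1 / real (n + 1)) * a ^ Suc n"
      unfolding e1 by (simp only: mult_ac)
    also have "(-1::real) ^ n * (-1) ^ Suc n = -1" by fact
    finally show "(-1) ^ n * (1 / real (n + 1)) * ((1 - a) - 1) ^ Suc n = - (a * (a ^ n / (n + 1)))" by simp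
  qed
  finally have ln: "ln (1 - a) = (\<Sum>n. - (a * (a ^ n / (n + 1))))" .
  have sm: "summable (\<lambda>n. a ^ n / (n + 1))"
  proof (rule summable_comparison_test'[OF summable_geometric[of a]])
    show "norm (a ^ n / (n + 1)) \<le> a ^ n" for n using a by (simp add: field_simps)
  qed (use a in auto)
  have "(\<Sum>n. a ^ n / (n + 1)) \<le> B" by (rule suminf_le_const[OF sm B])
  moreover have "0 \<le> (\<Sum>n. a ^ n / (n + 1))" using a by (intro suminf_nonneg sm) auto
  moreover have "- ln (1 - a) = a * (\<Sum>n. a ^ n / (n + 1))"
    unfolding ln sums_unique[OF sums_minus[OF sums_mult[OF summable_sums[OF sm]]], symmetric] by simp
  ultimately have "- ln (1 - a) \<le> 1 * B"
    using a mult_mono[of a 1 "\<Sum>n. a ^ n / (n + 1)" B] by simp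
  then show ?thesis using a by (simp add: ln_div)
qed

text \<open>
  The image of the test function has the coefficients \<open>binom_coeff \<alpha> n * M n\<close> with nonnegative moments
  \<open>M n\<close>.  Hardy's inequality is applied on each circle and integrated over the radii with the weight of
  the Bergman norm.  The Beta integral that arises for the \<open>n\<close>-th coefficient is inversely proportional
  to \<open>binom_coeff \<alpha> n\<close>, so that the sum of \<open>M n / (n + 1)\<close> is bounded by the norm.  As \<open>M n\<close> is at least a
  multiple of \<open>a ^ n * (1 - a) powr (-1/p) * measure \<mu> {a..<1}\<close>, this sum contains the logarithm.
\<close>

theorem bergman_one_necessity:
  assumes \<mu>: "borel_measure_01 \<mu>" and fin: "finite_measure \<mu>" and p: "0 < p" and \<alpha>: "1 < \<alpha>"
    and b: "hilbert_bounded \<mu> \<alpha> (hardy_space p) (hardy_norm p) (bergman_space 1 (\<alpha> - 2)) (bergman_norm 1 (\<alpha> - 2))"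
  shows "log_carleson 1 (1 / p) \<mu>"
proof -
  interpret finite_measure \<mu> by (rule fin)
  have \<alpha>0: "0 < \<alpha>" and \<alpha>1: "0 < \<alpha> - 1" using \<alpha> by auto
  obtain C where C: "0 \<le> C" "\<And>a. 0 < a \<Longrightarrow> a < 1 \<Longrightarrow> hilbert_op \<mu> \<alpha> (peak_fun p a) \<in> bergman_space 1 (\<alpha> - 2) \<and> bergman_norm 1 (\<alpha> - 2) (hilbert_op \<mu> \<alpha> (peak_fun p a)) \<le> C"
    using hilbert_bounded_peak[OF b p] by blast
  define c where "c = 2 powr (- (2 / p))"
  have c: "0 < c" by (simp add: c_def)
  show ?thesis
  proof (rule log_carlesonI[OF \<mu> fin])
    show "0 \<le> 1 / p" "0 \<le> 2 * (pi * C / c)" using p C c by auto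
    fix a :: real assume a2: "1/2 \<le> a" "a < 1"
    then have a: "0 < a" "a < 1" by auto
    let ?F = "hilbert_op \<mu> \<alpha> (peak_fun p a)"
    have m: "moment_expansion \<mu> (peak_fun p a)" by (rule peak_fun_moment_expansion[OF \<mu> fin a])
    note H = hilbert_op_integral[OF \<mu> fin \<alpha>0 m]
    have hF: "?F holomorphic_on ball 0 1" using H(1) by (simp add: hilbert_op_defined_def)
    define \<phi> where "\<phi> t = (1 - a\<^sup>2) powr (1 / p) * (1 - a * t) powr (- (2 / p))" for t
    have \<phi>0: "0 \<le> \<phi> t" for t by (simp add: \<phi>_def)
    define M where "M n = (LINT t|\<mu>. t ^ n * \<phi> t)" for n
    have M_eq: "(LINT t|\<mu>. of_real (t ^ n) * peak_fun p a (of_real t)) = complex_of_real (M n)" for n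
      unfolding M_def integral_complex_of_real[symmetric]
      by (rule Bochner_Integration.integral_cong[OF refl]) (use a in \<open>auto simp: space_borel_01[OF \<mu>] peak_fun_of_real \<phi>_def\<close>)
    have int: "integrable \<mu> (\<lambda>t. t ^ n * \<phi> t)" for n
    proof -
      have "integrable \<mu> (\<lambda>t. peak_fun p a (of_real t))" using m by (simp add: moment_expansion_def)
      from kernel_series_integral(2)[OF \<mu> this \<alpha>0, of 0 n]
      have "integrable \<mu> (\<lambda>t. of_real (t ^ n) * peak_fun p a (of_real t))" by simp
      then have "integrable \<mu> (\<lambda>t. complex_of_real (t ^ n * \<phi> t))"
        by (rule Bochner_Integration.integrable_cong[OF refl, THEN iffD1, rotated])
           (use a in \<open>auto simp: space_borel_01[OF \<mu>] peak_fun_of_real \<phi>_def\<close>)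
      then show ?thesis by (simp only: complex_of_real_integrable_eq)
    qed
    have M0: "0 \<le> M n" for n
      unfolding M_def by (rule Bochner_Integration.integral_nonneg) (auto simp: space_borel_01[OF \<mu>] \<phi>0)
    have M_low: "a ^ n * (c * (1 - a) powr (- (1 / p))) * measure \<mu> {a..<1} \<le> M n" for n
      unfolding M_def
    proof (rule integral_lower_bound_tail[OF \<mu> fin int])
      show "a ^ n * (c * (1 - a) powr (- (1 / p))) \<le> t ^ n * \<phi> t" if "a \<le> t" "t < 1" for t
        unfolding \<phi>_def c_def using a that by (intro mult_mono power_mono peak_fun_lower[OF p a that]) auto
    qed (use a \<phi>0 in auto)
    define A where "A n = binom_coeff \<alpha> n * M n" for n
    have A0: "0 \<le> A n" for n using M0 binom_coeff_pos[OF \<alpha>0] by (simp add: A_def less_imp_le)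
    have Fs: "(\<lambda>n. of_real (A n) * z ^ n) sums ?F z" if "norm z < 1" for z
    proof -
      have "hilbert_coeff \<mu> \<alpha> (peak_fun p a) n = of_real (A n)" for n
        unfolding hilbert_coeff_eq(1)[OF m] M_eq A_def by simp
      then show ?thesis using H(2)[OF that] by simp
    qed
    (* The Gamma factors of the binomial coefficient and of the Beta integral cancel. *)
    have coeff: "A n * Beta (real n + 1) (\<alpha> - 1) = M n / (\<alpha> - 1)" for n
    proof -
      have "Gamma \<alpha> = (\<alpha> - 1) * Gamma (\<alpha> - 1)"
      proof -
        have "\<alpha> - 1 \<notin> \<int>\<^sub>\<le>\<^sub>0" using \<alpha>1 by (auto simp: nonpos_Ints_def)
        from Gamma_plus1[OF this] show ?thesis by simp
      qed
      moreover have "Gamma (real n + 1) = fact n" using Gamma_fact[of n, where 'a=real] by (simp add: add.commute)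
      moreover have "Gamma (real n + \<alpha>) \<noteq> 0" "Gamma (\<alpha> - 1) \<noteq> 0"
      proof -
        have "0 < real n + \<alpha>" using \<alpha>0 by simp
        from Gamma_real_pos[OF this] Gamma_real_pos[OF \<alpha>1]
        show "Gamma (real n + \<alpha>) \<noteq> 0" "Gamma (\<alpha> - 1) \<noteq> 0" by linarith+
      qed
      moreover have "x / (f * ((\<alpha> - 1) * y)) * m * (f * y / x) = m / (\<alpha> - 1)"
        if "x \<noteq> 0" "y \<noteq> 0" "f \<noteq> 0" for x y f m :: real
        using that \<alpha>1 by (simp add: field_simps)
      moreover have "real n + 1 + (\<alpha> - 1) = real n + \<alpha>" by simp
      ultimately show ?thesis unfolding A_def binom_coeff_def Beta_def by (simp only: fact_nonzero not_False_eq_True)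
    qed
    have main: "(\<Sum>n<N. M n / (n + 1)) \<le> pi * C" for N
    proof -
      have "ennreal (\<Sum>n<N. M n / (\<alpha> - 1) / (n + 1)) = (\<Sum>n<N. ennreal (2 * A n / (n + 1)) * ennreal (Beta (real n + 1) (\<alpha> - 1) / 2))"
      proof -
        have "Beta (real n + 1) (\<alpha> - 1) \<ge> 0" for n
          unfolding Beta_def using \<alpha>1 by (intro divide_nonneg_nonneg mult_nonneg_nonneg less_imp_le Gamma_real_pos) auto
        then have "ennreal (2 * A n / (n + 1)) * ennreal (Beta (real n + 1) (\<alpha> - 1) / 2) = ennreal (M n / (\<alpha> - 1) / (n + 1))" for n
        proof -
          have "2 * x / w * (y / 2) = x * y / w" for x y w :: real by simp
          from this[of "A n" "real (n + 1)" "Beta (real n + 1) (\<alpha> - 1)"]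
          have eq: "2 * A n / real (n + 1) * (Beta (real n + 1) (\<alpha> - 1) / 2) = M n / (\<alpha> - 1) / real (n + 1)"
            unfolding coeff .
          have "ennreal (2 * A n / real (n + 1)) * ennreal (Beta (real n + 1) (\<alpha> - 1) / 2)
              = ennreal (2 * A n / real (n + 1) * (Beta (real n + 1) (\<alpha> - 1) / 2))"
            using A0[of n] \<open>\<And>n. Beta (real n + 1) (\<alpha> - 1) \<ge> 0\<close>[of n] by (intro ennreal_mult[symmetric]) auto
          then show ?thesis unfolding eq coeff .
        qed
        then show ?thesis using M0 \<alpha>1 by simp
      qed
      also have "\<dots> \<le> (\<Sum>n<N. ennreal (2 * A n / (n + 1)) * (\<integral>\<^sup>+r\<in>{0..<1}. ennreal (r * r ^ n * (1 - r\<^sup>2) powr (\<alpha> - 2)) \<partial>lborel))"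
        by (intro sum_mono mult_left_mono radial_Beta_lower[OF \<alpha>]) auto
      also have "\<dots> = (\<Sum>n<N. (\<integral>\<^sup>+r. ennreal (2 * A n / (n + 1)) * (ennreal (r * r ^ n * (1 - r\<^sup>2) powr (\<alpha> - 2)) * indicator {0..<1} r) \<partial>lborel))"
        by (intro sum.cong refl nn_integral_cmult[symmetric]) measurable
      also have "\<dots> = (\<integral>\<^sup>+r. (\<Sum>n<N. ennreal (2 * A n / (n + 1)) * (ennreal (r * r ^ n * (1 - r\<^sup>2) powr (\<alpha> - 2)) * indicator {0..<1} r)) \<partial>lborel)"
        by (rule nn_integral_sum[symmetric]) measurable
      also have "\<dots> \<le> (\<integral>\<^sup>+r\<in>{0..<1}. ennreal (r * integral {0..2*pi} (\<lambda>\<theta>. norm (?F (of_real r * cis \<theta>)) powr 1 * (1 - (norm (of_real r * cis \<theta>))\<^sup>2) powr (\<alpha> - 2))) \<partial>lborel)"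
      proof (rule nn_integral_mono)
        fix r :: real
        show "(\<Sum>n<N. ennreal (2 * A n / (n + 1)) * (ennreal (r * r ^ n * (1 - r\<^sup>2) powr (\<alpha> - 2)) * indicator {0..<1} r))
          \<le> ennreal (r * integral {0..2*pi} (\<lambda>\<theta>. norm (?F (of_real r * cis \<theta>)) powr 1 * (1 - (norm (of_real r * cis \<theta>))\<^sup>2) powr (\<alpha> - 2))) * indicator {0..<1} r"
        proof (cases "0 \<le> r \<and> r < 1")
          case r: True
          let ?w = "(1 - r\<^sup>2) powr (\<alpha> - 2)"
          have "(\<Sum>n<N. ennreal (2 * A n / (n + 1)) * ennreal (r * r ^ n * ?w)) = ennreal (\<Sum>n<N. (2 * A n / (n + 1)) * (r * r ^ n * ?w))"
          proof -
            have "(\<Sum>n<N. ennreal (2 * A n / (n + 1)) * ennreal (r * r ^ n * ?w)) = (\<Sum>n<N. ennreal ((2 * A n / (n + 1)) * (r * r ^ n * ?w)))"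
              using A0 r by (intro sum.cong refl ennreal_mult[symmetric]) auto
            also have "\<dots> = ennreal (\<Sum>n<N. (2 * A n / (n + 1)) * (r * r ^ n * ?w))"
              using A0 r by (intro sum_ennreal) auto
            finally show ?thesis .
          qed
          also have "(\<Sum>n<N. (2 * A n / (n + 1)) * (r * r ^ n * ?w)) = (2 * r * ?w) * (\<Sum>n<N. A n * r ^ n / (n + 1))"
            by (simp add: sum_distrib_left mult_ac)
          also have "\<dots> \<le> (2 * r * ?w) * (1 / 2 * integral {0..2*pi} (\<lambda>\<theta>. norm (?F (of_real r * cis \<theta>))))"
            using r by (intro mult_left_mono Hardy_pairing[OF A0 Fs]) auto
          also have "\<dots> = r * integral {0..2*pi} (\<lambda>\<theta>. norm (?F (of_real r * cis \<theta>)) powr 1 * (1 - (norm (of_real r * cis \<theta>))\<^sup>2) powr (\<alpha> - 2))"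
            using r by (simp add: norm_mult)
          finally show ?thesis using r by (simp add: ennreal_leI)
        next
          case False
          then have "indicator {0..<1} r = (0::ennreal)" by (auto simp: indicator_def)
          then show ?thesis by simp
        qed
      qed
      also have "\<dots> = (\<integral>\<^sup>+z\<in>ball 0 1. ennreal (norm (?F z) powr 1 * (1 - (norm z)\<^sup>2) powr (\<alpha> - 2)) \<partial>lborel)"
        by (rule nn_integral_disc_polar[OF continuous_on_bergman_integrand[OF hF], symmetric]) auto
      also have "\<dots> = ennreal (pi / (\<alpha> - 2 + 1) * bergman_norm 1 (\<alpha> - 2) ?F powr 1)"
        using C(2)[OF a] \<alpha> by (intro bergman_nn_integral(2)[OF hF]) auto
      also have "\<dots> \<le> ennreal (pi / (\<alpha> - 1) * C)"
        using C(2)[OF a] \<alpha>1 bergman_norm_nonneg by (intro ennreal_leI) (simp add: divide_right_mono)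
      finally have "(\<Sum>n<N. M n / (\<alpha> - 1) / (n + 1)) \<le> pi / (\<alpha> - 1) * C"
        using C(1) \<alpha>1 by (subst (asm) ennreal_le_iff) auto
      moreover have "(\<Sum>n<N. M n / (\<alpha> - 1) / (n + 1)) = (\<Sum>n<N. M n / (n + 1)) / (\<alpha> - 1)"
        by (simp add: sum_divide_distrib mult.commute)
      ultimately show ?thesis using \<alpha>1 by (simp add: field_simps)
    qed
    define m0 where "m0 = c * (1 - a) powr (- (1 / p)) * measure \<mu> {a..<1}"
    have m0: "0 \<le> m0" using c by (simp add: m0_def)
    have part: "m0 * (\<Sum>n<N. a ^ n / (n + 1)) \<le> pi * C" for N
    proof -
      have "m0 * (\<Sum>n<N. a ^ n / (n + 1)) = (\<Sum>n<N. a ^ n * m0 / (n + 1))"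
        by (simp add: sum_distrib_left mult_ac)
      also have "\<dots> \<le> (\<Sum>n<N. M n / (n + 1))"
        using M_low by (intro sum_mono divide_right_mono) (auto simp: m0_def mult_ac)
      also note main[of N]
      finally show ?thesis .
    qed
    have "m0 * ln (1 / (1 - a)) \<le> pi * C"
    proof (cases "m0 = 0")
      case False
      then have "ln (1 / (1 - a)) \<le> pi * C / m0"
        using part m0 by (intro ln_le_power_sum_limit[OF a]) (simp add: field_simps)
      then show ?thesis using False m0 by (simp add: field_simps)
    qed (use C in simp)
    (* This is where a >= 1/2 enters: then 2 <= 1 / (1 - a). *)
    moreover have "ln (2 / (1 - a)) \<le> 2 * ln (1 / (1 - a))"
    proof -
      have "2 \<le> 1 / (1 - a)" using a2 by (simp add: field_simps)
      then have "2 * (1 / (1 - a)) \<le> (1 / (1 - a)) * (1 / (1 - a))" using a by (intro mult_right_mono) auto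
      then have "2 / (1 - a) \<le> (1 / (1 - a)) * (1 / (1 - a))" by simp
      then have "ln (2 / (1 - a)) \<le> ln ((1 / (1 - a)) * (1 / (1 - a)))" using a by (subst ln_le_cancel_iff) auto
      also have "\<dots> = 2 * ln (1 / (1 - a))" using a by (subst ln_mult) auto
      finally show ?thesis .
    qed
    ultimately have "m0 * ln (2 / (1 - a)) \<le> 2 * (pi * C)"
      using mult_left_mono[of "ln (2 / (1 - a))" "2 * ln (1 / (1 - a))" m0] m0 by linarith
    then have "m0 * ln (2 / (1 - a)) * (1 - a) powr (1 / p) \<le> 2 * (pi * C) * (1 - a) powr (1 / p)"
      by (rule mult_right_mono) simp
    moreover have "m0 * ln (2 / (1 - a)) * (1 - a) powr (1 / p) = c * (ln (2 / (1 - a)) * measure \<mu> {a..<1}) * ((1 - a) powr (- (1 / p)) * (1 - a) powr (1 / p))"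
      unfolding m0_def by (simp only: mult_ac)
    moreover have "(1 - a) powr (- (1 / p)) * (1 - a) powr (1 / p) = 1" using a by (simp flip: powr_add)
    ultimately have "c * (ln (2 / (1 - a)) * measure \<mu> {a..<1}) \<le> 2 * (pi * C) * (1 - a) powr (1 / p)" by simp
    moreover have "0 < ln (2 / (1 - a))" using a by simp
    ultimately show "ln (2 / (1 - a)) powr 1 * measure \<mu> {a..<1} \<le> 2 * (pi * C / c) * (1 - a) powr (1 / p)"
      using c by (simp add: field_simps)
  qed simp
qed

section \<open>The characterization\<close>

theorem theorem3p1:
  fixes p \<alpha> :: real and \<mu> :: "real measure"
  assumes "0 < p" and "1 < \<alpha>"
    and "borel_measure_01 \<mu>"
    and "p \<le> 1 \<Longrightarrow> carleson (1 / p) \<mu>"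
    and "1 < p \<Longrightarrow> carleson 1 \<mu>"
  shows
    "(\<forall>q q' :: real. 1 < q \<and> \<alpha> * p \<le> q \<and> 1 / q + 1 / q' = 1 \<longrightarrow>
        (hilbert_bounded \<mu> \<alpha> (hardy_space p) (hardy_norm p)
            (bergman_space q (\<alpha> - 2)) (bergman_norm q (\<alpha> - 2))
          \<longleftrightarrow> carleson (1 / p + \<alpha> / q') \<mu>)) \<and>
     (p \<le> 1 \<longrightarrow>
        (hilbert_bounded \<mu> \<alpha> (hardy_space p) (hardy_norm p)
            (bergman_space 1 (\<alpha> - 2)) (bergman_norm 1 (\<alpha> - 2))
          \<longleftrightarrow> log_carleson 1 (1 / p) \<mu>)) \<and>
     (hilbert_bounded \<mu> \<alpha> (hardy_space p) (hardy_norm p) bloch_space bloch_norm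
        \<longleftrightarrow> carleson (1 / p + \<alpha>) \<mu>)"
proof -
  have fin: "finite_measure \<mu>"
    using assms(4,5) log_carleson_finite[OF assms(3)] unfolding carleson_def by (cases "p \<le> 1") auto
  show ?thesis
  proof (intro conjI allI impI)
    fix q q' :: real assume q: "1 < q \<and> \<alpha> * p \<le> q \<and> 1 / q + 1 / q' = 1"
    then show "hilbert_bounded \<mu> \<alpha> (hardy_space p) (hardy_norm p) (bergman_space q (\<alpha> - 2)) (bergman_norm q (\<alpha> - 2))
          \<longleftrightarrow> carleson (1 / p + \<alpha> / q') \<mu>"
      using bergman_power_necessity[OF assms(3) fin assms(1,2)] bergman_power_sufficiency[OF assms(3,1,2)] by blast
  next
    assume "p \<le> 1"
    then show "hilbert_bounded \<mu> \<alpha> (hardy_space p) (hardy_norm p) (bergman_space 1 (\<alpha> - 2)) (bergman_norm 1 (\<alpha> - 2))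
          \<longleftrightarrow> log_carleson 1 (1 / p) \<mu>"
      using bergman_one_necessity[OF assms(3) fin assms(1,2)] bergman_one_sufficiency[OF assms(3,1) _ assms(2)] by blast
  next
    show "hilbert_bounded \<mu> \<alpha> (hardy_space p) (hardy_norm p) bloch_space bloch_norm \<longleftrightarrow> carleson (1 / p + \<alpha>) \<mu>"
      using bloch_necessity[OF assms(3) fin assms(1,2)] bloch_sufficiency[OF assms(3,1,2)] by blast
  qed
qed

end
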